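(* Let $n\ge 1$. For any integral lattice $\Lambda\subset\mathbb{R}^n$, $$d(I(\Lambda))\le 2\lfloor n/2\rfloor .$$ In particular, if $\Lambda$ is strongly modular, then at most $2\lfloor n/2\rfloor$ distinct primes divide the level $\ell$ of $\Lambda$. Moreover, this bound is attained in every dimension: for every $n\ge 1$ there exists a strongly modular integral lattice in $\mathbb{R}^n$ whose level is divisible by exactly $2\lfloor n/2\rfloor$ distinct primes.
   Context: Lattices in euclidean $\mathbb{R}^n$ have full rank $n$. For a lattice $\Lambda$, $\Lambda^*$ denotes the dual lattice with respect to the euclidean inner product; $\Lambda$ is integral if $\Lambda\subseteq\Lambda^*$. The level of an integral lattice $\Lambda$ is the smallest positive integer $\ell$ with $\ell\Lambda^*\subseteq\Lambda$. For a positive integer $\ell$, $W(\ell)$ is the elementary abelian $2$-group of positive divisors $m\|\ell$ (i.e. $m\mid\ell$ and $\gcd(m,\ell/m)=1$), with multiplication $m*m'=mm'/\gcd(m,m')^2$. For $\Lambda$ integral of level $\ell$ and $m\in W(\ell)$ put $$\Lambda_m=\sqrt{m}\,(\Lambda^*\cap m^{-1}\Lambda).$$ Define the subgroup $$I(\Lambda)=\{m\in W(\ell)\mid \Lambda=\sigma\Lambda_m \text{ for some } \sigma\in \mathrm{O}_n(\mathbb{R})\}$$ of $W(\ell)$. The lattice $\Lambda$ is called strongly modular if $I(\Lambda)=W(\ell)$. For an elementary abelian $2$-group $A$, $d(A)$ denotes its dimension over $\mathbb{F}_2$. *)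

theory Defs
  imports "HOL-Analysis.Analysis" "HOL-Algebra.FiniteProduct"
    "HOL-Computational_Algebra.Primes"
begin

text \<open>A full-rank lattice: the integer span of a vector space basis \<open>B\<close> of the whole space.\<close>

definition euclidean_lattice :: "'a::euclidean_space set \<Rightarrow> bool" where
  "euclidean_lattice L \<longleftrightarrow>
     (\<exists>B. independent B \<and> span B = UNIV \<and>
          L = {\<Sum>b\<in>B. of_int (c b) *\<^sub>R b | c :: 'a \<Rightarrow> int. True})"

definition dual_lattice :: "'a::euclidean_space set \<Rightarrow> 'a set" where
  "dual_lattice L = {y. \<forall>x\<in>L. x \<bullet> y \<in> \<int>}"

definition integral_lattice :: "'a::euclidean_space set \<Rightarrow> bool" where
  "integral_lattice L \<longleftrightarrow> euclidean_lattice L \<and> L \<subseteq> dual_lattice L"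

definition level :: "'a::euclidean_space set \<Rightarrow> nat" where
  "level L = (LEAST l. 0 < l \<and> (\<lambda>x. real l *\<^sub>R x) ` dual_lattice L \<subseteq> L)"

definition W :: "nat \<Rightarrow> nat monoid" where
  "W l = \<lparr>carrier = {m. m dvd l \<and> coprime m (l div m)},
          monoid.mult = (\<lambda>m m'. m * m' div (gcd m m')\<^sup>2),
          one = 1\<rparr>"

definition partial_dual :: "nat \<Rightarrow> 'a::euclidean_space set \<Rightarrow> 'a set" where
  "partial_dual m L =
     (\<lambda>x. sqrt (real m) *\<^sub>R x) ` (dual_lattice L \<inter> (\<lambda>x. inverse (real m) *\<^sub>R x) ` L)"

definition I_set :: "'a::euclidean_space set \<Rightarrow> nat set" where
  "I_set L = {m \<in> carrier (W (level L)).
                \<exists>\<sigma>. orthogonal_transformation \<sigma> \<and> L = \<sigma> ` partial_dual m L}"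

definition I_group :: "'a::euclidean_space set \<Rightarrow> nat monoid" where
  "I_group L = (W (level L))\<lparr>carrier := I_set L\<rparr>"

definition strongly_modular :: "'a::euclidean_space set \<Rightarrow> bool" where
  "strongly_modular L \<longleftrightarrow> integral_lattice L \<and> I_set L = carrier (W (level L))"

text \<open>
  A finite elementary abelian 2-group, written multiplicatively, as a vector space over the
  field with two elements. The linear combination of the elements of \<open>B\<close> with coefficients
  \<open>c b \<in> {0, 1}\<close> is the product of the powers \<open>b [^] c b\<close>; \<open>B\<close> is a basis if every element
  is such a combination in exactly one way.
\<close>

definition F2_basis :: "('a, 'b) monoid_scheme \<Rightarrow> 'a set \<Rightarrow> bool" where
  "F2_basis G B \<longleftrightarrow> finite B \<and> B \<subseteq> carrier G \<and>
     (\<forall>x\<in>carrier G. \<exists>!c. c \<in> B \<rightarrow>\<^sub>E {0, 1::nat} \<and>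
        x = finprod G (\<lambda>b. b [^]\<^bsub>G\<^esub> c b) B)"

definition F2_dim :: "('a, 'b) monoid_scheme \<Rightarrow> nat" where
  "F2_dim G = (THE d. \<exists>B. F2_basis G B \<and> card B = d)"

lemma (in comm_group) card_carrier_F2_basis:
  assumes "F2_basis G B"
  shows "card (carrier G) = 2 ^ card B"
proof -
  let ?f = "\<lambda>c. finprod G (\<lambda>b. b [^] (c b :: nat)) B"
  have B: "finite B" "B \<subseteq> carrier G"
    and ex1: "\<And>x. x \<in> carrier G \<Longrightarrow> \<exists>!c. c \<in> B \<rightarrow>\<^sub>E {0, 1::nat} \<and> x = ?f c"
    using assms by (auto simp: F2_basis_def)
  have closed: "?f c \<in> carrier G" for c
    using B by (intro finprod_closed) auto
  have "bij_betw ?f (B \<rightarrow>\<^sub>E {0, 1}) (carrier G)"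
  proof (rule bij_betw_imageI)
    show "inj_on ?f (B \<rightarrow>\<^sub>E {0, 1})"
    proof (rule inj_onI)
      fix c d
      assume "c \<in> B \<rightarrow>\<^sub>E {0, 1}" "d \<in> B \<rightarrow>\<^sub>E {0, 1}" "?f c = ?f d"
      then show "c = d"
        by (intro Uniq_D[OF conjunct2[OF iffD1[OF ex1_iff_ex_Uniq, OF ex1[OF closed[of c]]]]]) simp_all
    qed
    show "?f ` (B \<rightarrow>\<^sub>E {0, 1}) = carrier G"
    proof (intro equalityI subsetI)
      fix x assume "x \<in> carrier G"
      from ex1_implies_ex[OF ex1[OF this]] show "x \<in> ?f ` (B \<rightarrow>\<^sub>E {0, 1})"
        by (elim exE conjE) (rule image_eqI)
    next
      fix x assume "x \<in> ?f ` (B \<rightarrow>\<^sub>E {0, 1})"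
      then show "x \<in> carrier G"
        by (elim imageE) (simp only: closed)
    qed
  qed
  then have "card (carrier G) = card (B \<rightarrow>\<^sub>E {0, 1::nat})"
    by (rule bij_betw_same_card[symmetric])
  also have "\<dots> = card {0, 1::nat} ^ card B"
    using B by (simp only: card_PiE prod_constant)
  also have "card {0, 1::nat} = 2"
    by simp
  finally show ?thesis .
qed

lemma (in comm_group) F2_dim_eq_card:
  assumes "F2_basis G B"
  shows "F2_dim G = card B"
  unfolding F2_dim_def
proof (rule the_equality)
  show "\<exists>B'. F2_basis G B' \<and> card B' = card B"
    using assms by blast
next
  fix d assume "\<exists>B'. F2_basis G B' \<and> card B' = d"
  then obtain B' where "F2_basis G B'" "card B' = d"
    by blast
  then have "(2::nat) ^ d = 2 ^ card B"
    using card_carrier_F2_basis[of B'] card_carrier_F2_basis[OF assms] by simp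
  then show "d = card B"
    by simp
qed

end

theory Submission
  imports Defs "HOL-Algebra.Sylow" "HOL-Algebra.Group_Action" "HOL-Algebra.Multiplicative_Group"
begin

text \<open>
  The orthogonal maps \<open>\<sigma>\<close> with \<open>\<Lambda> = \<sigma> \<Lambda>\<^sub>m\<close> for some \<open>m\<close> form a finite group \<open>H\<close> that contains the
  automorphism group of \<open>\<Lambda>\<close>, and in particular \<open>-1\<close>, as the kernel of a surjection onto \<open>I(\<Lambda>)\<close>. So the upper bound
  is a statement about a Sylow 2-subgroup \<open>P\<close> of \<open>H\<close>: an elementary abelian quotient of a finite
  2-group of real \<open>n \<times> n\<close> matrices has rank at most \<open>n\<close>. For odd \<open>n\<close> the determinant splits off
  the central element \<open>-1\<close>, which gives \<open>n - 1\<close>.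

  The rank bound is proved by induction on the dimension. If \<open>P\<close> does not consist of \<open>\<plusminus> 1\<close> only,
  there is a \<open>y\<close> in \<open>P\<close> that is central of order 2 modulo \<open>\<plusminus> 1\<close>, so \<open>y\<^sup>2 = \<plusminus> 1\<close> and every element
  of \<open>P\<close> commutes or anticommutes with \<open>y\<close>. If \<open>y\<^sup>2 = -1\<close>, a subgroup of index at most 2 is complex
  linear, and the same argument over the complex numbers gives a bound that is better by one. If
  \<open>y\<^sup>2 = 1\<close>, the two eigenspaces of \<open>y\<close> are preserved or swapped. A swap would lose one in the
  induction; this is repaired by bounding the product of the orders of two successive elementary
  abelian layers \<open>X/Y\<close> and \<open>Z/Z'\<close> by \<open>2\<close> to the power \<open>2n - 1\<close>.

  For the sharpness, the lattice in a single plane is \<open>{(u, v). p dvd v \<and> q dvd u - v}\<close>, of level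
  \<open>p\<^sup>2 q\<^sup>2\<close>. The swap of the coordinates and the reflection \<open>(u, v) \<mapsto> (u, - v)\<close> realize \<open>p\<^sup>2\<close> and
  \<open>q\<^sup>2\<close>. Planes for different pairs of primes are scaled so that each of them is modular
  at the primes of the others.
\<close>

section \<open>Groups of prime power order\<close>

text \<open>The obstacle is the index 2 that a swap costs: the bounds on the two eigenspaces already
  add up to the full exponent. The way out is that commutators are products of squares, so they are
  trivial in an elementary abelian quotient. The pointwise stabilizers of the two eigenspaces,
  conjugate under the swap, therefore agree modulo the kernel, and both contributions can be read
  off as two successive layers on one and the same eigenspace. Two successive layers lose a factor 2
  automatically, because a scalar -1 can contribute to only one of them, and this loss pays for the
  swap. The two-layer estimate in turn survives swaps: each of the two eigenspaces leaves a spare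
  factor 2, whereas in a chain of groups a swap in the lower layer forces one in the group above it,
  so that a single factor is due. The plane lattice comes from the extreme group for n = 2, the
  symmetry group of the square, dihedral of order 8, whose quotient by -1 is the Klein four-group.
  Its matrices are integral in the standard coordinates, so the similarity factors
  \<open>sqrt m\<close> have to be rational; this explains the squares in the level.\<close>

lemma (in group) p_group_center:
  assumes p: "prime p" and ord: "order G = p ^ k" and nontriv: "1 < order G"
  shows "\<exists>x\<in>carrier G. x \<noteq> \<one> \<and> (\<forall>g\<in>carrier G. g \<otimes> x = x \<otimes> g)"
proof (rule ccontr)
  assume no: "\<not> ?thesis"
  let ?\<phi> = "\<lambda>g. \<lambda>h\<in>carrier G. g \<otimes> h \<otimes> inv g"
  interpret A: group_action G "carrier G" ?\<phi>
    by (rule action_by_conjugation)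
  have fin: "finite (carrier G)"
    using nontriv by (auto simp: order_def intro: ccontr)
  let ?O = "orbits G (carrier G) ?\<phi>"
  have part: "partition (carrier G) ?O"
    by (rule A.orbit_partition)
  have finO: "finite ?O"
    using fin by (simp add: orbits_def)
  have sum: "card (carrier G) = (\<Sum>C\<in>?O. card C)"
  proof -
    have "card (\<Union>?O) = (\<Sum>C\<in>?O. card C)"
    proof (rule card_Union_disjoint)
      show "pairwise disjnt ?O"
        using A.disjoint_union by (auto simp: pairwise_def disjnt_def)
      fix C assume "C \<in> ?O"
      then show "finite C"
        using fin by (auto simp: orbits_def orbit_def)
    qed
    then show ?thesis
      using A.orbits_coverture by simp
  qed
  have one: "orbit G ?\<phi> \<one> = {\<one>}"
  proof (intro equalityI subsetI)
    fix y assume "y \<in> {\<one>}"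
    then show "y \<in> orbit G ?\<phi> \<one>"
      unfolding orbit_def by (intro CollectI exI[of _ \<one>]) simp
  qed (auto simp: orbit_def)
  \<comment> \<open>By the orbit-stabilizer theorem the length is a power of p, and length 1 would
    make the element central. The class equation then gives p dvd 1.\<close>
  have dvd: "p dvd card C" if C: "C \<in> ?O - {{\<one>}}" for C
  proof -
    obtain x where x: "x \<in> carrier G" "C = orbit G ?\<phi> x"
      using C by (auto simp: orbits_def)
    have "x \<noteq> \<one>" using x C one by auto
    then obtain g where g: "g \<in> carrier G" "g \<otimes> x \<noteq> x \<otimes> g"
      using no x by blast
    have "card C dvd p ^ k"
      unfolding x(2) ord[symmetric] A.orbit_stabilizer_theorem[OF x(1), symmetric] by (rule dvd_triv_left)
    then obtain i where i: "card C = p ^ i"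
      using p divides_primepow_nat by blast
    have inC: "x \<in> C" "g \<otimes> x \<otimes> inv g \<in> C"
      subgoal using x A.orbit_refl[of x] by simp
      subgoal using x g unfolding x(2) orbit_def by (intro CollectI exI[of _ g]) simp
      done
    have "g \<otimes> x \<otimes> inv g \<noteq> x"
      using g x(1) by (simp add: inv_solve_right')
    then have "card C \<noteq> 1"
      using inC by (auto simp: card_1_singleton_iff)
    then show ?thesis
      using i by (cases i) auto
  qed
  have mem: "{\<one>} \<in> ?O"
    unfolding orbits_def by (intro CollectI exI[of _ \<one>]) (simp only: one one_closed simp_thms)
  have "card (carrier G) = 1 + (\<Sum>C\<in>?O - {{\<one>}}. card C)"
    using sum sum.remove[OF finO mem, of card] by simp
  moreover have "p dvd (\<Sum>C\<in>?O - {{\<one>}}. card C)"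
    using dvd by (intro dvd_sum) auto
  moreover have "p dvd card (carrier G)"
    using ord nontriv unfolding order_def by (cases k) auto
  ultimately have "p dvd 1"
    by (simp only: dvd_add_left_iff)
  then show False using p by (simp add: prime_nat_iff)
qed

text \<open>A nontrivial central element of \<open>G Mod N\<close> is squared until the next square
  is trivial; the last nontrivial power is a central involution, and \<open>x\<close> represents it.
  Centrality is phrased by commutators, so that no quotient appears in the statement.\<close>

lemma (in group) two_group_mod_normal_central_involution:
  assumes ord: "order G = 2 ^ k" and N: "N \<lhd> G" and proper: "N \<noteq> carrier G"
  shows "\<exists>x\<in>carrier G - N. x \<otimes> x \<in> N \<and> (\<forall>g\<in>carrier G. g \<otimes> x \<otimes> inv g \<otimes> inv x \<in> N)"
proof -
  interpret N: normal N G by (rule N)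
  interpret Q: group "G Mod N" by (rule N.factorgroup_is_group)
  have fin: "finite (carrier G)"
    using ord unfolding order_def by (metis card.infinite power_not_zero zero_neq_numeral)
  have lag: "order (G Mod N) * card N = 2 ^ k"
    using lagrange[OF N.subgroup_axioms] ord by (simp add: order_def FactGroup_def)
  then have "order (G Mod N) dvd 2 ^ k"
    by (metis dvd_triv_left)
  then obtain i where i: "order (G Mod N) = 2 ^ i"
    using divides_primepow_nat[of 2] by auto
  have "card N < card (carrier G)"
    using proper N.subset fin by (meson psubsetI psubset_card_mono)
  then have "1 < order (G Mod N)"
    using lag ord i one_less_power[of "2::nat" i] by (cases "i = 0") (auto simp: order_def)
  then obtain c where c: "c \<in> carrier (G Mod N)" "c \<noteq> \<one>\<^bsub>G Mod N\<^esub>"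
      "\<And>d. d \<in> carrier (G Mod N) \<Longrightarrow> d \<otimes>\<^bsub>G Mod N\<^esub> c = c \<otimes>\<^bsub>G Mod N\<^esub> d"
    using Q.p_group_center[of 2 i] i by auto
  define c' where "c' j = c [^]\<^bsub>G Mod N\<^esub> ((2::nat) ^ j)" for j
  have c'i: "c' i = \<one>\<^bsub>G Mod N\<^esub>"
    using Q.pow_order_eq_1[OF c(1)] i by (simp add: c'_def)
  have c'0: "c' 0 \<noteq> \<one>\<^bsub>G Mod N\<^esub>"
    using c(2) Q.nat_pow_eone[OF c(1)] by (simp only: c'_def power_0) simp
  have carr: "c' j \<in> carrier (G Mod N)" for j
    using c by (simp add: c'_def)
  have comm: "d \<otimes>\<^bsub>G Mod N\<^esub> c' j = c' j \<otimes>\<^bsub>G Mod N\<^esub> d" if "d \<in> carrier (G Mod N)" for d j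
    unfolding c'_def using Q.group_commutes_pow[OF c(3)[OF that, symmetric] c(1) that] by simp
  have sq: "c' (Suc j) = c' j \<otimes>\<^bsub>G Mod N\<^esub> c' j" for j
    by (simp only: c'_def power_Suc mult_2 Q.nat_pow_mult[OF c(1)])
  obtain j where j: "c' j \<noteq> \<one>\<^bsub>G Mod N\<^esub>" "c' (Suc j) = \<one>\<^bsub>G Mod N\<^esub>"
  proof -
    have "\<exists>j<i. c' j \<noteq> \<one>\<^bsub>G Mod N\<^esub> \<and> c' (Suc j) = \<one>\<^bsub>G Mod N\<^esub>"
      using ex_least_nat_less[of "\<lambda>j. c' j = \<one>\<^bsub>G Mod N\<^esub>", OF c'i c'0] by blast
    then show ?thesis using that by blast
  qed
  obtain x where x: "x \<in> carrier G" "c' j = N #> x"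
    using carr[of j] by (auto simp: FactGroup_def RCOSETS_def)
  have one: "\<one>\<^bsub>G Mod N\<^esub> = N"
    by (simp add: FactGroup_def)
  have "x \<notin> N"
    using j(1) coset_join2[OF x(1) N.is_subgroup] unfolding x(2) one by blast
  moreover have "x \<otimes> x \<in> N"
  proof -
    have "N #> (x \<otimes> x) = N"
      using j(2) sq[of j] unfolding x(2) one by (simp add: FactGroup_def N.rcos_sum[OF x(1) x(1)])
    then show ?thesis
      using rcos_self[OF m_closed[OF x(1) x(1)] N.is_subgroup] by simp
  qed
  moreover have "g \<otimes> x \<otimes> inv g \<otimes> inv x \<in> N" if g: "g \<in> carrier G" for g
  proof -
    have "N #> g \<in> carrier (G Mod N)"
      using g by (auto simp: FactGroup_def RCOSETS_def)
    from comm[OF this, of j] have "N #> (g \<otimes> x) = N #> (x \<otimes> g)"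
      unfolding x(2) by (simp add: FactGroup_def N.rcos_sum[OF x(1) g] N.rcos_sum[OF g x(1)])
    then have "g \<otimes> x \<in> N #> (x \<otimes> g)"
      using rcos_self[OF m_closed[OF g x(1)] N.is_subgroup] by simp
    then obtain h where h: "h \<in> N" "g \<otimes> x = h \<otimes> (x \<otimes> g)"
      by (auto simp: r_coset_def)
    then have "g \<otimes> x \<otimes> inv g \<otimes> inv x = h"
      using x g N.mem_carrier[OF h(1)] by (simp add: inv_solve_right' m_assoc)
    then show ?thesis using h by simp
  qed
  ultimately show ?thesis using x by blast
qed

section \<open>Finite linear groups\<close>

text \<open>The notation \<open>inv\<close> is taken by the group inverse.\<close>

abbreviation finv :: "('a \<Rightarrow> 'b) \<Rightarrow> 'b \<Rightarrow> 'a" where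
  "finv \<equiv> inv_into UNIV"

text \<open>Closure under inverses is left to follow from finiteness: left translation by an element
  is an injective self-map of a finite set, hence reaches \<open>id\<close>.\<close>

definition linear_group :: "('a::euclidean_space \<Rightarrow> 'a) set \<Rightarrow> bool" where
  "linear_group X \<longleftrightarrow> finite X \<and> id \<in> X \<and> (\<forall>f\<in>X. linear f \<and> inj f) \<and> (\<forall>f\<in>X. \<forall>g\<in>X. f \<circ> g \<in> X)"

definition preserves :: "('a::euclidean_space \<Rightarrow> 'a) set \<Rightarrow> 'a set \<Rightarrow> bool" where
  "preserves X S \<longleftrightarrow> (\<forall>f\<in>X. \<forall>v\<in>S. f v \<in> S)"

text \<open>The kernel of the action on \<open>S\<close>. Statements about the group induced on
  \<open>S\<close> are made for subgroups that contain the fixer, so the elements stay maps of the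
  whole space and are never restricted.\<close>

definition fixer :: "('a::euclidean_space \<Rightarrow> 'a) set \<Rightarrow> 'a set \<Rightarrow> ('a \<Rightarrow> 'a) set" where
  "fixer X S = {f \<in> X. \<forall>v\<in>S. f v = v}"

text \<open>Commutation is asked for on \<open>S\<close> only, because \<open>y\<close> is an
  involution or a complex structure only there.\<close>

definition commutant :: "('a::euclidean_space \<Rightarrow> 'a) set \<Rightarrow> ('a \<Rightarrow> 'a) \<Rightarrow> 'a set \<Rightarrow> ('a \<Rightarrow> 'a) set" where
  "commutant X y S = {f \<in> X. \<forall>v\<in>S. f (y v) = y (f v)}"

definition prod_set :: "('a \<Rightarrow> 'a) set \<Rightarrow> ('a \<Rightarrow> 'a) set \<Rightarrow> ('a \<Rightarrow> 'a) set" where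
  "prod_set Y N = (\<lambda>(f, g). f \<circ> g) ` (Y \<times> N)"

lemma inj_on_comp_left: "inj f \<Longrightarrow> inj_on (\<lambda>g. f \<circ> g) A"
  using inj_on_subset[OF fun.inj_map subset_UNIV] .

lemma linear_groupD:
  assumes "linear_group X"
  shows "finite X" "id \<in> X" "\<And>f. f \<in> X \<Longrightarrow> linear f" "\<And>f. f \<in> X \<Longrightarrow> inj f"
    "\<And>f g. f \<in> X \<Longrightarrow> g \<in> X \<Longrightarrow> f \<circ> g \<in> X"
  using assms by (auto simp: linear_group_def)

lemma linear_group_inv:
  assumes X: "linear_group X" and f: "f \<in> X"
  shows "finv f \<in> X" "finv f \<circ> f = id" "f \<circ> finv f = id" "\<And>v. finv f (f v) = v" "\<And>v. f (finv f v) = v"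
proof -
  note D = linear_groupD[OF X]
  have inj: "inj f" using D f by blast
  have bij: "bij f"
    using linear_injective_imp_surjective[OF D(3)[OF f] inj] inj by (simp add: bij_def)
  have "inj_on (\<lambda>g. f \<circ> g) X"
    using inj by (rule inj_on_comp_left)
  moreover have "(\<lambda>g. f \<circ> g) ` X \<subseteq> X"
    using D f by auto
  ultimately have "(\<lambda>g. f \<circ> g) ` X = X"
    using D(1) by (intro endo_inj_surj) auto
  then obtain g where g: "g \<in> X" "f \<circ> g = id"
    using D(2) by (metis imageE)
  have "g = finv f"
    using g(2) inj by (metis inv_o_cancel comp_assoc comp_id id_comp)
  then show "finv f \<in> X" using g by simp
  show "finv f \<circ> f = id" "f \<circ> finv f = id"
    using bij surj_iff[of f] by (auto simp: bij_is_inj bij_is_surj)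
  show "finv f (f v) = v" "f (finv f v) = v" for v
    using bij by (auto simp: bij_is_inj bij_is_surj surj_f_inv_f)
qed

lemma linear_group_subset:
  assumes "linear_group X" "Z \<subseteq> X" "id \<in> Z" "\<And>f g. f \<in> Z \<Longrightarrow> g \<in> Z \<Longrightarrow> f \<circ> g \<in> Z"
  shows "linear_group Z"
  using assms finite_subset unfolding linear_group_def by blast

lemma linear_group_Int:
  assumes "linear_group X" "linear_group Y"
  shows "linear_group (X \<inter> Y)"
  using assms by (auto simp: linear_group_def)

definition fun_group :: "('a \<Rightarrow> 'a) set \<Rightarrow> ('a \<Rightarrow> 'a) monoid" where
  "fun_group X = \<lparr>carrier = X, monoid.mult = (\<circ>), one = id\<rparr>"

lemma fun_group_simps [simp]:
  "carrier (fun_group X) = X" "f \<otimes>\<^bsub>fun_group X\<^esub> g = f \<circ> g" "\<one>\<^bsub>fun_group X\<^esub> = id"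
  by (simp_all add: fun_group_def)

lemma group_fun_group:
  assumes X: "linear_group X"
  shows "group (fun_group X)"
proof (rule groupI)
  fix f assume "f \<in> carrier (fun_group X)"
  then show "\<exists>g\<in>carrier (fun_group X). g \<otimes>\<^bsub>fun_group X\<^esub> f = \<one>\<^bsub>fun_group X\<^esub>"
    using linear_group_inv[OF X, of f] by auto
qed (use linear_groupD[OF X] in \<open>auto simp: comp_assoc\<close>)

lemma inv_fun_group:
  assumes X: "linear_group X" and f: "f \<in> X"
  shows "inv\<^bsub>fun_group X\<^esub> f = finv f"
  using group.inv_equality[OF group_fun_group[OF X], of "finv f" f] linear_group_inv[OF X f] f by simp

lemma subgroup_fun_group:
  assumes X: "linear_group X" and Z: "linear_group Z" "Z \<subseteq> X"
  shows "subgroup Z (fun_group X)"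
proof (rule group.subgroupI[OF group_fun_group[OF X]])
  show "Z \<noteq> {}" using linear_groupD(2)[OF Z(1)] by blast
  fix f assume f: "f \<in> Z"
  then show "inv\<^bsub>fun_group X\<^esub> f \<in> Z"
    using inv_fun_group[OF X, of f] linear_group_inv(1)[OF Z(1) f] Z(2) by auto
qed (use Z linear_groupD in auto)

lemma card_linear_subgroup_dvd:
  assumes X: "linear_group X" and Z: "linear_group Z" "Z \<subseteq> X"
  shows "card Z dvd card X"
  using group.lagrange[OF group_fun_group[OF X] subgroup_fun_group[OF assms]]
  by (metis dvd_triv_right order_def fun_group_simps(1))

definition two_group :: "('a::euclidean_space \<Rightarrow> 'a) set \<Rightarrow> bool" where
  "two_group X \<longleftrightarrow> linear_group X \<and> (\<exists>k. card X = 2 ^ k)"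

lemma two_group_subset:
  assumes "two_group X" "linear_group Z" "Z \<subseteq> X"
  shows "two_group Z"
  using assms card_linear_subgroup_dvd[of X Z] divides_primepow_nat[of 2] unfolding two_group_def
  by auto

lemma two_group_central_involution:
  assumes X: "two_group X" and N: "linear_group N" "N \<subseteq> X" "N \<noteq> X"
    and normal: "\<And>f g. f \<in> X \<Longrightarrow> g \<in> N \<Longrightarrow> f \<circ> g \<circ> finv f \<in> N"
  shows "\<exists>f\<in>X - N. f \<circ> f \<in> N \<and> (\<forall>g\<in>X. g \<circ> f \<circ> finv g \<circ> finv f \<in> N)"
proof -
  obtain k where k: "card X = 2 ^ k" and lX: "linear_group X"
    using X by (auto simp: two_group_def)
  interpret group "fun_group X" by (rule group_fun_group[OF lX])
  have "N \<lhd> fun_group X"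
    unfolding normal_inv_iff using subgroup_fun_group[OF lX N(1,2)] normal inv_fun_group[OF lX] by simp
  from two_group_mod_normal_central_involution[OF _ this, of k] k N(3)
  show ?thesis
    using inv_fun_group[OF lX] by (simp add: order_def)
qed

lemma card_fibres:
  assumes fin: "finite X" and fib: "\<And>y. y \<in> X \<Longrightarrow> card {x \<in> X. f x = f y} = c"
  shows "card X = card (f ` X) * c"
proof -
  have "card X = (\<Sum>z\<in>f ` X. \<Sum>x\<in>{x \<in> X. f x = z}. 1)"
    using sum.image_gen[OF fin, of "\<lambda>_. 1::nat" f] by simp
  also have "\<dots> = (\<Sum>z\<in>f ` X. c)"
    using fib by (intro sum.cong) auto
  finally show ?thesis by simp
qed

text \<open>The fibre of composition through \<open>(f, g)\<close> consists of the pairs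
  \<open>(f \<circ> k, finv k \<circ> g)\<close> with \<open>k\<close> in
  \<open>Y \<inter> N\<close>. The formula also covers products that fail to be groups.\<close>

lemma card_prod_set:
  assumes Y: "linear_group Y" and N: "linear_group N"
  shows "card (prod_set Y N) * card (Y \<inter> N) = card Y * card N"
proof -
  let ?m = "\<lambda>(f, g). f \<circ> g"
  have "card (Y \<times> N) = card (?m ` (Y \<times> N)) * card (Y \<inter> N)"
  proof (rule card_fibres)
    show "finite (Y \<times> N)" using linear_groupD(1) Y N by blast
    fix p assume "p \<in> Y \<times> N"
    then obtain f g where p: "p = (f, g)" "f \<in> Y" "g \<in> N" by auto
    have eq: "{q \<in> Y \<times> N. ?m q = ?m p} = (\<lambda>k. (f \<circ> k, finv k \<circ> g)) ` (Y \<inter> N)"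
    proof (intro equalityI subsetI)
      fix q assume "q \<in> {q \<in> Y \<times> N. ?m q = ?m p}"
      then obtain f' g' where q: "q = (f', g')" "f' \<in> Y" "g' \<in> N" "f' \<circ> g' = f \<circ> g"
        using p by auto
      let ?k = "finv f \<circ> f'"
      have k1: "?k \<in> Y"
        using linear_groupD(5)[OF Y] linear_group_inv(1)[OF Y] p q by simp
      have "?k = finv f \<circ> (f' \<circ> g') \<circ> finv g'"
        using linear_group_inv[OF N q(3)] by (simp add: fun_eq_iff)
      also have "\<dots> = g \<circ> finv g'"
        unfolding q(4) using linear_group_inv[OF Y p(2)] by (simp add: fun_eq_iff)
      finally have k2: "?k = g \<circ> finv g'" .
      then have k: "?k \<in> Y \<inter> N"
        using k1 linear_groupD(5)[OF N] linear_group_inv(1)[OF N] p q by simp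
      have "f' = f \<circ> ?k"
        using linear_group_inv[OF Y p(2)] by (simp add: fun_eq_iff)
      moreover have "?k \<circ> g' = g"
        unfolding k2 using linear_group_inv[OF N q(3)] by (simp add: fun_eq_iff)
      then have "g' = finv ?k \<circ> g"
        using linear_group_inv(2)[OF Y k1] by (metis comp_assoc id_comp)
      ultimately show "q \<in> (\<lambda>k. (f \<circ> k, finv k \<circ> g)) ` (Y \<inter> N)"
        using k q by blast
    next
      fix q assume "q \<in> (\<lambda>k. (f \<circ> k, finv k \<circ> g)) ` (Y \<inter> N)"
      then obtain k where k: "k \<in> Y" "k \<in> N" "q = (f \<circ> k, finv k \<circ> g)" by auto
      then have "f \<circ> k \<in> Y" "finv k \<circ> g \<in> N"
        using linear_groupD(5) linear_group_inv(1) Y N p by blast+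
      moreover have "(f \<circ> k) \<circ> (finv k \<circ> g) = f \<circ> g"
        using linear_group_inv[OF Y k(1)] by (simp add: fun_eq_iff)
      ultimately show "q \<in> {q \<in> Y \<times> N. ?m q = ?m p}"
        using k p by simp
    qed
    have "inj_on (\<lambda>k. (f \<circ> k, finv k \<circ> g)) (Y \<inter> N)"
    proof (rule inj_onI)
      fix k k' assume "(f \<circ> k, finv k \<circ> g) = (f \<circ> k', finv k' \<circ> g)"
      then have "f \<circ> k = f \<circ> k'" by simp
      then show "k = k'"
        using linear_groupD(4)[OF Y p(2)] by (simp add: inj_eq fun_eq_iff)
    qed
    then show "card {q \<in> Y \<times> N. ?m q = ?m p} = card (Y \<inter> N)"
      unfolding eq by (rule card_image)
  qed
  then show ?thesis
    by (simp add: prod_set_def card_cartesian_product)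
qed

lemma linear_group_fixer:
  assumes "linear_group X"
  shows "linear_group (fixer X S)"
  by (rule linear_group_subset[OF assms]) (use linear_groupD[OF assms] in \<open>auto simp: fixer_def\<close>)

lemma fixer_subset: "fixer X S \<subseteq> X"
  by (auto simp: fixer_def)

lemma preserves_subset: "preserves X S \<Longrightarrow> Z \<subseteq> X \<Longrightarrow> preserves Z S"
  by (auto simp: preserves_def)

lemma preservesD: "preserves X S \<Longrightarrow> f \<in> X \<Longrightarrow> v \<in> S \<Longrightarrow> f v \<in> S"
  by (auto simp: preserves_def)

text \<open>As \<open>X\<close> preserves \<open>S\<close>, conjugation by its elements maps the
  fixer to itself, so \<open>n\<close> can be moved past \<open>y'\<close> at the price of a
  conjugate.\<close>

lemma linear_group_prod_fixer:
  assumes X: "linear_group X" and pres: "preserves X S" and Y: "linear_group Y" "Y \<subseteq> X"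
  shows "linear_group (prod_set Y (fixer X S))" (is "linear_group ?P")
proof (rule linear_group_subset[OF X])
  show "?P \<subseteq> X"
    using linear_groupD(5)[OF X] Y(2) by (auto simp: prod_set_def fixer_def)
  show "id \<in> ?P"
    unfolding prod_set_def
    by (rule image_eqI[of _ _ "(id, id)"])
      (use linear_groupD(2)[OF X] linear_groupD(2)[OF Y(1)] in \<open>auto simp: fixer_def\<close>)
  fix p q assume "p \<in> ?P" "q \<in> ?P"
  then obtain y n y' n' where h: "p = y \<circ> n" "q = y' \<circ> n'" "y \<in> Y" "y' \<in> Y"
      "n \<in> fixer X S" "n' \<in> fixer X S"
    by (auto simp: prod_set_def)
  have y'X: "y' \<in> X" using h Y by auto
  note iy = linear_group_inv[OF X y'X]
  have "finv y' \<circ> n \<circ> y' \<circ> n' \<in> fixer X S"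
    using linear_groupD(5)[OF X] iy h y'X preservesD[OF pres] by (auto simp: fixer_def)
  moreover have "y \<circ> y' \<in> Y"
    using h linear_groupD(5)[OF Y(1)] by simp
  moreover have "p \<circ> q = (y \<circ> y') \<circ> (finv y' \<circ> n \<circ> y' \<circ> n')"
    using iy h by (simp add: fun_eq_iff)
  ultimately show "p \<circ> q \<in> ?P"
    unfolding prod_set_def by (intro image_eqI[of _ _ "(y \<circ> y', finv y' \<circ> n \<circ> y' \<circ> n')"]) auto
qed

lemma prod_set_superset:
  assumes "linear_group Y" "linear_group N"
  shows "Y \<subseteq> prod_set Y N" "N \<subseteq> prod_set Y N"
proof -
  show "Y \<subseteq> prod_set Y N"
    unfolding prod_set_def
    by (rule subsetI, rule_tac x="(x, id)" in image_eqI) (use linear_groupD(2)[OF assms(2)] in auto)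
  show "N \<subseteq> prod_set Y N"
    unfolding prod_set_def
    by (rule subsetI, rule_tac x="(id, x)" in image_eqI) (use linear_groupD(2)[OF assms(1)] in auto)
qed

lemma prod_set_subset:
  assumes "linear_group X" "Y \<subseteq> X" "N \<subseteq> X"
  shows "prod_set Y N \<subseteq> X"
  using linear_groupD(5)[OF assms(1)] assms(2,3) by (auto simp: prod_set_def)

lemma linear_group_commutant:
  assumes X: "linear_group X" and pres: "preserves X S"
  shows "linear_group (commutant X y S)"
  by (rule linear_group_subset[OF X])
    (use linear_groupD[OF X] preservesD[OF pres] in \<open>auto simp: commutant_def\<close>)

lemma commutant_subset: "commutant X y S \<subseteq> X"
  by (auto simp: commutant_def)

text \<open>Two anticommuting elements compose to a commuting one, so the complement of the
  commutant is the single coset of \<open>t\<close>.\<close>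

lemma card_commutant:
  assumes X: "linear_group X" and pres: "preserves X S" and dich: "\<And>g. g \<in> X \<Longrightarrow> (\<forall>v\<in>S. g (y v) = y (g v)) \<or> (\<forall>v\<in>S. g (y v) = - y (g v))"
    and t: "t \<in> X" "t \<notin> commutant X y S"
  shows "card X = 2 * card (commutant X y S)"
proof -
  let ?C = "commutant X y S"
  note C = linear_group_commutant[OF X pres, of y]
  note it = linear_group_inv[OF X t(1)]
  have anti: "x (y v) = - y (x v)" if "x \<in> X - ?C" "v \<in> S" for x v
    using dich[of x] that by (auto simp: commutant_def)
  have comp: "x \<circ> x' \<in> ?C" if x: "x \<in> X - ?C" "x' \<in> X - ?C" for x x'
  proof -
    have "(x \<circ> x') (y v) = y ((x \<circ> x') v)" if v: "v \<in> S" for v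
    proof -
      have "x' v \<in> S" using x v preservesD[OF pres] by auto
      moreover have "x (- y (x' v)) = - x (y (x' v))"
        using x linear_groupD(3)[OF X] by (simp add: linear_neg)
      ultimately show ?thesis using x v anti[OF x(1)] anti[OF x(2)] by simp
    qed
    then show ?thesis using x linear_groupD(5)[OF X] by (auto simp: commutant_def)
  qed
  have it': "finv t \<in> X - ?C"
  proof -
    have "finv t \<notin> ?C"
    proof
      assume "finv t \<in> ?C"
      then have "finv (finv t) \<in> ?C" by (rule linear_group_inv(1)[OF C])
      moreover have "finv (finv t) = t"
        using it(2,3) by (intro inv_unique_comp) auto
      ultimately show False using t by simp
    qed
    then show ?thesis using it by simp
  qed
  have eq: "X - ?C = (\<lambda>x. t \<circ> x) ` ?C"
  proof (intro equalityI subsetI)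
    fix x assume x: "x \<in> X - ?C"
    have "x = t \<circ> (finv t \<circ> x)" using it by (simp add: fun_eq_iff)
    then show "x \<in> (\<lambda>x. t \<circ> x) ` ?C" using comp[OF it' x] by blast
  next
    fix x assume "x \<in> (\<lambda>x. t \<circ> x) ` ?C"
    then obtain c where c: "c \<in> ?C" "x = t \<circ> c" by blast
    have "x \<notin> ?C"
    proof
      assume "x \<in> ?C"
      then have "x \<circ> finv c \<in> ?C"
        using linear_groupD(5)[OF C] linear_group_inv(1)[OF C c(1)] by blast
      moreover have "x \<circ> finv c = t"
        using linear_group_inv[OF C c(1)] c(2) by (simp add: fun_eq_iff)
      ultimately show False using t by simp
    qed
    then show "x \<in> X - ?C"
      using c t linear_groupD(5)[OF X] by (auto simp: commutant_def)
  qed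
  have "inj_on (\<lambda>x. t \<circ> x) ?C"
    using linear_groupD(4)[OF X t(1)] by (rule inj_on_comp_left)
  then have "card (X - ?C) = card ?C"
    unfolding eq by (rule card_image)
  moreover have "card X = card ?C + card (X - ?C)"
    using card_Diff_subset[OF finite_subset[OF commutant_subset linear_groupD(1)[OF X]] commutant_subset, of y S]
      card_mono[OF linear_groupD(1)[OF X] commutant_subset, of y S]
    by linarith
  ultimately show ?thesis by simp
qed

section \<open>Involutions and complex structures\<close>

lemma two_group_linear: "two_group X \<Longrightarrow> linear_group X"
  by (simp add: two_group_def)

definition involution_on :: "('a::euclidean_space \<Rightarrow> 'a) \<Rightarrow> 'a set \<Rightarrow> bool" where
  "involution_on y S \<longleftrightarrow> linear y \<and> (\<forall>v\<in>S. y v \<in> S \<and> y (y v) = v)"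

definition complex_structure :: "('a::euclidean_space \<Rightarrow> 'a) \<Rightarrow> 'a set \<Rightarrow> bool" where
  "complex_structure J S \<longleftrightarrow> linear J \<and> (\<forall>v\<in>S. J v \<in> S \<and> J (J v) = - v)"

lemma eigenspaces:
  fixes y :: "'a::euclidean_space \<Rightarrow> 'a"
  assumes S: "subspace S" and inv: "involution_on y S"
  shows "subspace {v \<in> S. y v = v}" "subspace {v \<in> S. y v = - v}"
    and "dim {v \<in> S. y v = v} + dim {v \<in> S. y v = - v} = dim S"
    and "v \<in> S \<Longrightarrow> \<exists>a b. a \<in> {v \<in> S. y v = v} \<and> b \<in> {v \<in> S. y v = - v} \<and> v = a + b"
proof -
  have y: "linear y" "\<And>v. v \<in> S \<Longrightarrow> y v \<in> S" and sq: "\<And>v. v \<in> S \<Longrightarrow> y (y v) = v"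
    using inv by (auto simp: involution_on_def)
  let ?P = "{v \<in> S. y v = v}" and ?M = "{v \<in> S. y v = - v}"
  have lin: "y 0 = 0" "y (a + b) = y a + y b" "y (c *\<^sub>R a) = c *\<^sub>R y a" for a b c
    using y(1) by (auto simp: linear_0 linear_add linear_scale)
  show P: "subspace ?P" and M: "subspace ?M"
    using S by (auto simp: subspace_def lin)
  have dec: "\<exists>a b. a \<in> ?P \<and> b \<in> ?M \<and> v = a + b" if v: "v \<in> S" for v
  proof (intro exI conjI)
    let ?a = "(1/2) *\<^sub>R (v + y v)" and ?b = "(1/2) *\<^sub>R (v - y v)"
    have "v - y v = v + (-1) *\<^sub>R y v" by simp
    then have yb: "y (v - y v) = y v - v"
      using sq[OF v] by (simp only: lin) simp
    show "?a \<in> ?P"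
      using v y(2)[OF v] sq[OF v] S by (auto simp: lin subspace_scale subspace_add add.commute)
    have "y ?b = (1/2) *\<^sub>R (y v - v)"
      by (simp only: lin yb)
    also have "\<dots> = - ?b"
      by (simp add: scaleR_right_diff_distrib)
    finally show "?b \<in> ?M"
      using v y(2)[OF v] S by (auto simp: subspace_scale subspace_diff)
    have "?a + ?b = (1/2) *\<^sub>R ((v + y v) + (v - y v))"
      by (simp only: scaleR_add_right)
    also have "\<dots> = v"
      by (simp add: scaleR_2[symmetric])
    finally show "v = ?a + ?b" by simp
  qed
  then show "v \<in> S \<Longrightarrow> \<exists>a b. a \<in> ?P \<and> b \<in> ?M \<and> v = a + b" .
  have "{x + y |x y. x \<in> ?P \<and> y \<in> ?M} = S"
  proof (intro equalityI subsetI)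
    fix v assume "v \<in> S"
    from dec[OF this] show "v \<in> {x + y |x y. x \<in> ?P \<and> y \<in> ?M}" by blast
  qed (use S in \<open>auto simp: subspace_add\<close>)
  moreover have "?P \<inter> ?M \<subseteq> {0}"
    by (auto simp: eq_neg_iff_add_eq_0 scaleR_2[symmetric])
  then have "dim (?P \<inter> ?M) = 0"
    by (simp only: dim_eq_0)
  ultimately show "dim ?P + dim ?M = dim S"
    using dim_sums_Int[OF P M] by (simp only: add_0_right)
qed

lemma preserves_eigenspaces:
  assumes "linear_group X" "preserves X S"
  shows "preserves (commutant X y S) {v \<in> S. y v = v}"
    and "preserves (commutant X y S) {v \<in> S. y v = - v}"
proof -
  have "f (- v) = - f v" if "f \<in> X" for f v
    using linear_groupD(3)[OF assms(1) that] by (rule linear_neg)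
  then show "preserves (commutant X y S) {v \<in> S. y v = v}"
    "preserves (commutant X y S) {v \<in> S. y v = - v}"
    using preservesD[OF assms(2)] by (auto simp: preserves_def commutant_def)
qed

lemma fixer_eigenspaces:
  fixes y :: "'a::euclidean_space \<Rightarrow> 'a"
  assumes X: "linear_group X"
    and S: "subspace S" and inv: "involution_on y S"
    and f: "f \<in> X" "\<And>v. v \<in> {v \<in> S. y v = v} \<Longrightarrow> f v = v"
      "\<And>v. v \<in> {v \<in> S. y v = - v} \<Longrightarrow> f v = v"
  shows "f \<in> fixer X S"
proof -
  have "f v = v" if "v \<in> S" for v
  proof -
    obtain a b where ab: "a \<in> {v \<in> S. y v = v}" "b \<in> {v \<in> S. y v = - v}" "v = a + b"
      using eigenspaces(4)[OF S inv \<open>v \<in> S\<close>] by blast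
    have "f v = f a + f b"
      using linear_groupD(3)[OF X f(1)] ab by (simp add: linear_add)
    then show ?thesis using f(2)[OF ab(1)] f(3)[OF ab(2)] ab(3) by simp
  qed
  then show ?thesis using f(1) by (auto simp: fixer_def)
qed

lemma linear_group_scalars:
  fixes X :: "('a::euclidean_space \<Rightarrow> 'a) set"
  assumes X: "linear_group X" and pres: "preserves X S"
  defines "N \<equiv> {f \<in> X. (\<forall>v\<in>S. f v = v) \<or> (\<forall>v\<in>S. f v = - v)}"
  shows "linear_group N" and "\<And>f g. f \<in> X \<Longrightarrow> g \<in> N \<Longrightarrow> f \<circ> g \<circ> finv f \<in> N"
proof -
  have neg: "f (- v) = - f v" if "f \<in> X" for f v
    using linear_groupD(3)[OF X that] by (rule linear_neg)
  show "linear_group N"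
  proof (rule linear_group_subset[OF X])
    fix f g assume "f \<in> N" "g \<in> N"
    then have fg: "f \<in> X" "g \<in> X" "(\<forall>v\<in>S. f v = v) \<or> (\<forall>v\<in>S. f v = - v)"
        "(\<forall>v\<in>S. g v = v) \<or> (\<forall>v\<in>S. g v = - v)"
      by (simp_all add: N_def)
    have "(\<forall>v\<in>S. (f \<circ> g) v = v) \<or> (\<forall>v\<in>S. (f \<circ> g) v = - v)"
      using fg(3,4) neg[OF fg(1)] by (elim disjE) simp_all
    then show "f \<circ> g \<in> N"
      using linear_groupD(5)[OF X] fg by (simp add: N_def)
  qed (use linear_groupD(2)[OF X] in \<open>auto simp: N_def\<close>)
  fix f g assume fg: "f \<in> X" "g \<in> N"
  note i = linear_group_inv[OF X fg(1)]
  have S: "finv f v \<in> S" if "v \<in> S" for v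
    using preservesD[OF pres i(1) that] .
  show "f \<circ> g \<circ> finv f \<in> N"
    using fg i S linear_groupD(5)[OF X] neg[OF fg(1)] unfolding N_def by auto
qed

text \<open>The quotient by the elements acting as 1 or -1 on \<open>S\<close> is trivial or has a
  central involution, represented by \<open>y\<close>. That the commutator of \<open>g\<close> and
  \<open>y\<close> acts on \<open>S\<close> as 1 or -1 is the last clause of the second
  case.\<close>

lemma real_dichotomy:
  fixes X :: "('a::euclidean_space \<Rightarrow> 'a) set"
  assumes X: "two_group X" and pres: "preserves X S"
  obtains (scalar) "\<And>f. f \<in> X \<Longrightarrow> (\<forall>v\<in>S. f v = v) \<or> (\<forall>v\<in>S. f v = - v)"
  | (involution) y where "y \<in> X" "\<not> (\<forall>v\<in>S. y v = v)" "\<not> (\<forall>v\<in>S. y v = - v)"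
      "(\<forall>v\<in>S. y (y v) = v) \<or> (\<forall>v\<in>S. y (y v) = - v)"
      "\<And>g. g \<in> X \<Longrightarrow> (\<forall>v\<in>S. g (y v) = y (g v)) \<or> (\<forall>v\<in>S. g (y v) = - y (g v))"
proof -
  define N where "N = {f \<in> X. (\<forall>v\<in>S. f v = v) \<or> (\<forall>v\<in>S. f v = - v)}"
  have lX: "linear_group X" using X by (rule two_group_linear)
  have N: "linear_group N" "\<And>f g. f \<in> X \<Longrightarrow> g \<in> N \<Longrightarrow> f \<circ> g \<circ> finv f \<in> N"
    using linear_group_scalars[OF lX pres] by (auto simp: N_def)
  show thesis
  proof (cases "N = X")
    case True
    then show thesis using scalar by (auto simp: N_def)
  next
    case False
    then obtain y where y: "y \<in> X - N" "y \<circ> y \<in> N" "\<forall>g\<in>X. g \<circ> y \<circ> finv g \<circ> finv y \<in> N"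
      using two_group_central_involution[OF X N(1) _ _ N(2)] by (auto simp: N_def)
    show thesis
    proof (rule involution)
      fix g assume g: "g \<in> X"
      let ?n = "g \<circ> y \<circ> finv g \<circ> finv y"
      have n: "?n (y (g v)) = g (y v)" for v
        using linear_group_inv[OF lX g] linear_group_inv[OF lX, of y] y(1) by simp
      have "y (g v) \<in> S" if "v \<in> S" for v
        using that g y(1) preservesD[OF pres] by auto
      moreover have "(\<forall>v\<in>S. ?n v = v) \<or> (\<forall>v\<in>S. ?n v = - v)"
        using y(3) g by (auto simp only: N_def)
      ultimately show "(\<forall>v\<in>S. g (y v) = y (g v)) \<or> (\<forall>v\<in>S. g (y v) = - y (g v))"
        using n by metis
    qed (use y in \<open>auto simp: N_def\<close>)
  qed
qed

text \<open>\<open>h\<close> stands in for the restriction to \<open>S\<close>: any function that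
  separates exactly the cosets of the fixer will do. It is a truth value for real scalars and a
  complex number for complex ones.\<close>

lemma card_eq_image_times_fixer:
  assumes X: "linear_group X"
    and h: "\<And>f g. f \<in> X \<Longrightarrow> g \<in> X \<Longrightarrow> h f = h g \<longleftrightarrow> finv g \<circ> f \<in> fixer X S"
  shows "card X = card (h ` X) * card (fixer X S)"
proof (rule card_fibres)
  show "finite X" using X by (rule linear_groupD)
  fix g assume g: "g \<in> X"
  note i = linear_group_inv[OF X g]
  have "{f \<in> X. h f = h g} = (\<lambda>k. g \<circ> k) ` fixer X S"
  proof (intro equalityI subsetI)
    fix f assume "f \<in> {f \<in> X. h f = h g}"
    then have "finv g \<circ> f \<in> fixer X S" "f = g \<circ> (finv g \<circ> f)"
      using h g i by (auto simp: fun_eq_iff)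
    then show "f \<in> (\<lambda>k. g \<circ> k) ` fixer X S" by blast
  next
    fix f assume "f \<in> (\<lambda>k. g \<circ> k) ` fixer X S"
    then obtain k where k: "k \<in> fixer X S" "f = g \<circ> k" by blast
    then have "f \<in> X" "finv g \<circ> f = k"
      unfolding k(2) using linear_groupD(5)[OF X g, of k] i by (auto simp: fixer_def fun_eq_iff)
    then show "f \<in> {f \<in> X. h f = h g}" using h g k by simp
  qed
  moreover have "inj_on (\<lambda>k. g \<circ> k) (fixer X S)"
    using linear_groupD(4)[OF X g] by (rule inj_on_comp_left)
  ultimately show "card {f \<in> X. h f = h g} = card (fixer X S)"
    by (simp add: card_image)
qed

lemma card_le_two_fixer:
  fixes X :: "('a::euclidean_space \<Rightarrow> 'a) set"
  assumes X: "linear_group X" and pres: "preserves X S"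
    and scalar: "\<And>f. f \<in> X \<Longrightarrow> (\<forall>v\<in>S. f v = v) \<or> (\<forall>v\<in>S. f v = - v)"
  shows "card X \<le> 2 * card (fixer X S)"
proof -
  define h where "h f = (\<forall>v\<in>S. f v = v)" for f :: "'a \<Rightarrow> 'a"
  have le: "card (h ` X) \<le> 2"
    using card_mono[of "UNIV :: bool set" "h ` X"] by simp
  have "h f = h g \<longleftrightarrow> finv g \<circ> f \<in> fixer X S" if fg: "f \<in> X" "g \<in> X" for f g
  proof -
    note i = linear_group_inv[OF X fg(2)]
    have "finv g \<circ> f \<in> fixer X S \<longleftrightarrow> (\<forall>v\<in>S. f v = g v)"
      using linear_groupD(5)[OF X i(1) fg(1)] i(4,5) by (auto simp: fixer_def) metis+
    also have "\<dots> \<longleftrightarrow> h f = h g"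
      using scalar[OF fg(1)] scalar[OF fg(2)] unfolding h_def by metis
    finally show ?thesis by simp
  qed
  from card_eq_image_times_fixer[of X h S, OF X this] le show ?thesis by simp
qed

text \<open>When \<open>prod_set Y N\<close> is a group between \<open>Y\<close> and
  \<open>X\<close>, this is the multiplicativity [X : Y] = [X : YN] [N : N \<inter> Y]. With
  \<open>N\<close> the fixer of one eigenspace, the first index is estimated on that eigenspace and
  the second one on the other.\<close>

lemma split_bound:
  assumes Y: "linear_group Y" and N: "linear_group N"
    and a: "c * card X \<le> a * card (prod_set Y N)" and b: "d * card N \<le> b * card (N \<inter> Y)"
  shows "c * d * card X \<le> a * b * card Y"
proof -
  have pos: "0 < card (Y \<inter> N)"
    using linear_groupD(1,2)[OF linear_group_Int[OF Y N]] by (auto simp: card_gt_0_iff)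
  have "(c * d * card X) * (card N * card (Y \<inter> N)) = (c * card X) * (d * card N) * card (Y \<inter> N)"
    by (simp add: algebra_simps)
  also have "\<dots> \<le> (a * card (prod_set Y N)) * (b * card (N \<inter> Y)) * card (Y \<inter> N)"
    using mult_le_mono[OF mult_le_mono[OF a b] le_refl] .
  also have "\<dots> = a * b * card (Y \<inter> N) * (card (prod_set Y N) * card (Y \<inter> N))"
    by (simp add: algebra_simps Int_commute)
  also have "\<dots> = (a * b * card Y) * (card N * card (Y \<inter> N))"
    by (simp add: card_prod_set[OF Y N])
  finally show ?thesis
    using pos linear_groupD(1,2)[OF N] by (auto simp: card_gt_0_iff)
qed


lemma dim_pos:
  fixes E :: "'a::euclidean_space set"
  assumes "subspace E" "E \<noteq> {0}"
  shows "0 < dim E"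
proof -
  have "\<not> E \<subseteq> {0}"
    using assms subspace_0 by blast
  then show ?thesis unfolding dim_eq_0[of E, symmetric] by (rule neq0_conv[THEN iffD1])
qed

lemma eigenspaces_proper:
  fixes y :: "'a::euclidean_space \<Rightarrow> 'a"
  assumes S: "subspace S" and inv: "involution_on y S"
    and proper: "\<not> (\<forall>v\<in>S. y v = v)" "\<not> (\<forall>v\<in>S. y v = - v)"
  shows "{v \<in> S. y v = v} \<noteq> {0}" "{v \<in> S. y v = - v} \<noteq> {0}"
    "dim {v \<in> S. y v = v} < dim S" "dim {v \<in> S. y v = - v} < dim S"
proof -
  note E = eigenspaces[OF S inv]
  show 1: "{v \<in> S. y v = v} \<noteq> {0}" and 2: "{v \<in> S. y v = - v} \<noteq> {0}"
    using E(4) proper by fastforce+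
  show "dim {v \<in> S. y v = v} < dim S" "dim {v \<in> S. y v = - v} < dim S"
    using dim_pos[OF E(1) 1] dim_pos[OF E(2) 2] E(3) by linarith+
qed

lemma commutant_mono: "Z \<subseteq> X \<Longrightarrow> commutant Z y S \<subseteq> commutant X y S"
  by (auto simp: commutant_def)

section \<open>Complex linear 2-groups\<close>

definition cscale :: "('a::euclidean_space \<Rightarrow> 'a) \<Rightarrow> complex \<Rightarrow> 'a \<Rightarrow> 'a" where
  "cscale J z v = Re z *\<^sub>R v + Im z *\<^sub>R J v"

lemma cscale:
  fixes J :: "'a::euclidean_space \<Rightarrow> 'a"
  assumes S: "subspace S" and cs: "complex_structure J S"
  shows "linear (cscale J z)"
    and "\<And>v. v \<in> S \<Longrightarrow> cscale J z v \<in> S"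
    and "\<And>v. v \<in> S \<Longrightarrow> cscale J z (cscale J w v) = cscale J (z * w) v"
    and "cscale J 1 v = v" "cscale J (- 1) v = - v" "cscale J 0 v = 0"
    and "\<And>v. v \<in> S \<Longrightarrow> cscale J z v = cscale J w v \<Longrightarrow> v \<noteq> 0 \<Longrightarrow> z = w"
    and "\<And>f v. linear f \<Longrightarrow> f (J v) = J (f v) \<Longrightarrow> f (cscale J z v) = cscale J z (f v)"
proof -
  have J: "linear J" "\<And>v. v \<in> S \<Longrightarrow> J v \<in> S" "\<And>v. v \<in> S \<Longrightarrow> J (J v) = - v"
    using cs by (auto simp: complex_structure_def)
  have lin: "J (a + b) = J a + J b" "J (c *\<^sub>R a) = c *\<^sub>R J a" for a b c
    using J(1) by (auto simp: linear_add linear_scale)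
  show "linear (cscale J z)"
    by (rule linearI) (simp_all add: cscale_def lin algebra_simps)
  show "cscale J z v \<in> S" if "v \<in> S" for v
    using S J(2) that by (auto simp: cscale_def subspace_add subspace_scale)
  have mult: "cscale J z (cscale J w v) = cscale J (z * w) v" if v: "v \<in> S" for z w v
    by (simp add: cscale_def lin J(3)[OF v] algebra_simps)
  then show "\<And>v. v \<in> S \<Longrightarrow> cscale J z (cscale J w v) = cscale J (z * w) v" .
  show "cscale J 1 v = v" "cscale J (- 1) v = - v" "cscale J 0 v = 0"
    by (simp_all add: cscale_def)
  show "z = w" if v: "v \<in> S" "cscale J z v = cscale J w v" "v \<noteq> 0" for v
  proof (rule ccontr)
    assume "z \<noteq> w"
    have "cscale J (z - w) v = 0"
      using v(2) by (simp add: cscale_def algebra_simps)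
    then have "cscale J (inverse (z - w) * (z - w)) v = 0"
      unfolding mult[OF v(1), symmetric] by (simp add: cscale_def linear_0[OF J(1)])
    then show False
      using \<open>z \<noteq> w\<close> v(3) by (simp add: cscale_def)
  qed
  show "f (cscale J z v) = cscale J z (f v)" if "linear f" "f (J v) = J (f v)" for f v
    using that by (simp add: cscale_def linear_add linear_scale)
qed

text \<open>A relation \<open>J v = k *\<^sub>R v\<close> with real \<open>k\<close> would give
  \<open>k * k = - 1\<close>, so \<open>v\<close> and \<open>J v\<close> are independent. This makes
  \<open>2 ^ dim S\<close> at least 4 in the base case of the complex bound.\<close>

lemma complex_dim_ge_2:
  fixes J :: "'a::euclidean_space \<Rightarrow> 'a"
  assumes S: "subspace S" "S \<noteq> {0}"
    and cs: "complex_structure J S"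
  shows "2 \<le> dim S"
proof -
  have J: "linear J" "\<And>v. v \<in> S \<Longrightarrow> J v \<in> S" "\<And>v. v \<in> S \<Longrightarrow> J (J v) = - v"
    using cs by (auto simp: complex_structure_def)
  obtain v where v: "v \<in> S" "v \<noteq> 0"
    using S subspace_0 by blast
  have notin: "J v \<noteq> k *\<^sub>R v" for k
  proof
    assume k: "J v = k *\<^sub>R v"
    then have "J (J v) = (k * k) *\<^sub>R v"
      using linear_scale[OF J(1)] by simp
    then have "(k * k) *\<^sub>R v = - v"
      using J(3)[OF v(1)] by simp
    then have "(k * k + 1) *\<^sub>R v = 0"
      unfolding scaleR_add_left scaleR_one by (simp only: add.left_inverse)
    then show False
      using v(2) by (simp add: add_nonneg_eq_0_iff)
  qed
  then have "J v \<notin> span {v}"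
    by (auto simp: span_singleton)
  then have "independent {J v, v}"
    using v(2) by (simp add: independent_insert)
  moreover have "card {J v, v} = 2"
    using notin[of 1] by simp
  ultimately show ?thesis
    using independent_card_le_dim[of "{J v, v}" S] v J(2) by simp
qed

text \<open>Squares of elements of \<open>X\<close> lie in \<open>Y\<close>, and a complex number
  has at most two square roots, so at most twice as many scalars occur in \<open>X\<close> as in
  \<open>Y\<close>. Both groups have the same fixer, which cancels.\<close>

lemma card_complex_scalars:
  fixes X :: "('a::euclidean_space \<Rightarrow> 'a) set"
  assumes X: "linear_group X" and S: "subspace S" "S \<noteq> {0}" "preserves X S"
    and cs: "complex_structure J S"
    and Y: "linear_group Y" "Y \<subseteq> X" "\<And>f. f \<in> X \<Longrightarrow> f \<circ> f \<in> Y" "fixer X S \<subseteq> Y"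
    and scalar: "\<And>f. f \<in> X \<Longrightarrow> \<exists>z. \<forall>v\<in>S. f v = cscale J z v"
  shows "card X \<le> 2 * card Y"
proof -
  note cs = cscale[OF S(1) cs]
  obtain v where v: "v \<in> S" "v \<noteq> 0"
    using S subspace_0 by blast
  define h where "h f = (SOME z. \<forall>v\<in>S. f v = cscale J z v)" for f
  have h: "f v = cscale J (h f) v" if "f \<in> X" "v \<in> S" for f v
    using someI_ex[OF scalar[OF that(1)]] that(2) by (auto simp: h_def)
  have heq: "h f = h g \<longleftrightarrow> finv g \<circ> f \<in> fixer X S" if fg: "f \<in> X" "g \<in> X" for f g
  proof -
    note i = linear_group_inv[OF X fg(2)]
    have "finv g \<circ> f \<in> fixer X S \<longleftrightarrow> (\<forall>v\<in>S. f v = g v)"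
      using linear_groupD(5)[OF X i(1) fg(1)] i(4,5) by (auto simp: fixer_def) metis+
    also have "\<dots> \<longleftrightarrow> h f = h g"
      using h[OF fg(1)] h[OF fg(2)] cs(7)[OF v(1) _ v(2)] v(1) by metis
    finally show ?thesis by simp
  qed
  have fixY: "fixer Y S = fixer X S"
    using Y by (auto simp: fixer_def)
  have cX: "card X = card (h ` X) * card (fixer X S)"
    by (rule card_eq_image_times_fixer[of X h S, OF X heq])
  have cY: "card Y = card (h ` Y) * card (fixer X S)"
    using card_eq_image_times_fixer[of Y h S, OF Y(1)] heq Y(2) linear_groupD(5)[OF Y(1)]
      linear_group_inv(1)[OF Y(1)] unfolding fixY by blast
  have fin: "finite (h ` Y)" "finite (h ` X)"
    using linear_groupD(1) X Y(1) by auto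
  have sub: "h ` X \<subseteq> (\<Union>w\<in>h ` Y. {csqrt w, - csqrt w})"
  proof
    fix z assume "z \<in> h ` X"
    then obtain f where f: "f \<in> X" "z = h f" by blast
    have "f v \<in> S" using preservesD[OF S(3) f(1) v(1)] .
    then have "(f \<circ> f) v = cscale J (z * z) v"
      using h[OF f(1)] v cs(3)[OF v(1)] f by simp
    also have "(f \<circ> f) v = cscale J (h (f \<circ> f)) v"
      using h[of "f \<circ> f" v] Y(2,3) f v by auto
    finally have "h (f \<circ> f) = z * z"
      using cs(7)[OF v(1) _ v(2)] by simp
    moreover have "(csqrt (z * z))\<^sup>2 = z\<^sup>2"
      using power2_csqrt[of "z * z"] by (simp only: power2_eq_square)
    then have "z = csqrt (z * z) \<or> z = - csqrt (z * z)"
      by (metis power2_eq_iff)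
    ultimately show "z \<in> (\<Union>w\<in>h ` Y. {csqrt w, - csqrt w})"
      using Y(3)[OF f(1)] by force
  qed
  have "card (h ` X) \<le> card (\<Union>w\<in>h ` Y. {csqrt w, - csqrt w})"
    by (rule card_mono[OF finite_UN_I[OF fin(1)] sub]) simp
  also have "\<dots> \<le> (\<Sum>w\<in>h ` Y. card {csqrt w, - csqrt w})"
    using fin by (intro card_UN_le)
  also have "\<dots> \<le> (\<Sum>w\<in>h ` Y. 2)"
    by (intro sum_mono) (simp add: card_insert_if)
  finally have "card (h ` X) \<le> card (h ` Y) * 2" by simp
  then show ?thesis unfolding cX cY by simp
qed

text \<open>The exact factor is recorded, and not only the bound 2, because the two-layer estimate
  compares the factors of four nested groups.\<close>

lemma commutant_index:
  assumes X: "linear_group X" and pres: "preserves X S"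
    and dich: "\<And>g. g \<in> X \<Longrightarrow> (\<forall>v\<in>S. g (y v) = y (g v)) \<or> (\<forall>v\<in>S. g (y v) = - y (g v))"
  shows "card X = (if X \<subseteq> commutant X y S then 1 else 2) * card (commutant X y S)"
proof (cases "X \<subseteq> commutant X y S")
  case True
  then have "commutant X y S = X" using commutant_subset by blast
  then show ?thesis by simp
next
  case False
  then obtain t where "t \<in> X" "t \<notin> commutant X y S" by blast
  from card_commutant[OF X pres dich this] False show ?thesis by simp
qed

lemma two_group_commutant:
  assumes "two_group X" "preserves X S"
  shows "two_group (commutant X y S)"
  using two_group_subset[OF assms(1) linear_group_commutant[OF two_group_linear[OF assms(1)] assms(2)]
      commutant_subset] .

lemma square_in_commutant:
  assumes "linear_group X" "preserves X S" "Y \<subseteq> X" "f \<in> commutant X y S" "f \<circ> f \<in> Y"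
  shows "f \<circ> f \<in> commutant Y y S"
  using linear_groupD(5)[OF linear_group_commutant[OF assms(1,2)] assms(4,4)] assms(5)
  by (auto simp: commutant_def)

text \<open>A swap is affordable here. Scalars contribute at most 2 against
  \<open>2 ^ dim S \<ge> 4\<close>. Otherwise each of the two eigenspaces has a spare factor 2 by
  induction, and one of the two factors pays for the index of the commutant.\<close>

theorem complex_two_group_bound:
  assumes "two_group X" "preserves X S" "subspace S" "S \<noteq> {0}" "complex_structure J S"
    and "\<And>f v. f \<in> X \<Longrightarrow> v \<in> S \<Longrightarrow> f (J v) = J (f v)"
    and "linear_group Y" "Y \<subseteq> X" "\<And>f. f \<in> X \<Longrightarrow> f \<circ> f \<in> Y" "fixer X S \<subseteq> Y"
  shows "2 * card X \<le> 2 ^ dim S * card Y"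
  using assms
proof (induction "dim S" arbitrary: X S Y rule: less_induct)
  case less
  note X2 = less.prems(1) and pres = less.prems(2) and S = less.prems(3,4) and J = less.prems(5)
    and comm = less.prems(6) and Y = less.prems(7-10)
  note cs = cscale[OF S(1) J]
  have lX: "linear_group X" using X2 by (rule two_group_linear)
  have J': "linear J" "\<And>v. v \<in> S \<Longrightarrow> J v \<in> S"
    using J by (auto simp: complex_structure_def)
  have fcs: "f (cscale J z v) = cscale J z (f v)" if "f \<in> X" "v \<in> S" for f z v
    using cs(8)[OF linear_groupD(3)[OF lX that(1)] comm[OF that]] .
  have pS: "f v \<in> S" if "f \<in> X" "v \<in> S" for f v
    using preservesD[OF pres that] .
  \<comment> \<open>The elements acting as complex scalars take the place of those acting as 1 or
    -1.\<close>
  define N where "N = {f \<in> X. \<exists>z. \<forall>v\<in>S. f v = cscale J z v}"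
  show ?case
  proof (cases "N = X")
    case True
    then have "card X \<le> 2 * card Y"
      by (intro card_complex_scalars[OF lX S pres J Y]) (auto simp: N_def)
    moreover have "(2::nat) ^ 2 \<le> 2 ^ dim S"
      using complex_dim_ge_2[OF S J] by (intro power_increasing) auto
    then have "2 * 2 * card Y \<le> 2 ^ dim S * card Y"
      by (intro mult_le_mono) auto
    ultimately show ?thesis by linarith
  next
    case False
    have lN: "linear_group N"
    proof (rule linear_group_subset[OF lX])
      show "id \<in> N"
        using linear_groupD(2)[OF lX] cs(4) by (auto simp: N_def intro!: exI[of _ 1])
      fix f g assume "f \<in> N" "g \<in> N"
      then obtain z w where fg: "f \<in> X" "g \<in> X" "\<forall>v\<in>S. f v = cscale J z v" "\<forall>v\<in>S. g v = cscale J w v"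
        by (auto simp: N_def)
      then have "\<forall>v\<in>S. (f \<circ> g) v = cscale J (z * w) v"
        using cs(2,3) by simp
      then show "f \<circ> g \<in> N"
        using linear_groupD(5)[OF lX fg(1,2)] unfolding N_def by blast
    qed (auto simp: N_def)
    have normal: "f \<circ> g \<circ> finv f \<in> N" if fg: "f \<in> X" "g \<in> N" for f g
    proof -
      note i = linear_group_inv[OF lX fg(1)]
      obtain z where z: "g \<in> X" "\<forall>v\<in>S. g v = cscale J z v"
        using fg by (auto simp: N_def)
      have "(f \<circ> g \<circ> finv f) v = cscale J z v" if "v \<in> S" for v
        using pS[OF i(1) that] z fcs[OF fg(1)] i(5) by simp
      then show ?thesis
        using linear_groupD(5)[OF lX] i(1) fg(1) z(1) unfolding N_def by blast
    qed
    have NX: "N \<subseteq> X" by (auto simp: N_def)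
    obtain x where x: "x \<in> X" "x \<notin> N" "x \<circ> x \<in> N" "\<forall>g\<in>X. g \<circ> x \<circ> finv g \<circ> finv x \<in> N"
      using two_group_central_involution[OF X2 lN NX False normal] by blast
    obtain c where c: "\<forall>v\<in>S. x (x v) = cscale J c v"
      using x(3) by (auto simp: N_def)
    obtain v0 where v0: "v0 \<in> S" "v0 \<noteq> 0"
      using S subspace_0 by blast
    have nz: "f v0 \<noteq> 0" if "f \<in> X" for f
      using linear_groupD(3,4)[OF lX that] v0(2) by (metis injD linear_0)
    have c0: "c \<noteq> 0"
      using nz[OF linear_groupD(5)[OF lX x(1) x(1)]] c v0 cs(6) by auto
    define \<mu> where "\<mu> = csqrt c"
    have \<mu>: "\<mu> \<noteq> 0" "\<mu> * \<mu> = c"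
      using c0 power2_csqrt[of c] by (auto simp: \<mu>_def power2_eq_square)
    define y where "y v = cscale J (inverse \<mu>) (x v)" for v
    have lx: "linear x" using linear_groupD(3)[OF lX x(1)] .
    have liny: "linear y"
      using linear_compose[OF lx cs(1)[of "inverse \<mu>"]] unfolding y_def comp_def .
    have yS: "y v \<in> S" if "v \<in> S" for v
      unfolding y_def using cs(2) pS[OF x(1) that] .
    have yy: "y (y v) = v" if v: "v \<in> S" for v
    proof -
      have "y (y v) = cscale J (inverse \<mu>) (cscale J (inverse \<mu>) (x (x v)))"
        unfolding y_def using fcs[OF x(1) pS[OF x(1) v]] by simp
      also have "\<dots> = cscale J (inverse \<mu> * (inverse \<mu> * c)) v"
        using c v cs(2,3) by simp
      also have "inverse \<mu> * (inverse \<mu> * c) = 1"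
        using \<mu> by (auto simp: field_simps)
      finally show ?thesis by (simp only: cs(4))
    qed
    have inv: "involution_on y S"
      using liny yS yy by (auto simp: involution_on_def)
    have xy: "x v = cscale J \<mu> (y v)" if "v \<in> S" for v
      unfolding y_def using cs(3)[OF pS[OF x(1) that]] \<mu> cs(4) by simp
    have proper: "\<not> (\<forall>v\<in>S. y v = v)" "\<not> (\<forall>v\<in>S. y v = - v)"
    proof -
      have notN: "\<not> (\<forall>v\<in>S. x v = cscale J z v)" for z
        using x(1,2) by (auto simp: N_def)
      then show "\<not> (\<forall>v\<in>S. y v = v)"
        using xy by fastforce
      have "cscale J \<mu> (- v) = cscale J (- \<mu>) v" for v
        using linear_neg[OF J'(1)] by (simp add: cscale_def)
      then show "\<not> (\<forall>v\<in>S. y v = - v)"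
        using xy notN[of "- \<mu>"] by fastforce
    qed
    \<comment> \<open>\<open>\<zeta>\<close> is the scalar by which the commutator of
      \<open>g\<close> and \<open>x\<close> acts. Carrying \<open>g\<close> past \<open>x\<close>
      twice gives \<open>\<zeta> * \<zeta> * c = c\<close>, so \<open>\<zeta>\<close> is 1 or
      -1.\<close>
    have dich: "(\<forall>v\<in>S. g (y v) = y (g v)) \<or> (\<forall>v\<in>S. g (y v) = - y (g v))" if g: "g \<in> X" for g
    proof -
      obtain \<zeta> where "\<forall>v\<in>S. (g \<circ> x \<circ> finv g \<circ> finv x) v = cscale J \<zeta> v"
        using x(4) g by (auto simp: N_def)
      then have \<zeta>: "g (x v) = cscale J \<zeta> (x (g v))" if "v \<in> S" for v
        using pS[OF x(1) pS[OF g that]] linear_group_inv[OF lX g] linear_group_inv[OF lX x(1)]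
        by (metis comp_apply)
      have gv0: "g v0 \<in> S" "g v0 \<noteq> 0" using pS g v0 nz by auto
      have "cscale J c (g v0) = g (x (x v0))"
        using c v0 fcs[OF g v0(1)] by simp
      also have "\<dots> = cscale J \<zeta> (x (cscale J \<zeta> (x (g v0))))"
        using \<zeta> pS[OF x(1) v0(1)] v0(1) by simp
      also have "\<dots> = cscale J (\<zeta> * \<zeta> * c) (g v0)"
        using fcs[OF x(1)] pS[OF x(1) gv0(1)] c gv0(1) cs(2,3) by (simp add: mult.assoc)
      finally have "\<zeta> * \<zeta> * c = c"
        using cs(7)[OF gv0(1) _ gv0(2)] by metis
      then have "\<zeta>\<^sup>2 = 1\<^sup>2"
        using c0 by (simp add: power2_eq_square)
      then have "\<zeta> = 1 \<or> \<zeta> = - 1"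
        by (simp only: power2_eq_iff)
      moreover have gy: "g (y v) = cscale J (inverse \<mu>) (cscale J \<zeta> (x (g v)))" if "v \<in> S" for v
        unfolding y_def using fcs[OF g pS[OF x(1) that]] \<zeta>[OF that] by simp
      moreover have "cscale J (inverse \<mu>) (cscale J (- 1) w) = - cscale J (inverse \<mu>) w" for w
        using linear_neg[OF cs(1)] cs(5) by simp
      ultimately show ?thesis
        unfolding y_def using cs(4) by auto
    qed
    let ?X = "commutant X y S" and ?Y = "commutant Y y S"
    let ?E1 = "{v \<in> S. y v = v}" and ?E2 = "{v \<in> S. y v = - v}"
    note E = eigenspaces[OF S(1) inv] and Ep = eigenspaces_proper[OF S(1) inv proper]
    \<comment> \<open>The index of \<open>?Y\<close> in \<open>?X\<close> is split at
      \<open>P\<close>: that of \<open>P\<close> in \<open>?X\<close> is bounded on the first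
      eigenspace, whose fixer \<open>N1\<close> lies in \<open>P\<close>, and that of
      \<open>N1 \<inter> ?Y\<close> in \<open>N1\<close> on the second one.\<close>
    define N1 where "N1 = fixer ?X ?E1"
    define P where "P = prod_set ?Y N1"
    have lX0: "linear_group ?X" and X20: "two_group ?X"
      using two_group_commutant[OF X2 pres] two_group_linear by blast+
    have lY0: "linear_group ?Y" and YX: "?Y \<subseteq> ?X"
      using linear_group_commutant[OF Y(1) preserves_subset[OF pres Y(2)]] commutant_mono[OF Y(2)] by blast+
    have lN1: "linear_group N1" "N1 \<subseteq> ?X"
      unfolding N1_def using linear_group_fixer[OF lX0] fixer_subset by auto
    note pE = preserves_eigenspaces[OF lX pres, of y]
    have lP: "linear_group P" "?Y \<subseteq> P" "N1 \<subseteq> P" "P \<subseteq> ?X"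
      using linear_group_prod_fixer[OF lX0 pE(1) lY0 YX] prod_set_superset[OF lY0 lN1(1)]
        prod_set_subset[OF lX0 YX lN1(2)] by (auto simp: P_def N1_def)
    have sq: "f \<circ> f \<in> ?Y" if "f \<in> ?X" for f
      using square_in_commutant[OF lX pres Y(2) that] Y(3) that commutant_subset by blast
    have yJ: "y (J v) = J (y v)" if v: "v \<in> S" for v
    proof -
      have "y (J v) = cscale J (inverse \<mu>) (J (x v))"
        unfolding y_def using comm[OF x(1) v] by simp
      also have "\<dots> = J (y v)"
        unfolding y_def using cs(8)[OF J'(1) refl] by simp
      finally show ?thesis .
    qed
    have J1: "complex_structure J ?E1" and J2: "complex_structure J ?E2"
      using J yJ linear_neg[OF J'(1)] by (auto simp: complex_structure_def)
    have "2 * card ?X \<le> 2 ^ dim ?E1 * card P"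
      by (rule less.hyps[OF Ep(3) X20 pE(1) E(1) Ep(1) J1 _ lP(1,4)])
        (use comm sq lP N1_def in \<open>auto simp: commutant_def\<close>)
    moreover have "2 * card N1 \<le> 2 ^ dim ?E2 * card (N1 \<inter> ?Y)"
    proof (rule less.hyps[OF Ep(4) two_group_subset[OF X20 lN1] preserves_subset[OF pE(2) lN1(2)] E(2) Ep(2) J2])
      show "linear_group (N1 \<inter> ?Y)" using linear_group_Int lN1(1) lY0 .
      show "f \<circ> f \<in> N1 \<inter> ?Y" if "f \<in> N1" for f
        using linear_groupD(5)[OF lN1(1) that that] sq that lN1(2) by auto
      show "fixer N1 ?E2 \<subseteq> N1 \<inter> ?Y"
      proof
        fix f assume f: "f \<in> fixer N1 ?E2"
        then have "f \<in> fixer X S"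
          by (intro fixer_eigenspaces[OF lX S(1) inv]) (auto simp: N1_def fixer_def commutant_def)
        then show "f \<in> N1 \<inter> ?Y"
          using Y(4) f by (auto simp: N1_def fixer_def commutant_def)
      qed
      show "f (J v) = J (f v)" if "f \<in> N1" "v \<in> ?E2" for f v
        using comm that lN1(2) commutant_subset by blast
    qed simp
    ultimately have "2 * 2 * card ?X \<le> 2 ^ dim ?E1 * 2 ^ dim ?E2 * card ?Y"
      unfolding P_def by (rule split_bound[OF lY0 lN1(1)])
    also have "\<dots> = 2 ^ dim S * card ?Y"
      by (simp add: power_add[symmetric] E(3))
    also have "\<dots> \<le> 2 ^ dim S * card Y"
      using card_mono[OF linear_groupD(1)[OF Y(1)] commutant_subset] by simp
    finally have "2 * 2 * card ?X \<le> 2 ^ dim S * card Y" .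
    moreover have "card X \<le> 2 * card ?X"
      using commutant_index[OF lX pres dich] by simp
    ultimately show ?thesis by linarith
  qed
qed

lemma linear_group_neg: "linear_group X \<Longrightarrow> f \<in> X \<Longrightarrow> f (- v) = - f v"
  by (simp add: linear_groupD(3) linear_neg)

text \<open>
  The chain of two layers is what makes the induction for a single layer work when the group
  swaps two blocks of imprimitivity.
\<close>

theorem two_layer_bound:
  assumes "two_group X" "preserves X S" "subspace S" "S \<noteq> {0}"
    and "linear_group Y" "Y \<subseteq> X" "linear_group Z" "Z \<subseteq> Y" "linear_group Z'" "Z' \<subseteq> Z"
    and "\<And>f. f \<in> X \<Longrightarrow> f \<circ> f \<in> Y" "\<And>f. f \<in> Z \<Longrightarrow> f \<circ> f \<in> Z'"
    and "fixer X S \<subseteq> Y" "fixer Z S \<subseteq> Z'"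
  shows "2 * (card X * card Z) \<le> 4 ^ dim S * (card Y * card Z')"
  using assms
proof (induction "dim S" arbitrary: X S Y Z Z' rule: less_induct)
  case less
  note X2 = less.prems(1) and pres = less.prems(2) and S = less.prems(3,4)
    and Y = less.prems(5,6) and Z = less.prems(7,8) and Z' = less.prems(9,10)
    and sqX = less.prems(11) and sqZ = less.prems(12) and fixX = less.prems(13) and fixZ = less.prems(14)
  have lX: "linear_group X" using X2 by (rule two_group_linear)
  have ZX: "Z \<subseteq> X" and WX: "Z' \<subseteq> X" using Y Z Z' by auto
  have fin: "finite X" "finite Y" "finite Z" "finite Z'"
    using linear_groupD(1) lX Y Z Z' by auto
  have presY: "preserves Y S" and presZ: "preserves Z S" and presW: "preserves Z' S"
    using preserves_subset[OF pres] Y Z Z' by auto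
  have pos: "1 \<le> dim S" using dim_pos[OF S] by simp
  from X2 pres show ?case
  proof (cases rule: real_dichotomy)
    case scalar
    \<comment> \<open>A sign can be lost only once along the chain \<open>X\<close>,
      \<open>Y\<close>, \<open>Z\<close>, \<open>Z'\<close>. If \<open>Y\<close> acts trivially on
      \<open>S\<close>, so does \<open>Z\<close>, and \<open>Z = Z'\<close>; if \<open>Y\<close>
      contains an element acting as -1, then \<open>Y = X\<close>.\<close>
    have le: "card X * card Z \<le> 2 * (card Y * card Z')"
    proof (cases "Y \<subseteq> fixer X S")
      case True
      then have "Z \<subseteq> fixer Z S" using Z by (auto simp: fixer_def)
      then have "Z = Z'" using fixZ Z' by auto
      moreover have "card X \<le> 2 * card Y"
        using card_le_two_fixer[OF lX pres scalar] card_mono[OF fin(2) fixX] by linarith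
      ultimately show ?thesis by simp
    next
      case False
      then obtain g where g: "g \<in> Y" "g \<notin> fixer X S" by blast
      then have gX: "g \<in> X" using Y by auto
      note i = linear_group_inv[OF lX gX]
      have gneg: "\<forall>v\<in>S. g v = - v"
        using scalar[OF gX] g gX by (auto simp: fixer_def)
      have "X \<subseteq> Y"
      proof
        fix f assume f: "f \<in> X"
        show "f \<in> Y"
        proof (cases "f \<in> fixer X S")
          case False
          then have "\<forall>v\<in>S. f v = - v" using scalar[OF f] f by (auto simp: fixer_def)
          then have "\<forall>v\<in>S. (g \<circ> f) v = v"
            using gneg linear_group_neg[OF lX gX] by simp
          then have "g \<circ> f \<in> Y"
            using fixX linear_groupD(5)[OF lX gX f] by (auto simp: fixer_def)
          then have "finv g \<circ> (g \<circ> f) \<in> Y"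
            using linear_groupD(5)[OF Y(1)] linear_group_inv(1)[OF Y(1) g(1)] by blast
          moreover have "finv g \<circ> (g \<circ> f) = f" using i by (simp add: fun_eq_iff)
          ultimately show ?thesis by simp
        qed (use fixX in blast)
      qed
      then have "X = Y" using Y by auto
      moreover have "card Z \<le> 2 * card (fixer Z S)"
        by (rule card_le_two_fixer[OF Z(1) presZ]) (use scalar ZX in auto)
      then have "card Z \<le> 2 * card Z'"
        using card_mono[OF fin(4) fixZ] by linarith
      ultimately show ?thesis by simp
    qed
    have "(4::nat) ^ 1 \<le> 4 ^ dim S"
      using pos by (intro power_increasing) auto
    then have "4 * (card Y * card Z') \<le> 4 ^ dim S * (card Y * card Z')"
      by (intro mult_le_mono) auto
    then show ?thesis using le by linarith
  next
    case (involution y)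
    let ?X = "commutant X y S" and ?Y = "commutant Y y S"
    let ?Z = "commutant Z y S" and ?Z' = "commutant Z' y S"
    note dich = involution(5)
    have X20: "two_group ?X" and lX0: "linear_group ?X"
      using two_group_commutant[OF X2 pres] two_group_linear by blast+
    have l0: "linear_group ?Y" "linear_group ?Z" "linear_group ?Z'"
      using linear_group_commutant Y(1) Z(1) Z'(1) presY presZ presW by auto
    have sub: "?Y \<subseteq> ?X" "?Z \<subseteq> ?Y" "?Z' \<subseteq> ?Z" "?Z \<subseteq> ?X" "?Z' \<subseteq> ?X"
      using commutant_mono Y(2) Z(2) Z'(2) ZX WX by metis+
    have sqX0: "f \<circ> f \<in> ?Y" if "f \<in> ?X" for f
      using square_in_commutant[OF lX pres Y(2) that] sqX that commutant_subset by blast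
    have sqZ0: "f \<circ> f \<in> ?Z'" if "f \<in> ?Z" for f
      using square_in_commutant[OF Z(1) presZ Z'(2) that] sqZ that commutant_subset by blast
    \<comment> \<open>This has one factor 2 more than the claim; the passage from the commutants
      back to the full groups uses it up.\<close>
    have main: "4 * (card ?X * card ?Z) \<le> 4 ^ dim S * (card ?Y * card ?Z')"
      using involution(4)
    proof
      assume sq: "\<forall>v\<in>S. y (y v) = v"
      have inv: "involution_on y S"
        using sq linear_groupD(3)[OF lX involution(1)] preservesD[OF pres involution(1)]
        by (auto simp: involution_on_def)
      let ?E1 = "{v \<in> S. y v = v}" and ?E2 = "{v \<in> S. y v = - v}"
      note E = eigenspaces[OF S(1) inv] and Ep = eigenspaces_proper[OF S(1) inv involution(2,3)]
      note pE = preserves_eigenspaces[OF lX pres, of y]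
      \<comment> \<open>The induction hypothesis is applied to the chain \<open>?X\<close>,
        \<open>P\<close>, \<open>?Z\<close>, \<open>Q\<close> on the first eigenspace and to
        \<open>N\<close>, \<open>N \<inter> ?Y\<close>, \<open>M\<close>,
        \<open>M \<inter> ?Z'\<close> on the second. The product of the two estimates collapses by
        \<open>card_prod_set\<close>.\<close>
      define N where "N = fixer ?X ?E1"
      define M where "M = fixer ?Z ?E1"
      define P where "P = prod_set ?Y N"
      define Q where "Q = prod_set ?Z' M"
      have lN: "linear_group N" "N \<subseteq> ?X" and lM: "linear_group M" "M \<subseteq> ?Z"
        unfolding N_def M_def by (rule linear_group_fixer[OF lX0] linear_group_fixer[OF l0(2)] fixer_subset)+
      have MN: "M \<subseteq> N"
        using sub by (auto simp: N_def M_def fixer_def)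
      have lP: "linear_group P" "P \<subseteq> ?X" "?Y \<subseteq> P" "N \<subseteq> P"
        using linear_group_prod_fixer[OF lX0 pE(1) l0(1) sub(1)] prod_set_superset[OF l0(1) lN(1)]
          prod_set_subset[OF lX0 sub(1) lN(2)] by (auto simp: P_def N_def)
      have lQ: "linear_group Q" "Q \<subseteq> ?Z" "?Z' \<subseteq> Q" "M \<subseteq> Q"
        using linear_group_prod_fixer[OF l0(2) preserves_subset[OF pE(1) sub(4)] l0(3) sub(3)]
          prod_set_superset[OF l0(3) lM(1)] prod_set_subset[OF l0(2) sub(3) lM(2)]
        by (auto simp: Q_def M_def)
      have fixE2: "f \<in> fixer X S" if "f \<in> fixer N ?E2" for f
        using that by (intro fixer_eigenspaces[OF lX S(1) inv]) (auto simp: N_def fixer_def commutant_def)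
      have "2 * (card ?X * card ?Z) \<le> 4 ^ dim ?E1 * (card P * card Q)"
      proof (rule less.hyps[OF Ep(3) X20 pE(1) E(1) Ep(1) lP(1,2) l0(2) _ lQ(1,2)])
        show "?Z \<subseteq> P" using sub lP by auto
      qed (use sqX0 sqZ0 lP lQ in \<open>auto simp: N_def[symmetric] M_def[symmetric]\<close>)
      moreover have "2 * (card N * card M) \<le> 4 ^ dim ?E2 * (card (N \<inter> ?Y) * card (M \<inter> ?Z'))"
      proof (rule less.hyps[OF Ep(4) two_group_subset[OF X20 lN] preserves_subset[OF pE(2) lN(2)] E(2) Ep(2)])
        show "linear_group (N \<inter> ?Y)" "linear_group (M \<inter> ?Z')"
          using linear_group_Int lN(1) lM(1) l0 by auto
        show "M \<subseteq> N \<inter> ?Y" using MN lM sub by auto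
        show "f \<circ> f \<in> N \<inter> ?Y" if "f \<in> N" for f
          using linear_groupD(5)[OF lN(1) that that] sqX0 that lN(2) by auto
        show "f \<circ> f \<in> M \<inter> ?Z'" if "f \<in> M" for f
          using linear_groupD(5)[OF lM(1) that that] sqZ0 that lM(2) by auto
        show "fixer N ?E2 \<subseteq> N \<inter> ?Y"
        proof
          fix f assume f: "f \<in> fixer N ?E2"
          then show "f \<in> N \<inter> ?Y"
            using fixE2[OF f] fixX by (auto simp: N_def fixer_def commutant_def)
        qed
        show "fixer M ?E2 \<subseteq> M \<inter> ?Z'"
        proof
          fix f assume f: "f \<in> fixer M ?E2"
          then have "f \<in> fixer N ?E2" using MN by (auto simp: fixer_def)
          then show "f \<in> M \<inter> ?Z'"
            using fixE2[of f] fixZ f by (auto simp: M_def fixer_def commutant_def)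
        qed
      qed (use lM lN in auto)
      ultimately have "(2 * (card ?X * card ?Z)) * (2 * (card N * card M))
          \<le> (4 ^ dim ?E1 * (card P * card Q)) * (4 ^ dim ?E2 * (card (N \<inter> ?Y) * card (M \<inter> ?Z')))"
        by (rule mult_le_mono)
      also have "\<dots> = 4 ^ dim S * ((card P * card (?Y \<inter> N)) * (card Q * card (?Z' \<inter> M)))"
        by (simp add: E(3)[symmetric] power_add Int_commute algebra_simps)
      also have "\<dots> = 4 ^ dim S * ((card ?Y * card N) * (card ?Z' * card M))"
        by (simp add: P_def Q_def card_prod_set l0 lN(1) lM(1))
      finally have "(4 * (card ?X * card ?Z)) * (card N * card M)
          \<le> (4 ^ dim S * (card ?Y * card ?Z')) * (card N * card M)"
        by (simp add: algebra_simps)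
      moreover have "0 < card N * card M"
        using linear_groupD(1,2)[OF lN(1)] linear_groupD(1,2)[OF lM(1)] by (auto simp: card_gt_0_iff)
      ultimately show ?thesis by (simp only: mult_le_cancel2)
    next
      assume sq: "\<forall>v\<in>S. y (y v) = - v"
      have J: "complex_structure y S"
        using sq linear_groupD(3)[OF lX involution(1)] preservesD[OF pres involution(1)]
        by (auto simp: complex_structure_def)
      \<comment> \<open>Each layer separately satisfies the complex estimate, so two spare factors 2
        are available.\<close>
      have "2 * card ?X \<le> 2 ^ dim S * card ?Y"
        by (rule complex_two_group_bound[OF X20 preserves_subset[OF pres commutant_subset] S J _ l0(1) sub(1) sqX0])
          (use fixX in \<open>auto simp: commutant_def fixer_def\<close>)
      moreover have "2 * card ?Z \<le> 2 ^ dim S * card ?Z'"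
        by (rule complex_two_group_bound[OF two_group_subset[OF X20 l0(2) sub(4)]
              preserves_subset[OF presZ commutant_subset] S J _ l0(3) sub(3) sqZ0])
          (use fixZ in \<open>auto simp: commutant_def fixer_def\<close>)
      ultimately have "(2 * card ?X) * (2 * card ?Z) \<le> (2 ^ dim S * card ?Y) * (2 ^ dim S * card ?Z')"
        by (rule mult_le_mono)
      moreover have "(2::nat) ^ dim S * 2 ^ dim S = 4 ^ dim S"
        by (simp add: power_mult_distrib[symmetric])
      ultimately show ?thesis by (simp add: algebra_simps)
    qed
    define e where "e A = (if A \<subseteq> commutant A y S then 1 else 2 :: nat)" for A
    have card: "card X = e X * card ?X" "card Y = e Y * card ?Y" "card Z = e Z * card ?Z" "card Z' = e Z' * card ?Z'"
      unfolding e_def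
      using commutant_index[OF lX pres dich] commutant_index[OF Y(1) presY, of y]
        commutant_index[OF Z(1) presZ, of y] commutant_index[OF Z'(1) presW, of y] dich Y(2) ZX WX
      by blast+
    \<comment> \<open>An anticommuting element of \<open>Z\<close> is also one of \<open>Y\<close>.
      So index 2 for both \<open>X\<close> and \<open>Z\<close> forces index 2 for \<open>Y\<close>,
      and at most one factor 2 is left over.\<close>
    have "Y \<subseteq> ?Y \<Longrightarrow> Z \<subseteq> ?Z"
      using Z(2) by (auto simp: commutant_def)
    then have e: "e X * e Z \<le> 2 * (e Y * e Z')"
      by (auto simp: e_def)
    have "2 * (card X * card Z) = (2 * (card ?X * card ?Z)) * (e X * e Z)"
      unfolding card(1,3) by (simp add: algebra_simps)
    also have "\<dots> \<le> (2 * (card ?X * card ?Z)) * (2 * (e Y * e Z'))"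
      using e by (rule mult_le_mono2)
    also have "\<dots> = (4 * (card ?X * card ?Z)) * (e Y * e Z')"
      by (simp add: algebra_simps)
    also have "\<dots> \<le> (4 ^ dim S * (card ?Y * card ?Z')) * (e Y * e Z')"
      using main by (rule mult_le_mono1)
    also have "\<dots> = 4 ^ dim S * (card Y * card Z')"
      unfolding card(2,4) by (simp add: algebra_simps)
    finally show ?thesis .
  qed
qed

section \<open>The rank bound for a single layer\<close>

lemma commutator_in_subgroup:
  assumes X: "linear_group X" and Y: "linear_group Y" and sq: "\<And>f. f \<in> X \<Longrightarrow> f \<circ> f \<in> Y"
    and f: "f \<in> X" and g: "g \<in> X"
  shows "f \<circ> g \<circ> finv f \<circ> finv g \<in> Y"
proof -
  note i = linear_group_inv[OF X f] linear_group_inv[OF X g]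
  \<comment> \<open>The commutator of f and g is f^2 (f^-1 g)^2 g^-2, a product of three
    squares.\<close>
  have "(f \<circ> f) \<circ> ((finv f \<circ> g) \<circ> (finv f \<circ> g)) \<circ> (finv g \<circ> finv g) \<in> Y"
    using linear_groupD(5)[OF Y] sq linear_groupD(5)[OF X] i f g by metis
  moreover have "(f \<circ> f) \<circ> ((finv f \<circ> g) \<circ> (finv f \<circ> g)) \<circ> (finv g \<circ> finv g) = f \<circ> g \<circ> finv f \<circ> finv g"
    using i by (simp add: fun_eq_iff)
  ultimately show ?thesis by simp
qed

lemma finv_finv:
  assumes X: "linear_group X" and f: "f \<in> X"
  shows "finv (finv f) = f"
  using linear_group_inv(2,3)[OF assms] by (intro inv_unique_comp)

text \<open>Moving \<open>y\<close> through the conjugate passes both \<open>finv t\<close> and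
  \<open>t\<close>, so the sign of an anticommuting \<open>t\<close> cancels. This is what lets a
  swap exchange the fixers of the two eigenspaces inside the commutant.\<close>

lemma commutant_conj:
  assumes X: "linear_group X" and pres: "preserves X S"
    and dich: "\<And>g. g \<in> X \<Longrightarrow> (\<forall>v\<in>S. g (y v) = y (g v)) \<or> (\<forall>v\<in>S. g (y v) = - y (g v))"
    and t: "t \<in> X" and g: "g \<in> commutant X y S"
  shows "t \<circ> g \<circ> finv t \<in> commutant X y S"
proof -
  note i = linear_group_inv[OF X t]
  have gX: "g \<in> X" using g by (auto simp: commutant_def)
  have "t (g (finv t (y v))) = y (t (g (finv t v)))" if v: "v \<in> S" for v
  proof -
    define w where "w = finv t v"
    have w: "w \<in> S" "t w = v" using preservesD[OF pres i(1) v] i(5) by (auto simp: w_def)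
    have gw: "g w \<in> S" "g (y w) = y (g w)"
      using preservesD[OF pres gX w(1)] g w by (auto simp: commutant_def)
    from dich[OF t] show ?thesis
    proof
      assume c: "\<forall>v\<in>S. t (y v) = y (t v)"
      then have "y v = t (y w)" using w by simp
      then show ?thesis using c gw i(4) by (simp add: w_def[symmetric])
    next
      assume c: "\<forall>v\<in>S. t (y v) = - y (t v)"
      then have "y v = t (- y w)" using w linear_group_neg[OF X t] by simp
      then have "finv t (y v) = - y w" using i(4) by simp
      then have "t (g (finv t (y v))) = - t (g (y w))"
        using linear_group_neg[OF X t] linear_group_neg[OF X gX] by simp
      then show ?thesis using c gw by (simp add: w_def[symmetric])
    qed
  qed
  then show ?thesis
    using linear_groupD(5)[OF X] i(1) t gX by (auto simp: commutant_def)
qed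

text \<open>The diagonal sign matrices with trivial \<open>Y\<close> attain equality, so the
  induction hypothesis has no spare factor that could pay for a swap. The case of anticommuting
  elements therefore takes the route through \<open>two_layer_bound\<close>.\<close>

theorem two_group_bound:
  assumes "two_group X" "preserves X S" "subspace S"
    and "linear_group Y" "Y \<subseteq> X" "\<And>f. f \<in> X \<Longrightarrow> f \<circ> f \<in> Y" "fixer X S \<subseteq> Y"
  shows "card X \<le> 2 ^ dim S * card Y"
  using assms
proof (induction "dim S" arbitrary: X S Y rule: less_induct)
  case less
  note X2 = less.prems(1) and pres = less.prems(2) and S = less.prems(3)
    and Y = less.prems(4,5) and sqX = less.prems(6) and fixX = less.prems(7)
  have lX: "linear_group X" using X2 by (rule two_group_linear)
  have fin: "finite X" "finite Y"
    using linear_groupD(1) lX Y by auto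
  from X2 pres show ?case
  proof (cases rule: real_dichotomy)
    case scalar
    show ?thesis
    proof (cases "S = {0}")
      case True
      then have "X \<subseteq> fixer X S"
        using linear_groupD(3)[OF lX] by (auto simp: fixer_def linear_0)
      then have "card X \<le> card Y" using fixX fin by (intro card_mono) auto
      then show ?thesis using True by simp
    next
      case False
      have "card X \<le> 2 * card Y"
        using card_le_two_fixer[OF lX pres scalar] card_mono[OF fin(2) fixX] by linarith
      moreover have "(2::nat) ^ 1 \<le> 2 ^ dim S"
        using dim_pos[OF S False] by (intro power_increasing) auto
      then have "2 * card Y \<le> 2 ^ dim S * card Y"
        by (intro mult_le_mono) auto
      ultimately show ?thesis by linarith
    qed
  next
    case (involution y)
    let ?X = "commutant X y S" and ?Y = "commutant Y y S"
    note dich = involution(5)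
    have S0: "S \<noteq> {0}"
      using involution(2) linear_groupD(3)[OF lX involution(1)] by (auto simp: linear_0)
    have X20: "two_group ?X" and lX0: "linear_group ?X"
      using two_group_commutant[OF X2 pres] two_group_linear by blast+
    have lY0: "linear_group ?Y" and YX: "?Y \<subseteq> ?X"
      using linear_group_commutant[OF Y(1) preserves_subset[OF pres Y(2)]] commutant_mono[OF Y(2)] by blast+
    have sq0: "f \<circ> f \<in> ?Y" if "f \<in> ?X" for f
      using square_in_commutant[OF lX pres Y(2) that] sqX that commutant_subset by blast
    have Y0Y: "card ?Y \<le> card Y"
      using card_mono[OF fin(2) commutant_subset] .
    have idx: "card X \<le> 2 * card ?X"
      using commutant_index[OF lX pres dich] by simp
    \<comment> \<open>A spare factor 2 for the commutant pays for its index in \<open>X\<close>. It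
      is supplied by the complex bound when the square of \<open>y\<close> is -1, and by the
      two-layer bound in the case of a swap.\<close>
    have half: ?thesis if "2 * card ?X \<le> 2 ^ dim S * card ?Y"
      using idx that mult_le_mono2[OF Y0Y, of "2 ^ dim S"] by linarith
    from involution(4) show ?thesis
    proof
      assume sq: "\<forall>v\<in>S. y (y v) = - v"
      have J: "complex_structure y S"
        using sq linear_groupD(3)[OF lX involution(1)] preservesD[OF pres involution(1)]
        by (auto simp: complex_structure_def)
      have "2 * card ?X \<le> 2 ^ dim S * card ?Y"
        by (rule complex_two_group_bound[OF X20 preserves_subset[OF pres commutant_subset] S S0 J _ lY0 YX sq0])
          (use fixX in \<open>auto simp: commutant_def fixer_def\<close>)
      then show ?thesis by (rule half)
    next
      assume sq: "\<forall>v\<in>S. y (y v) = v"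
      have inv: "involution_on y S"
        using sq linear_groupD(3)[OF lX involution(1)] preservesD[OF pres involution(1)]
        by (auto simp: involution_on_def)
      let ?E1 = "{v \<in> S. y v = v}" and ?E2 = "{v \<in> S. y v = - v}"
      note E = eigenspaces[OF S(1) inv] and Ep = eigenspaces_proper[OF S(1) inv involution(2,3)]
      note pE = preserves_eigenspaces[OF lX pres, of y]
      define N where "N = fixer ?X ?E1"
      define P where "P = prod_set ?Y N"
      have lN: "linear_group N" "N \<subseteq> ?X"
        using linear_group_fixer[OF lX0] fixer_subset by (auto simp: N_def)
      have lP: "linear_group P" "P \<subseteq> ?X" "?Y \<subseteq> P" "N \<subseteq> P"
        using linear_group_prod_fixer[OF lX0 pE(1) lY0 YX] prod_set_superset[OF lY0 lN(1)]
          prod_set_subset[OF lX0 YX lN(2)] by (auto simp: P_def N_def)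
      have fixS: "f \<in> fixer X S" if "f \<in> ?X" "\<And>v. v \<in> ?E1 \<Longrightarrow> f v = v" "\<And>v. v \<in> ?E2 \<Longrightarrow> f v = v" for f
        using that by (intro fixer_eigenspaces[OF lX S(1) inv]) (auto simp: commutant_def)
      show ?thesis
      proof (cases "X \<subseteq> ?X")
        case True
        have "card ?X \<le> 2 ^ dim ?E1 * card P"
          by (rule less.hyps[OF Ep(3) X20 pE(1) E(1) lP(1,2)])
            (use sq0 lP N_def in auto)
        moreover have "card N \<le> 2 ^ dim ?E2 * card (N \<inter> ?Y)"
        proof (rule less.hyps[OF Ep(4) two_group_subset[OF X20 lN] preserves_subset[OF pE(2) lN(2)] E(2)])
          show "linear_group (N \<inter> ?Y)" using linear_group_Int lN(1) lY0 .
          show "f \<circ> f \<in> N \<inter> ?Y" if "f \<in> N" for f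
            using linear_groupD(5)[OF lN(1) that that] sq0 that lN(2) by auto
          show "fixer N ?E2 \<subseteq> N \<inter> ?Y"
          proof
            fix f assume f: "f \<in> fixer N ?E2"
            then have "f \<in> Y"
              using fixS[of f] fixX by (auto simp: N_def fixer_def)
            then show "f \<in> N \<inter> ?Y"
              using f by (auto simp: N_def fixer_def commutant_def)
          qed
        qed simp
        ultimately have "1 * 1 * card ?X \<le> 2 ^ dim ?E1 * 2 ^ dim ?E2 * card ?Y"
          unfolding P_def by (intro split_bound[OF lY0 lN(1)]) simp_all
        then have "card ?X \<le> 2 ^ dim S * card ?Y"
          by (simp add: power_add[symmetric] E(3))
        also have "\<dots> \<le> 2 ^ dim S * card Y"
          using Y0Y by (rule mult_le_mono2)
        also have "?X = X" using True commutant_subset by blast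
        finally show ?thesis .
      next
        case False
        then obtain t where t: "t \<in> X" "t \<notin> ?X" by blast
        note i = linear_group_inv[OF lX t(1)]
        have it: "finv t \<in> X" "finv t \<notin> ?X"
          using i(1) linear_group_inv(1)[OF lX0, of "finv t"] finv_finv[OF lX t(1)] t(2) by auto
        have anti: "s (y v) = - y (s v)" if "s \<in> X" "s \<notin> ?X" "v \<in> S" for s v
          using dich[OF that(1)] that by (auto simp: commutant_def)
        have swap1: "s v \<in> ?E2" if s: "s \<in> X" "s \<notin> ?X" and v: "v \<in> ?E1" for s v
        proof -
          have "s v = - y (s v)" using anti[OF s, of v] v by simp
          then have "y (s v) = - s v" by (metis minus_minus)
          then show ?thesis using v preservesD[OF pres s(1), of v] by simp
        qed
        have swap2: "s v \<in> ?E1" if s: "s \<in> X" "s \<notin> ?X" and v: "v \<in> ?E2" for s v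
          using anti[OF s, of v] v preservesD[OF pres s(1), of v] linear_group_neg[OF lX s(1)] by auto
        have dimt: "dim (t ` E) = dim E" for E
          using linear_groupD(3,4)[OF lX t(1)] by (intro dim_image_eq) (auto intro: inj_on_subset)
        have "dim ?E1 \<le> dim ?E2"
          unfolding dimt[of ?E1, symmetric] using swap1[OF t] by (intro dim_subset image_subsetI)
        moreover have "dim ?E2 \<le> dim ?E1"
          unfolding dimt[of ?E2, symmetric] using swap2[OF t] by (intro dim_subset image_subsetI)
        ultimately have dimS: "dim S = dim ?E1 + dim ?E1"
          using E(3) by linarith
        \<comment> \<open>\<open>N'\<close> is the counterpart of \<open>N\<close> for the other
          eigenspace, and conjugation by \<open>t\<close> exchanges the two. Replacing
          \<open>N\<close> by \<open>N'\<close> moves the lower layer to \<open>?E1\<close>, where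
          the upper layer already acts.\<close>
        define N' where "N' = fixer ?X ?E2"
        have lN': "linear_group N'" "N' \<subseteq> ?X"
          using linear_group_fixer[OF lX0] fixer_subset by (auto simp: N'_def)
        have conj1: "t \<circ> f \<circ> finv t \<in> N'" if "f \<in> N" for f
        proof -
          have f: "f \<in> ?X" "\<And>v. v \<in> ?E1 \<Longrightarrow> f v = v" using that by (auto simp: N_def fixer_def)
          have "(t \<circ> f \<circ> finv t) v = v" if "v \<in> ?E2" for v
            using f(2)[OF swap2[OF it that]] i(5) by simp
          then show ?thesis
            using commutant_conj[OF lX pres dich t(1) f(1)] by (simp add: N'_def fixer_def)
        qed
        have conj2: "finv t \<circ> f \<circ> t \<in> N" if "f \<in> N'" for f
        proof -
          have f: "f \<in> ?X" "\<And>v. v \<in> ?E2 \<Longrightarrow> f v = v" using that by (auto simp: N'_def fixer_def)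
          have "(finv t \<circ> f \<circ> t) v = v" if "v \<in> ?E1" for v
            using f(2)[OF swap1[OF t that]] i(4) by simp
          then show ?thesis
            using commutant_conj[OF lX pres dich it(1) f(1)] finv_finv[OF lX t(1)]
            by (simp add: N_def fixer_def)
        qed
        \<comment> \<open>\<open>f\<close> and its conjugate by \<open>t\<close> differ by a
          commutator, which lies in \<open>Y\<close> because all squares do. Hence \<open>N'\<close>
          is contained in \<open>P\<close>, and membership in \<open>Y\<close> is invariant under
          the conjugation.\<close>
        have comm: "f \<circ> finv (finv t \<circ> f \<circ> t) \<in> ?Y \<and> (finv t \<circ> f \<circ> t) \<in> Y = (f \<in> Y)" if f: "f \<in> N'" for f
        proof -
          have fX: "f \<in> X" "f \<in> ?X" using f lN'(2) commutant_subset[of X y S] by blast+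
          note j = linear_group_inv[OF lX fX(1)]
          let ?g = "finv t \<circ> f \<circ> t"
          have g: "?g \<in> ?X" "?g \<in> X" using conj2[OF f] lN(2) commutant_subset[of X y S] by blast+
          have inv: "finv ?g = finv t \<circ> finv f \<circ> t"
            using i j by (intro inv_unique_comp) (simp_all add: fun_eq_iff)
          have "f \<circ> finv t \<circ> finv f \<circ> finv (finv t) \<in> Y"
            using commutator_in_subgroup[OF lX Y(1) sqX fX(1) it(1)] .
          then have c: "f \<circ> finv ?g \<in> Y"
            unfolding inv finv_finv[OF lX t(1)] by (simp add: comp_assoc)
          have "f \<circ> finv ?g \<in> ?X"
            using linear_groupD(5)[OF lX0 fX(2)] linear_group_inv(1)[OF lX0 g(1)] by blast
          then have c1: "f \<circ> finv ?g \<in> ?Y" using c by (auto simp: commutant_def)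
          have e1: "f = (f \<circ> finv ?g) \<circ> ?g" and e2: "?g = finv (f \<circ> finv ?g) \<circ> f"
            subgoal using linear_group_inv[OF lX g(2)] by (simp add: fun_eq_iff)
            subgoal
            proof -
              have "finv (f \<circ> finv ?g) = ?g \<circ> finv f"
                using linear_group_inv[OF lX g(2)] j by (intro inv_unique_comp) (simp_all add: fun_eq_iff)
              then show ?thesis using j by (simp add: fun_eq_iff)
            qed
            done
          have "?g \<in> Y \<longleftrightarrow> f \<in> Y"
            using e1 e2 linear_groupD(5)[OF Y(1)] c linear_group_inv(1)[OF Y(1) c] by metis
          then show ?thesis using c1 by blast
        qed
        have N'P: "N' \<subseteq> P"
        proof
          fix f assume f: "f \<in> N'"
          let ?g = "finv t \<circ> f \<circ> t"
          have "?g \<in> X" using conj2[OF f] lN(2) commutant_subset[of X y S] by blast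
          then have "f = (f \<circ> finv ?g) \<circ> ?g"
            using linear_group_inv(4)[OF lX, of ?g] by (simp add: fun_eq_iff)
          then show "f \<in> P"
            unfolding P_def prod_set_def
            using comm[OF f] conj2[OF f] by (intro image_eqI[of _ _ "(f \<circ> finv ?g, ?g)"]) auto
        qed
        have inj: "inj_on (\<lambda>f. s \<circ> f \<circ> s') A" if "s \<in> X" "s' \<in> X" for s s' A
        proof (rule inj_onI)
          fix f g assume "s \<circ> f \<circ> s' = s \<circ> g \<circ> s'"
          then have "finv s \<circ> (s \<circ> f \<circ> s') \<circ> finv s' = finv s \<circ> (s \<circ> g \<circ> s') \<circ> finv s'" by simp
          then show "f = g"
            using linear_group_inv[OF lX that(1)] linear_group_inv[OF lX that(2)]
            by (simp add: fun_eq_iff)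
        qed
        have cN: "card N \<le> card N'"
          using conj1 linear_groupD(1)[OF lN'(1)] inj[OF t(1) it(1)]
          by (intro card_inj_on_le[of "\<lambda>f. t \<circ> f \<circ> finv t"]) auto
        have cNY: "card (N' \<inter> ?Y) \<le> card (N \<inter> ?Y)"
        proof (rule card_inj_on_le)
          show "inj_on (\<lambda>f. finv t \<circ> f \<circ> t) (N' \<inter> ?Y)" by (rule inj[OF it(1) t(1)])
          show "(\<lambda>f. finv t \<circ> f \<circ> t) ` (N' \<inter> ?Y) \<subseteq> N \<inter> ?Y"
          proof (rule image_subsetI)
            fix f assume f: "f \<in> N' \<inter> ?Y"
            then have "finv t \<circ> f \<circ> t \<in> N" "finv t \<circ> f \<circ> t \<in> Y"
              using conj2[of f] comm[of f] commutant_subset[of Y y S] by blast+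
            then show "finv t \<circ> f \<circ> t \<in> N \<inter> ?Y"
              using lN by (auto simp: commutant_def)
          qed
          show "finite (N \<inter> ?Y)" using linear_groupD(1)[OF lN(1)] by simp
        qed
        \<comment> \<open>The chain is \<open>?X\<close>, \<open>P\<close>, \<open>N'\<close>,
          \<open>N' \<inter> ?Y\<close> on \<open>?E1\<close>. As \<open>?E1\<close> has half the
          dimension of \<open>S\<close>, \<open>4 ^ dim ?E1\<close> is \<open>2 ^ dim S\<close>, and
          the spare factor 2 of the two-layer bound survives.\<close>
        have "2 * (card ?X * card N') \<le> 4 ^ dim ?E1 * (card P * card (N' \<inter> ?Y))"
        proof (rule two_layer_bound[OF X20 pE(1) E(1) Ep(1) lP(1,2) lN'(1) N'P])
          show "linear_group (N' \<inter> ?Y)" using linear_group_Int lN'(1) lY0 .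
          show "f \<circ> f \<in> N' \<inter> ?Y" if "f \<in> N'" for f
            using linear_groupD(5)[OF lN'(1) that that] sq0 that lN'(2) by auto
          show "fixer N' ?E1 \<subseteq> N' \<inter> ?Y"
          proof
            fix f assume f: "f \<in> fixer N' ?E1"
            then have "f \<in> Y"
              using fixS[of f] fixX by (auto simp: N'_def fixer_def)
            then show "f \<in> N' \<inter> ?Y"
              using f by (auto simp: N'_def fixer_def commutant_def)
          qed
        qed (use sq0 lP N_def in auto)
        then have "2 * card ?X * card N \<le> 2 ^ dim S * (card P * card (?Y \<inter> N))"
        proof -
          assume *: "2 * (card ?X * card N') \<le> 4 ^ dim ?E1 * (card P * card (N' \<inter> ?Y))"
          have "2 * card ?X * card N \<le> 2 * (card ?X * card N')"
            using cN by simp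
          also note *
          also have "4 ^ dim ?E1 * (card P * card (N' \<inter> ?Y)) \<le> 4 ^ dim ?E1 * (card P * card (N \<inter> ?Y))"
            using mult_le_mono2[OF mult_le_mono2[OF cNY]] .
          also have "(4::nat) ^ dim ?E1 = 2 ^ dim S"
            unfolding dimS power_add power_mult_distrib[symmetric] by simp
          finally show ?thesis by (simp add: Int_commute)
        qed
        also have "card P * card (?Y \<inter> N) = card ?Y * card N"
          unfolding P_def by (rule card_prod_set[OF lY0 lN(1)])
        finally have "(2 * card ?X) * card N \<le> (2 ^ dim S * card ?Y) * card N"
          by (simp add: algebra_simps)
        moreover have "0 < card N"
          using linear_groupD(1,2)[OF lN(1)] by (auto simp: card_gt_0_iff)
        ultimately have "2 * card ?X \<le> 2 ^ dim S * card ?Y"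
          by (simp only: mult_le_cancel2)
        then show ?thesis by (rule half)
      qed
    qed
  qed
qed

section \<open>The group of exact divisors\<close>

text \<open>For sets of prime factors of \<open>l\<close> this parametrizes the exact divisors, and
  the multiplication of \<open>W l\<close> becomes the symmetric difference. The group laws are
  checked on the sets.\<close>

definition exact_part :: "nat \<Rightarrow> nat set \<Rightarrow> nat" where
  "exact_part l S = (\<Prod>p\<in>S. p ^ multiplicity p l)"

lemma exact_part_empty [simp]: "exact_part l {} = 1"
  by (simp add: exact_part_def)

lemma exact_part_Un:
  assumes "finite S" "finite T" "S \<inter> T = {}"
  shows "exact_part l (S \<union> T) = exact_part l S * exact_part l T"
  using assms by (simp add: exact_part_def prod.union_disjoint)

lemma exact_part_split:
  "finite S \<Longrightarrow> exact_part l S = exact_part l (S \<inter> T) * exact_part l (S - T)"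
  using exact_part_Un[of "S \<inter> T" "S - T" l] by (simp add: Int_Diff_Un Int_Diff_disjoint)

lemma exact_part_pos:
  assumes "S \<subseteq> prime_factors l"
  shows "0 < exact_part l S"
  unfolding exact_part_def
proof (intro prod_pos ballI zero_less_power)
  fix p assume "p \<in> S"
  then show "0 < p" using assms by (auto simp: in_prime_factors_iff prime_gt_0_nat)
qed

lemma exact_part_all:
  assumes "0 < l"
  shows "exact_part l (prime_factors l) = l"
  using prime_factorization_nat[of l] assms by (simp add: exact_part_def)

lemma coprime_exact_part:
  assumes "S \<subseteq> prime_factors l" "T \<subseteq> prime_factors l" "S \<inter> T = {}"
  shows "coprime (exact_part l S) (exact_part l T)"
  unfolding exact_part_def
proof (intro prod_coprime_left prod_coprime_right)
  fix p q assume "p \<in> S" "q \<in> T"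
  then have "prime p" "prime q" "p \<noteq> q"
    using assms by (auto simp: in_prime_factors_iff)
  then show "coprime (p ^ multiplicity p l) (q ^ multiplicity q l)"
    by (intro coprime_power_left_iff[THEN iffD2] coprime_power_right_iff[THEN iffD2] disjI1 primes_coprime | simp add: primes_coprime)+
qed

lemma prime_dvd_exact_part_iff:
  assumes S: "S \<subseteq> prime_factors l" and p: "prime p"
  shows "p dvd exact_part l S \<longleftrightarrow> p \<in> S"
proof
  have fin: "finite S" using S finite_subset by blast
  assume "p dvd exact_part l S"
  then obtain q where q: "q \<in> S" "p dvd q ^ multiplicity q l"
    unfolding exact_part_def using p fin by (auto simp: prime_dvd_prod_iff)
  then have "p dvd q" using p prime_dvd_power by blast
  moreover have "prime q" using q S by (auto simp: in_prime_factors_iff)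
  ultimately show "p \<in> S" using p q(1) primes_dvd_imp_eq by blast
next
  have fin: "finite S" using S finite_subset by blast
  assume pS: "p \<in> S"
  then have "p \<in> prime_factors l" using S by blast
  then have "multiplicity p l > 0"
    by (simp add: prime_factors_multiplicity)
  then have "p dvd p ^ multiplicity p l" by (simp add: dvd_power)
  also have "\<dots> dvd exact_part l S"
    unfolding exact_part_def using fin pS by (rule dvd_prodI)
  finally show "p dvd exact_part l S" .
qed

lemma inj_on_exact_part: "inj_on (exact_part l) (Pow (prime_factors l))"
proof (rule inj_onI)
  fix S T assume ST: "S \<in> Pow (prime_factors l)" "T \<in> Pow (prime_factors l)" "exact_part l S = exact_part l T"
  then have "p \<in> S \<longleftrightarrow> p \<in> T" if "p \<in> prime_factors l" for p
    using prime_dvd_exact_part_iff[of S l p] prime_dvd_exact_part_iff[of T l p] that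
    by (auto simp: in_prime_factors_iff)
  then show "S = T" using ST by blast
qed

lemma exact_part_complement:
  assumes "0 < l" "S \<subseteq> prime_factors l"
  shows "exact_part l S * exact_part l (prime_factors l - S) = l"
proof -
  have "S \<union> (prime_factors l - S) = prime_factors l" using assms by blast
  then show ?thesis
    using exact_part_Un[of S "prime_factors l - S" l] exact_part_all[OF assms(1)] finite_subset[OF assms(2)]
    by simp
qed

text \<open>An exact divisor \<open>m\<close> contains the full power of every prime dividing it,
  since such a prime cannot divide \<open>l div m\<close>.\<close>

lemma carrier_W:
  assumes l: "0 < l"
  shows "carrier (W l) = exact_part l ` Pow (prime_factors l)"
proof (intro equalityI subsetI)
  fix m assume "m \<in> carrier (W l)"
  then have m: "m dvd l" "coprime m (l div m)" by (auto simp: W_def)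
  then have l_eq: "l = m * (l div m)" by simp
  have m0: "0 < m" "0 < l div m" using l l_eq by (metis gr0I mult_0 mult_0_right)+
  have sub: "prime_factors m \<subseteq> prime_factors l"
    using m l by (simp add: dvd_prime_factors)
  have "multiplicity p l = multiplicity p m" if "p \<in> prime_factors m" for p
  proof -
    have p: "prime p" "p dvd m" using that by (auto simp: in_prime_factors_iff)
    then have "\<not> p dvd l div m"
      using m(2) by (meson coprime_common_divisor not_prime_unit)
    then have "multiplicity p (l div m) = 0"
      by (rule not_dvd_imp_multiplicity_0)
    then show ?thesis
      using prime_elem_multiplicity_mult_distrib[of p m "l div m"] p(1) m0 l_eq by simp
  qed
  then have "exact_part l (prime_factors m) = exact_part m (prime_factors m)"
    unfolding exact_part_def by (intro prod.cong) auto
  also have "\<dots> = m" using m0 by (intro exact_part_all)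
  finally show "m \<in> exact_part l ` Pow (prime_factors l)"
    using sub by (intro image_eqI[of _ _ "prime_factors m"]) auto
next
  fix m assume "m \<in> exact_part l ` Pow (prime_factors l)"
  then obtain S where S: "S \<subseteq> prime_factors l" "m = exact_part l S" by auto
  have c: "m * exact_part l (prime_factors l - S) = l"
    using exact_part_complement[OF l S(1)] S(2) by simp
  then have "l div m = exact_part l (prime_factors l - S)"
    using nonzero_mult_div_cancel_left[of m "exact_part l (prime_factors l - S)"] exact_part_pos[OF S(1)]
    unfolding c S(2)[symmetric] by simp
  moreover have "coprime m (exact_part l (prime_factors l - S))"
    unfolding S(2) by (rule coprime_exact_part) (use S in auto)
  moreover have "m dvd l"
    using c dvd_triv_left by metis
  ultimately show "m \<in> carrier (W l)"
    by (auto simp: W_def)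
qed

lemma W_one [simp]: "\<one>\<^bsub>W l\<^esub> = 1"
  by (simp add: W_def)

lemma gcd_exact_part:
  assumes "S \<subseteq> prime_factors l" "T \<subseteq> prime_factors l"
  shows "gcd (exact_part l S) (exact_part l T) = exact_part l (S \<inter> T)"
proof -
  have fin: "finite S" "finite T" using assms finite_subset by blast+
  have S: "exact_part l S = exact_part l (S \<inter> T) * exact_part l (S - T)"
    and T: "exact_part l T = exact_part l (S \<inter> T) * exact_part l (T - S)"
    using exact_part_split fin by (metis Int_commute)+
  have "coprime (exact_part l (S - T)) (exact_part l (T - S))"
    by (rule coprime_exact_part) (use assms in auto)
  then show ?thesis
    unfolding S T by (simp add: gcd_mult_distrib_nat[symmetric])
qed

lemma mult_exact_part:
  assumes "S \<subseteq> prime_factors l" "T \<subseteq> prime_factors l"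
  shows "exact_part l S \<otimes>\<^bsub>W l\<^esub> exact_part l T = exact_part l (sym_diff S T)"
proof -
  have fin: "finite S" "finite T" using assms finite_subset by blast+
  let ?g = "exact_part l (S \<inter> T)" and ?a = "exact_part l (S - T)" and ?b = "exact_part l (T - S)"
  have S: "exact_part l S = ?g * ?a" and T: "exact_part l T = ?g * ?b"
    using exact_part_split fin by (metis Int_commute)+
  have "exact_part l (sym_diff S T) = ?a * ?b"
    using fin by (intro exact_part_Un) auto
  moreover have "exact_part l S * exact_part l T = ?g\<^sup>2 * (?a * ?b)"
    unfolding S T by (simp add: power2_eq_square algebra_simps)
  moreover have "0 < ?g" using assms by (intro exact_part_pos) auto
  ultimately show ?thesis
    by (simp add: W_def gcd_exact_part[OF assms])
qed

lemma comm_group_W: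
  assumes l: "0 < l"
  shows "comm_group (W l)"
proof (rule comm_groupI)
  note C = carrier_W[OF l]
  let ?P = "prime_factors l"
  have sd: "sym_diff S T \<subseteq> ?P" if "S \<subseteq> ?P" "T \<subseteq> ?P" for S T using that by blast
  show "\<one>\<^bsub>W l\<^esub> \<in> carrier (W l)"
    unfolding C by (intro image_eqI[of _ _ "{}"]) auto
  fix x assume "x \<in> carrier (W l)"
  then obtain S where S: "x = exact_part l S" "S \<subseteq> ?P" unfolding C by auto
  show "\<one>\<^bsub>W l\<^esub> \<otimes>\<^bsub>W l\<^esub> x = x"
    using mult_exact_part[of "{}" l S] S by simp
  show "\<exists>y\<in>carrier (W l). y \<otimes>\<^bsub>W l\<^esub> x = \<one>\<^bsub>W l\<^esub>"
    using mult_exact_part[of S l S] S unfolding C by (intro bexI[of _ x]) auto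
  fix y assume "y \<in> carrier (W l)"
  then obtain T where T: "y = exact_part l T" "T \<subseteq> ?P" unfolding C by auto
  show "x \<otimes>\<^bsub>W l\<^esub> y \<in> carrier (W l)"
    unfolding S T C mult_exact_part[OF S(2) T(2)] using sd[OF S(2) T(2)] by blast
  show "x \<otimes>\<^bsub>W l\<^esub> y = y \<otimes>\<^bsub>W l\<^esub> x"
    unfolding S T mult_exact_part[OF S(2) T(2)] mult_exact_part[OF T(2) S(2)] by (simp add: Un_commute)
  fix z assume "z \<in> carrier (W l)"
  then obtain U where U: "z = exact_part l U" "U \<subseteq> ?P" unfolding C by auto
  have "sym_diff (sym_diff S T) U = sym_diff S (sym_diff T U)" by blast
  then show "x \<otimes>\<^bsub>W l\<^esub> y \<otimes>\<^bsub>W l\<^esub> z = x \<otimes>\<^bsub>W l\<^esub> (y \<otimes>\<^bsub>W l\<^esub> z)"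
    unfolding S T U mult_exact_part[OF S(2) T(2)] mult_exact_part[OF T(2) U(2)]
      mult_exact_part[OF sd[OF S(2) T(2)] U(2)] mult_exact_part[OF S(2) sd[OF T(2) U(2)]] by simp
qed

lemma W_square:
  assumes "0 < l" "m \<in> carrier (W l)"
  shows "m \<otimes>\<^bsub>W l\<^esub> m = 1"
  using assms mult_exact_part[of _ l] carrier_W[OF assms(1)] by fastforce

lemma card_carrier_W:
  assumes "0 < l"
  shows "card (carrier (W l)) = 2 ^ card (prime_factors l)"
  unfolding carrier_W[OF assms] by (simp add: card_image[OF inj_on_exact_part] card_Pow)

text \<open>The four factors belong to the regions of the Venn diagram of two sets of primes:
  \<open>g\<close> to the intersection, \<open>a\<close> and \<open>b\<close> to the differences,
  \<open>c\<close> to the rest. The coprimality statements are those required by the gluing of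
  lattices.\<close>

lemma W_decompose:
  assumes l: "0 < l" and m: "m \<in> carrier (W l)" and k: "k \<in> carrier (W l)"
  obtains g a b c where "m = g * a" "k = g * b" "l = g * a * b * c" "m \<otimes>\<^bsub>W l\<^esub> k = a * b"
    "coprime a g" "coprime b c" "coprime a (g * b)"
proof -
  let ?P = "prime_factors l"
  obtain S T where S: "m = exact_part l S" "S \<subseteq> ?P" and T: "k = exact_part l T" "T \<subseteq> ?P"
    using m k unfolding carrier_W[OF l] by auto
  have fin: "finite S" "finite T" using S T finite_subset by blast+
  let ?g = "exact_part l (S \<inter> T)" and ?a = "exact_part l (S - T)" and ?b = "exact_part l (T - S)"
  let ?c = "exact_part l (?P - (S \<union> T))"
  have 1: "m = ?g * ?a" "k = ?g * ?b"
    unfolding S T using exact_part_split fin by (metis Int_commute)+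
  have ab: "?a * ?b = exact_part l (sym_diff S T)"
    using fin by (intro exact_part_Un[symmetric]) auto
  have gb: "?g * ?b = exact_part l T"
    using 1 T by simp
  have "S \<union> T = S \<union> (T - S)" by blast
  then have "exact_part l (S \<union> T) = exact_part l S * ?b"
    using exact_part_Un[of S "T - S" l] fin by auto
  then have "exact_part l (S \<union> T) = ?g * ?a * ?b" using 1 S by simp
  then have 2: "l = ?g * ?a * ?b * ?c"
    using exact_part_complement[OF l, of "S \<union> T"] S T by simp
  have 3: "m \<otimes>\<^bsub>W l\<^esub> k = ?a * ?b"
    unfolding ab unfolding S T by (rule mult_exact_part[OF S(2) T(2)])
  have 4: "coprime ?a ?g" "coprime ?b ?c" "coprime ?a (?g * ?b)"
    unfolding gb by (rule coprime_exact_part; use S T in blast)+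
  show thesis
    by (rule that[OF 1 2 3 4])
qed

section \<open>Bases of finite elementary abelian 2-groups\<close>

lemma (in comm_group) F2_basis_exists:
  assumes fin: "finite (carrier G)" and sq: "\<And>x. x \<in> carrier G \<Longrightarrow> x \<otimes> x = \<one>"
  shows "\<exists>B. F2_basis G B"
proof -
  define f where "f B c = finprod G (\<lambda>b. b [^] (c b :: nat)) B" for B c
  \<comment> \<open>Independence, expressed as injectivity of the product map on 0-1 coefficients. A
    maximal independent set exists because the carrier is finite, and it turns out to
    generate.\<close>
  define free where "free B \<longleftrightarrow> B \<subseteq> carrier G \<and> inj_on (f B) (B \<rightarrow>\<^sub>E {0, 1})" for B
  have "free {}" by (simp add: free_def)
  moreover have "finite {B. free B}"
    using fin by (rule finite_subset[rotated, OF finite_Pow_iff[THEN iffD2]]) (auto simp: free_def)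
  ultimately obtain B where B: "free B" and max: "\<And>B'. free B' \<Longrightarrow> B \<subseteq> B' \<Longrightarrow> B' = B"
    using finite_has_maximal[of "{B. free B}"] by auto
  have BG: "B \<subseteq> carrier G" and inj: "inj_on (f B) (B \<rightarrow>\<^sub>E {0, 1})"
    using B by (auto simp: free_def)
  have finB: "finite B" using BG fin finite_subset by blast
  have closed: "f B c \<in> carrier G" for c
    unfolding f_def using BG by (intro finprod_closed) auto
  have pow: "b [^] (c + d) = b [^] ((c + d) mod 2)" if "b \<in> carrier G" for b and c d :: nat
  proof -
    have "b [^] (2 * k) = \<one>" for k :: nat
      using that sq by (induction k) (simp_all add: nat_pow_mult[symmetric] m_assoc)
    then have "b [^] n = b [^] (n mod 2)" for n :: nat
      using that by (metis l_one mult_div_mod_eq nat_pow_closed nat_pow_mult)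
    then show ?thesis .
  qed
  have mult: "f B c \<otimes> f B d = f B (\<lambda>b\<in>B. (c b + d b) mod 2)" for c d
  proof -
    have "f B c \<otimes> f B d = finprod G (\<lambda>b. b [^] c b \<otimes> b [^] d b) B"
      unfolding f_def using BG by (intro finprod_multf[symmetric]) auto
    also have "\<dots> = f B (\<lambda>b\<in>B. (c b + d b) mod 2)"
      unfolding f_def
    proof (rule finprod_cong')
      fix b assume b: "b \<in> B"
      then have "b \<in> carrier G" using BG by blast
      then show "b [^] c b \<otimes> b [^] d b = b [^] (\<lambda>b\<in>B. (c b + d b) mod 2) b"
        using pow[of b "c b" "d b"] b by (simp add: nat_pow_mult)
    qed (use BG in auto)
    finally show ?thesis .
  qed
  have surj: "x \<in> f B ` (B \<rightarrow>\<^sub>E {0, 1})" if x: "x \<in> carrier G" for x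
  proof (rule ccontr)
    assume nx: "x \<notin> f B ` (B \<rightarrow>\<^sub>E {0, 1})"
    have "x \<notin> B"
    proof
      assume xB: "x \<in> B"
      have "f B (\<lambda>b\<in>B. if b = x then 1 else 0) = finprod G (\<lambda>b. if b = x then b else \<one>) B"
        unfolding f_def using BG by (intro finprod_cong') auto
      also have "\<dots> = x"
        using finprod_singleton_swap[OF xB finB, of "\<lambda>b. b"] BG by (auto simp: Pi_def)
      finally show False
        using nx image_eqI[of x "f B" "\<lambda>b\<in>B. if b = x then 1 else 0" "B \<rightarrow>\<^sub>E {0, 1}"] by simp
    qed
    have ins: "f (insert x B) c = x [^] c x \<otimes> f B c" for c
      unfolding f_def using BG x \<open>x \<notin> B\<close> finB by (intro finprod_insert) auto
    have restr: "f B (restrict c B) = f B c" for c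
      unfolding f_def using BG by (intro finprod_cong') auto
    have rPi: "restrict c B \<in> B \<rightarrow>\<^sub>E {0, 1}" if "c \<in> insert x B \<rightarrow>\<^sub>E {0, 1::nat}" for c
      using that by (auto simp: PiE_iff)
    have modPi: "(\<lambda>b\<in>B. (c b + d b) mod 2) \<in> B \<rightarrow>\<^sub>E {0, 1::nat}" for c d :: "'a \<Rightarrow> nat"
      by (auto simp: PiE_iff)
    have "free (insert x B)"
      unfolding free_def
    proof (intro conjI inj_onI)
      show "insert x B \<subseteq> carrier G" using x BG by simp
      fix c d assume cd: "c \<in> insert x B \<rightarrow>\<^sub>E {0, 1::nat}" "d \<in> insert x B \<rightarrow>\<^sub>E {0, 1}"
        and eq: "f (insert x B) c = f (insert x B) d"
      have cx: "c x \<in> {0, 1}" "d x \<in> {0, 1}" using cd by auto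
      \<comment> \<open>Every element is its own inverse, so a relation that involves
        \<open>x\<close> can be solved for \<open>x\<close>, which puts \<open>x\<close> among the
        products over \<open>B\<close>.\<close>
      have key: "x = f B e \<otimes> f B e'" if "x \<otimes> f B e = f B e'" for e e'
        using that x closed[of e] closed[of e'] sq[OF closed[of e]] by (metis inv_equality inv_solve_right' m_comm)
      have neq: False if "c' x = 1" "d' x = 0" "f (insert x B) c' = f (insert x B) d'" for c' d'
      proof -
        have "x \<otimes> f B c' = f B d'" using that ins x closed by simp
        then have "x = f B (\<lambda>b\<in>B. (c' b + d' b) mod 2)" using key mult by metis
        then show False using nx modPi by blast
      qed
      have x_eq: "c x = d x" using cx neq[of c d] neq[of d c] eq by auto
      then have "f B c = f B d" using eq x closed by (simp add: ins)
      then have "restrict c B = restrict d B"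
        using inj_onD[OF inj _ rPi[OF cd(1)] rPi[OF cd(2)]] restr by metis
      then have "c b = d b" if "b \<in> B" for b using that by (metis restrict_apply')
      then show "c = d"
        using x_eq cd by (intro PiE_ext[of c "insert x B" "\<lambda>_. {0, 1}" d]) auto
    qed
    then show False using max[of "insert x B"] \<open>x \<notin> B\<close> by blast
  qed
  have "F2_basis G B"
    unfolding F2_basis_def
  proof (intro conjI ballI)
    fix x assume "x \<in> carrier G"
    from surj[OF this] obtain c where "c \<in> B \<rightarrow>\<^sub>E {0, 1}" "x = f B c" by blast
    then have "\<exists>!c. c \<in> B \<rightarrow>\<^sub>E {0, 1} \<and> x = f B c"
      using inj by (intro ex1I[of _ c]) (auto dest: inj_onD)
    then show "\<exists>!c. c \<in> B \<rightarrow>\<^sub>E {0, 1::nat} \<and> x = finprod G (\<lambda>b. b [^] c b) B"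
      by (simp only: f_def)
  qed (use finB BG in auto)
  then show ?thesis ..
qed

section \<open>Passage to a Sylow 2-subgroup and the determinant\<close>

lemma linear_group_of_subgroup:
  assumes "linear_group H" "subgroup P (fun_group H)"
  shows "linear_group P" "P \<subseteq> H"
proof -
  show sub: "P \<subseteq> H" using subgroup.subset[OF assms(2)] by simp
  show "linear_group P"
    by (rule linear_group_subset[OF assms(1) sub])
      (use subgroup.one_closed[OF assms(2)] subgroup.m_closed[OF assms(2)] in auto)
qed

text \<open>Serves to show that a Sylow 2-subgroup of a group with -1 contains -1: otherwise this
  union would be a 2-subgroup of twice the order.\<close>

lemma linear_group_Un_neg:
  assumes P: "linear_group P"
  shows "linear_group (P \<union> (\<lambda>f v. - f v) ` P)" (is "linear_group ?X")
proof -
  have inj: "inj (\<lambda>v. - f v)" and lin: "linear (\<lambda>v. - f v)" if "f \<in> P" for f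
    using linear_groupD(3,4)[OF P that] by (auto simp: inj_def linear_compose_neg)
  have "f \<circ> g \<in> ?X" if fg: "f \<in> ?X" "g \<in> ?X" for f g
  proof -
    obtain f' where f': "f' \<in> P" "f = f' \<or> f = (\<lambda>v. - f' v)" using fg by auto
    obtain g' where g': "g' \<in> P" "g = g' \<or> g = (\<lambda>v. - g' v)" using fg by auto
    have "f \<circ> g = f' \<circ> g' \<or> f \<circ> g = (\<lambda>v. - (f' \<circ> g') v)"
      using f'(2) g'(2) linear_neg[OF linear_groupD(3)[OF P f'(1)]] by (auto simp: fun_eq_iff)
    moreover have "(\<lambda>v. - (f' \<circ> g') v) \<in> (\<lambda>f v. - f v) ` P"
      using linear_groupD(5)[OF P f'(1) g'(1)] by (rule imageI)
    ultimately show ?thesis using linear_groupD(5)[OF P f'(1) g'(1)] by (metis UnCI)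
  qed
  then show ?thesis
    using linear_groupD(1-4)[OF P] inj lin unfolding linear_group_def by auto
qed

text \<open>\<open>P\<close> is a Sylow 2-subgroup of \<open>H\<close> and \<open>Y\<close> is its
  intersection with \<open>A\<close>. The order \<open>2 ^ t\<close> of \<open>Y\<close> divides
  that of \<open>A\<close>, so \<open>2 ^ (d + t)\<close> divides the order of \<open>H\<close> and
  \<open>d + t \<le> a\<close>: passing to \<open>P\<close> does not shrink the quotient. The rank
  bound then applies to \<open>P\<close> over \<open>Y\<close>.\<close>

lemma orthogonal_group_bound:
  fixes H :: "(real ^ 'n \<Rightarrow> real ^ 'n) set"
  assumes H: "linear_group H" and orth: "\<And>f. f \<in> H \<Longrightarrow> orthogonal_transformation f"
    and A: "linear_group A" "A \<subseteq> H" and sq: "\<And>f. f \<in> H \<Longrightarrow> f \<circ> f \<in> A"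
    and neg: "(\<lambda>v. - v) \<in> A" and card: "card H = 2 ^ d * card A"
  shows "d \<le> 2 * (CARD('n) div 2)"
proof -
  let ?ng = "\<lambda>v :: real ^ 'n. - v"
  have pos: "0 < card H" using linear_groupD(1,2)[OF H] by (auto simp: card_gt_0_iff)
  obtain m where m: "card H = 2 ^ multiplicity 2 (card H) * m" "\<not> 2 dvd m"
    using multiplicity_decompose'[of "card H" 2] pos by (auto simp: mult.commute)
  define a where "a = multiplicity 2 (card H)"
  obtain P where "subgroup P (fun_group H)" and cP: "card P = 2 ^ a"
    using sylow_thm[of 2 "fun_group H" a m] group_fun_group[OF H] m(1) linear_groupD(1)[OF H]
    by (auto simp: order_def a_def)
  then have P: "linear_group P" "P \<subseteq> H"
    using linear_group_of_subgroup[OF H] by auto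
  have not_dvd: "\<not> 2 ^ Suc a dvd card H"
    using m by (simp add: a_def[symmetric] power_Suc2 del: power_Suc)
  have ngP: "?ng \<in> P"
  proof (rule ccontr)
    assume no: "?ng \<notin> P"
    let ?X = "P \<union> (\<lambda>f v. - f v) ` P"
    have "P \<inter> (\<lambda>f v. - f v) ` P = {}"
    proof (rule ccontr)
      assume "P \<inter> (\<lambda>f v. - f v) ` P \<noteq> {}"
      then obtain f where f: "f \<in> P" "(\<lambda>v. - f v) \<in> P" by blast
      have "(\<lambda>v. - f v) \<circ> finv f \<in> P"
        using linear_groupD(5)[OF P(1) f(2) linear_group_inv(1)[OF P(1) f(1)]] .
      moreover have "(\<lambda>v. - f v) \<circ> finv f = ?ng"
        using linear_group_inv(5)[OF P(1) f(1)] by (simp add: fun_eq_iff)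
      ultimately show False using no by simp
    qed
    moreover have "inj_on (\<lambda>f v. - f v) P"
      by (auto simp: inj_on_def fun_eq_iff)
    ultimately have "card ?X = 2 ^ Suc a"
      using linear_groupD(1)[OF P(1)] cP by (simp add: card_Un_disjoint card_image)
    moreover have "?X \<subseteq> H"
    proof -
      have "(\<lambda>v. - f v) \<in> H" if "f \<in> P" for f
        using linear_groupD(5)[OF H, of ?ng f] neg A P that by (auto simp: comp_def)
      then show ?thesis using P by auto
    qed
    ultimately show False
      using card_linear_subgroup_dvd[OF H linear_group_Un_neg[OF P(1)]] not_dvd by simp
  qed
  define Y where "Y = P \<inter> A"
  have Y: "linear_group Y" "Y \<subseteq> P" "Y \<subseteq> A" and ngY: "?ng \<in> Y"
    using linear_group_Int[OF P(1) A(1)] ngP neg by (auto simp: Y_def)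
  have P2: "two_group P" using P cP by (auto simp: two_group_def)
  obtain t where t: "card Y = 2 ^ t"
    using two_group_subset[OF P2 Y(1,2)] by (auto simp: two_group_def)
  have "2 ^ t dvd card A"
    using card_linear_subgroup_dvd[OF A(1) Y(1,3)] t by simp
  then have "2 ^ d * 2 ^ t dvd card H"
    unfolding card by (rule mult_dvd_mono[OF dvd_refl])
  then have "\<not> Suc a \<le> d + t"
    using not_dvd by (metis dvd_trans le_imp_power_dvd power_add)
  then have dt: "d + t \<le> a" by simp
  have fix_UNIV: "fixer P UNIV \<subseteq> {id}"
    by (auto simp: fixer_def fun_eq_iff)
  have bound: "2 ^ a \<le> 2 ^ CARD('n) * card Z"
    if Z: "linear_group Z" "Z \<subseteq> P" "\<And>f. f \<in> P \<Longrightarrow> f \<circ> f \<in> Z" for Z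
  proof -
    have "card P \<le> 2 ^ dim (UNIV :: (real ^ 'n) set) * card Z"
      by (rule two_group_bound[OF P2 _ _ Z])
        (use fix_UNIV linear_groupD(2)[OF Z(1)] in \<open>auto simp: preserves_def\<close>)
    then show ?thesis by (simp add: cP)
  qed
  show ?thesis
  proof (cases "even CARD('n)")
    case True
    have "2 ^ a \<le> 2 ^ CARD('n) * card Y"
      by (rule bound[OF Y(1,2)]) (use sq P linear_groupD(5)[OF P(1)] in \<open>auto simp: Y_def\<close>)
    then have "(2::nat) ^ a \<le> 2 ^ (CARD('n) + t)"
      by (simp add: t power_add)
    then have "a \<le> CARD('n) + t" by simp
    then show ?thesis using dt True by simp
  next
    case False
    let ?det = "\<lambda>f :: real ^ 'n \<Rightarrow> real ^ 'n. det (matrix f)"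
    have det_comp: "?det (f \<circ> g) = ?det f * ?det g" if "f \<in> P" "g \<in> P" for f g
      using linear_groupD(3)[OF P(1)] that by (simp add: matrix_compose det_mul)
    have det1: "?det f = 1 \<or> ?det f = - 1" if "f \<in> P" for f
      using orth[of f] P that orthogonal_transformation_matrix[of f] det_orthogonal_matrix by blast
    have "?ng = (*\<^sub>R) (- 1)" by (auto simp: fun_eq_iff)
    then have detng: "?det ?ng = - 1"
      using False by (simp only: det_matrix_scaleR) simp
    \<comment> \<open>In odd dimension -1 has determinant -1 and lies in \<open>Y\<close>, so
      \<open>Z\<close> has index 2 in \<open>Y\<close>. Squares have determinant 1, so the rank
      bound holds for \<open>P\<close> over \<open>Z\<close> as well, and the additional factor 2
      lowers the exponent by one.\<close>
    define Z where "Z = {f \<in> Y. ?det f = 1}"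
    have Z: "linear_group Z" "Z \<subseteq> P"
    proof -
      show "Z \<subseteq> P" using Y by (auto simp: Z_def)
      show "linear_group Z"
        by (rule linear_group_subset[OF Y(1)])
          (use det_comp[OF subsetD[OF Y(2)] subsetD[OF Y(2)]] linear_groupD[OF Y(1)] in \<open>auto simp: Z_def matrix_id\<close>)
    qed
    have "Y - Z = (\<lambda>f v. - f v) ` Z"
    proof (intro equalityI subsetI)
      fix f assume f: "f \<in> Y - Z"
      then have "?det f = - 1" using det1[of f] Y by (auto simp: Z_def)
      then have "?det (?ng \<circ> f) = 1" using det_comp[of ?ng f] f Y ngP detng by auto
      then have "?ng \<circ> f \<in> Z" using linear_groupD(5)[OF Y(1) ngY, of f] f by (auto simp: Z_def)
      then show "f \<in> (\<lambda>f v. - f v) ` Z"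
        by (intro image_eqI[of _ _ "?ng \<circ> f"]) auto
    next
      fix f assume "f \<in> (\<lambda>f v. - f v) ` Z"
      then obtain g where g: "g \<in> Z" "f = ?ng \<circ> g" by (auto simp: comp_def)
      then have "f \<in> Y" using linear_groupD(5)[OF Y(1) ngY, of g] by (auto simp: Z_def)
      moreover have "?det f = - 1"
        using det_comp[of ?ng g] g Y ngP detng by (auto simp: Z_def)
      ultimately show "f \<in> Y - Z" by (auto simp: Z_def)
    qed
    moreover have "inj_on (\<lambda>f v. - f v) Z"
      by (auto simp: inj_on_def fun_eq_iff)
    ultimately have "card (Y - Z) = card Z" by (simp add: card_image)
    moreover have "card (Y - Z) = card Y - card Z" "card Z \<le> card Y"
      using linear_groupD(1)[OF Y(1)] by (auto simp: Z_def intro!: card_Diff_subset card_mono)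
    ultimately have cY: "card Y = 2 * card Z" by linarith
    have "2 ^ a \<le> 2 ^ CARD('n) * card Z"
    proof (rule bound[OF Z])
      fix f assume f: "f \<in> P"
      have "?det (f \<circ> f) = 1"
        using det_comp[OF f f] det1[OF f] by auto
      then show "f \<circ> f \<in> Z"
        using sq f P linear_groupD(5)[OF P(1)] by (auto simp: Z_def Y_def)
    qed
    then have "2 * 2 ^ a \<le> 2 ^ CARD('n) * card Y"
      unfolding cY by simp
    then have "(2::nat) ^ Suc a \<le> 2 ^ (CARD('n) + t)"
      by (simp add: t power_add)
    then have "Suc a \<le> CARD('n) + t"
      by (simp only: power_increasing_iff[of "2::nat"] one_less_numeral_iff semiring_norm)
    then show ?thesis using dt False by presburger
  qed
qed

section \<open>Lattices and their duals\<close>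

definition additive :: "'a::real_vector set \<Rightarrow> bool" where
  "additive L \<longleftrightarrow> 0 \<in> L \<and> (\<forall>x\<in>L. \<forall>y\<in>L. x - y \<in> L)"

lemma additiveD:
  assumes "additive L"
  shows "0 \<in> L" "\<And>x y. x \<in> L \<Longrightarrow> y \<in> L \<Longrightarrow> x - y \<in> L" "\<And>x. x \<in> L \<Longrightarrow> - x \<in> L"
    "\<And>x y. x \<in> L \<Longrightarrow> y \<in> L \<Longrightarrow> x + y \<in> L"
proof -
  show 0: "0 \<in> L" and diff: "\<And>x y. x \<in> L \<Longrightarrow> y \<in> L \<Longrightarrow> x - y \<in> L"
    using assms by (auto simp: additive_def)
  show neg: "\<And>x. x \<in> L \<Longrightarrow> - x \<in> L"
    using diff[OF 0] by simp
  show "\<And>x y. x \<in> L \<Longrightarrow> y \<in> L \<Longrightarrow> x + y \<in> L"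
    using diff neg by fastforce
qed

lemma additive_scale_nat:
  assumes L: "additive L" and x: "x \<in> L"
  shows "real n *\<^sub>R x \<in> L"
  by (induction n) (use additiveD[OF L] x in \<open>auto simp: scaleR_add_left\<close>)

lemma additive_scale_int:
  assumes L: "additive L" and x: "x \<in> L"
  shows "of_int z *\<^sub>R x \<in> L"
proof (cases z rule: int_cases2)
  case (nonneg n)
  then show ?thesis using additive_scale_nat[OF L x, of n] by simp
next
  case (nonpos n)
  then show ?thesis using additiveD(3)[OF L additive_scale_nat[OF L x, of n]] by simp
qed

lemma bezout_real:
  assumes "coprime a (b :: nat)"
  obtains u v :: int where "real_of_int u * real a + real_of_int v * real b = 1"
proof -
  have "coprime (int a) (int b)" using assms by simp
  then obtain u v where "u * int a + v * int b = 1"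
    using bezout_int[of "int a" "int b"] by auto
  then have "real_of_int (u * int a + v * int b) = 1" by simp
  then show thesis by (intro that[of u v]) simp
qed

text \<open>By Bezout. It takes the place of localization: arguments about exact divisors and about
  single primes are reduced to coprime multiples.\<close>

lemma additive_coprime:
  assumes L: "additive L" and ab: "coprime a b" and x: "real a *\<^sub>R x \<in> L" "real b *\<^sub>R x \<in> L"
  shows "x \<in> L"
proof -
  obtain u v :: int where uv: "real_of_int u * real a + real_of_int v * real b = 1"
    using bezout_real[OF ab] .
  have "x = (real_of_int u * real a + real_of_int v * real b) *\<^sub>R x"
    by (simp add: uv)
  also have "\<dots> = of_int u *\<^sub>R (real a *\<^sub>R x) + of_int v *\<^sub>R (real b *\<^sub>R x)"
    by (simp add: scaleR_add_left)
  also have "\<dots> \<in> L"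
    using additiveD(4)[OF L additive_scale_int[OF L x(1)] additive_scale_int[OF L x(2)]] .
  finally show ?thesis .
qed

lemma additive_dual: "additive (dual_lattice L)"
  by (auto simp: additive_def dual_lattice_def inner_diff_right)

lemma dual_latticeD: "y \<in> dual_lattice L \<Longrightarrow> x \<in> L \<Longrightarrow> x \<bullet> y \<in> \<int>"
  by (auto simp: dual_lattice_def)

lemma riesz_linear:
  fixes f :: "'a::euclidean_space \<Rightarrow> real"
  assumes "linear f"
  shows "\<exists>w. \<forall>x. f x = x \<bullet> w"
  using adjoint_works[OF assms, of _ 1] by (intro exI[of _ "adjoint f 1"]) (simp add: inner_commute)

text \<open>Modelled on a basis \<open>B\<close> with dual basis \<open>D\<close>: the numbers
  \<open>x \<bullet> D b\<close> are the coordinates, and membership in \<open>L\<close> becomes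
  finitely many integrality conditions.\<close>

definition dual_bases :: "'a::euclidean_space set \<Rightarrow> 'a set \<Rightarrow> ('a \<Rightarrow> 'a) \<Rightarrow> bool" where
  "dual_bases L B D \<longleftrightarrow> finite B \<and> B \<subseteq> L \<and> B \<noteq> {} \<and> span B = UNIV \<and>
     (\<forall>x. x = (\<Sum>b\<in>B. (x \<bullet> D b) *\<^sub>R b)) \<and> (\<forall>x. x \<in> L \<longleftrightarrow> (\<forall>b\<in>B. x \<bullet> D b \<in> \<int>))"

lemma dual_basesD:
  assumes "dual_bases L B D"
  shows "finite B" "B \<subseteq> L" "B \<noteq> {}" "span B = UNIV" "x = (\<Sum>b\<in>B. (x \<bullet> D b) *\<^sub>R b)"
    "x \<in> L \<longleftrightarrow> (\<forall>b\<in>B. x \<bullet> D b \<in> \<int>)"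
  using assms unfolding dual_bases_def by blast+

text \<open>A coordinate with respect to \<open>B\<close> is a linear functional, and
  \<open>D b\<close> is the vector that represents it.\<close>

lemma ex_dual_bases:
  fixes L :: "'a::euclidean_space set"
  assumes "euclidean_lattice L"
  shows "\<exists>B D. dual_bases L B D"
proof -
  obtain B where B: "independent B" "span B = UNIV"
    and L: "L = {\<Sum>b\<in>B. of_int (c b) *\<^sub>R b | c :: 'a \<Rightarrow> int. True}"
    using assms by (auto simp: euclidean_lattice_def)
  have fin: "finite B" using B(1) by (rule independent_imp_finite)
  have "\<exists>w. \<forall>x. representation B x b = x \<bullet> w" for b
  proof (rule riesz_linear)
    show "linear (\<lambda>x. representation B x b)"
      by (rule linearI) (simp_all add: representation_add representation_scale B)
  qed
  then obtain D where D: "\<And>b x. representation B x b = x \<bullet> D b" by metis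
  have sum: "x = (\<Sum>b\<in>B. (x \<bullet> D b) *\<^sub>R b)" for x
    using sum_representation_eq[OF B(1), of x B] B(2) fin by (simp add: D)
  have coord: "(\<Sum>b\<in>B. c b *\<^sub>R b) \<bullet> D b' = c b'" if "b' \<in> B" for c b'
  proof -
    have "(\<Sum>b\<in>B. c b *\<^sub>R b) \<bullet> D b' = (\<Sum>b\<in>B. c b * (b \<bullet> D b'))"
      by (simp add: inner_sum_left)
    also have "\<dots> = (\<Sum>b\<in>B. c b * (if b = b' then 1 else 0))"
      by (intro sum.cong) (auto simp: D[symmetric] representation_basis[OF B(1)])
    also have "\<dots> = c b'" using fin that by (simp add: if_distrib cong: if_cong)
    finally show ?thesis .
  qed
  have mem: "x \<in> L \<longleftrightarrow> (\<forall>b\<in>B. x \<bullet> D b \<in> \<int>)" for x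
  proof
    assume "x \<in> L"
    then obtain c :: "'a \<Rightarrow> int" where "x = (\<Sum>b\<in>B. of_int (c b) *\<^sub>R b)" using L by auto
    then show "\<forall>b\<in>B. x \<bullet> D b \<in> \<int>" using coord by simp
  next
    assume int: "\<forall>b\<in>B. x \<bullet> D b \<in> \<int>"
    have "x = (\<Sum>b\<in>B. of_int \<lfloor>x \<bullet> D b\<rfloor> *\<^sub>R b)"
      by (subst sum[of x], intro sum.cong) (use int in \<open>auto simp: Ints_def\<close>)
    then show "x \<in> L" unfolding L by (intro CollectI exI[of _ "\<lambda>b. \<lfloor>x \<bullet> D b\<rfloor>"]) simp
  qed
  have "B \<subseteq> L"
  proof
    fix b assume "b \<in> B"
    then show "b \<in> L" unfolding mem by (simp add: D[symmetric] representation_basis[OF B(1)])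
  qed
  moreover have "B \<noteq> {}"
  proof
    assume "B = {}"
    then have "(UNIV :: 'a set) = {0}" using B(2) by simp
    then show False using nonzero_Basis nonempty_Basis by blast
  qed
  ultimately have "dual_bases L B D"
    unfolding dual_bases_def using fin B(2) sum mem by blast
  then show ?thesis by blast
qed

lemma additive_lattice:
  assumes "euclidean_lattice L"
  shows "additive L"
proof -
  obtain B D where "dual_bases L B D"
    using ex_dual_bases[OF assms] by blast
  note B = dual_basesD[OF this]
  show ?thesis using B(6) by (auto simp: additive_def inner_diff_left)
qed

text \<open>The vectors \<open>D b\<close> lie in the dual lattice, and integrality against them is
  integrality of the coordinates.\<close>

lemma dual_dual_lattice:
  assumes "euclidean_lattice L"
  shows "dual_lattice (dual_lattice L) = L"
proof -
  obtain B D where "dual_bases L B D"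
    using ex_dual_bases[OF assms] by blast
  note B = dual_basesD[OF this]
  have "D b \<in> dual_lattice L" if "b \<in> B" for b
    using that B(6) by (auto simp: dual_lattice_def)
  then show ?thesis
    using B(6) by (auto simp: dual_lattice_def inner_commute)
qed

text \<open>By the Cauchy-Schwarz inequality the integers \<open>x \<bullet> w\<close> lie in a
  finite box, and they determine \<open>x\<close>.\<close>

lemma finite_integral_coordinates:
  fixes D :: "'a::euclidean_space set"
  assumes fin: "finite D" and sep: "\<And>x y. (\<And>w. w \<in> D \<Longrightarrow> x \<bullet> w = y \<bullet> w) \<Longrightarrow> x = y"
  shows "finite {x. norm x \<le> R \<and> (\<forall>w\<in>D. x \<bullet> w \<in> \<int>)}" (is "finite ?S")
proof -
  define M where "M w = \<lceil>R * norm w\<rceil>" for w :: 'a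
  let ?f = "\<lambda>x. \<lambda>w\<in>D. \<lfloor>x \<bullet> w\<rfloor>"
  have "?f ` ?S \<subseteq> (\<Pi>\<^sub>E w\<in>D. {- M w..M w})"
  proof (intro image_subsetI PiE_I)
    fix x w assume x: "x \<in> ?S" and w: "w \<in> D"
    have "\<bar>x \<bullet> w\<bar> \<le> norm x * norm w" by (rule Cauchy_Schwarz_ineq2)
    also have "\<dots> \<le> R * norm w" using x by (intro mult_right_mono) auto
    also have "\<dots> \<le> of_int (M w)" by (simp add: M_def)
    finally have "\<bar>x \<bullet> w\<bar> \<le> of_int (M w)" .
    moreover obtain z where z: "x \<bullet> w = of_int z" using x w by (auto elim!: Ints_cases)
    ultimately have "\<bar>z\<bar> \<le> M w" by linarith
    then show "?f x w \<in> {- M w..M w}" using w z by auto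
  qed auto
  then have "finite (?f ` ?S)"
    by (rule finite_subset) (use fin in \<open>auto intro: finite_PiE\<close>)
  moreover have "inj_on ?f ?S"
  proof (rule inj_onI)
    fix x y assume xy: "x \<in> ?S" "y \<in> ?S" "?f x = ?f y"
    show "x = y"
    proof (rule sep)
      fix w assume w: "w \<in> D"
      then have "\<lfloor>x \<bullet> w\<rfloor> = \<lfloor>y \<bullet> w\<rfloor>" using xy(3) by (metis restrict_apply')
      moreover have "x \<bullet> w \<in> \<int>" "y \<bullet> w \<in> \<int>" using xy w by auto
      ultimately show "x \<bullet> w = y \<bullet> w" by (metis Ints_cases floor_of_int)
    qed
  qed
  ultimately show ?thesis by (rule finite_imageD)
qed

lemma finite_dual_lattice_ball:
  assumes "euclidean_lattice L"
  shows "finite {x \<in> dual_lattice L. norm x \<le> R}"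
proof -
  obtain B D where "dual_bases L B D"
    using ex_dual_bases[OF assms] by blast
  note B = dual_basesD[OF this]
  have "finite {x. norm x \<le> R \<and> (\<forall>w\<in>B. x \<bullet> w \<in> \<int>)}"
  proof (rule finite_integral_coordinates[OF B(1)])
    fix x y assume eq: "\<And>w. w \<in> B \<Longrightarrow> x \<bullet> w = y \<bullet> w"
    have "(x - y) \<bullet> z = 0" for z
    proof -
      have "(x - y) \<bullet> z = (x - y) \<bullet> (\<Sum>b\<in>B. (z \<bullet> D b) *\<^sub>R b)" using B(5)[of z] by simp
      also have "\<dots> = 0" using eq by (simp add: inner_sum_right inner_diff_left)
      finally show ?thesis .
    qed
    then have "(x - y) \<bullet> (x - y) = 0" .
    then show "x = y" by simp
  qed
  then show ?thesis
    by (rule rev_finite_subset) (use B(2) in \<open>auto simp: dual_lattice_def inner_commute\<close>)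
qed

text \<open>Removing the integral parts of the coordinates gives every class of the dual lattice
  modulo \<open>L\<close> a representative of norm at most \<open>R\<close>, and only finitely many
  such vectors exist. By the pigeonhole principle two multiples \<open>i\<close>,
  \<open>j \<le> card F\<close> of a dual vector share a representative; \<open>j - i\<close>
  divides the factorial of \<open>card F\<close>, which therefore works for all dual vectors at
  once.\<close>

lemma ex_level:
  assumes "integral_lattice L"
  shows "\<exists>l>0. (\<lambda>x. real l *\<^sub>R x) ` dual_lattice L \<subseteq> L"
proof -
  have lat: "euclidean_lattice L" and sub: "L \<subseteq> dual_lattice L"
    using assms by (auto simp: integral_lattice_def)
  note ad = additive_lattice[OF lat] and add = additive_dual[of L]
  obtain B D where "dual_bases L B D"
    using ex_dual_bases[OF lat] by blast
  note B = dual_basesD[OF this]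
  define R where "R = (\<Sum>b\<in>B. norm b)"
  define F where "F = {z \<in> dual_lattice L. norm z \<le> R}"
  have finF: "finite F" unfolding F_def by (rule finite_dual_lattice_ball[OF lat])
  have red: "\<exists>z\<in>F. y - z \<in> L" if y: "y \<in> dual_lattice L" for y
  proof -
    define l where "l = (\<Sum>b\<in>B. of_int \<lfloor>y \<bullet> D b\<rfloor> *\<^sub>R b)"
    have "(\<Sum>b\<in>A. of_int \<lfloor>y \<bullet> D b\<rfloor> *\<^sub>R b) \<in> L" if "A \<subseteq> B" for A
      using finite_subset[OF that B(1)] that
      by (induction A rule: finite_induct)
        (use additiveD[OF ad] additive_scale_int[OF ad] B(2) in auto)
    then have l: "l \<in> L" by (simp add: l_def)
    have "y - l = (\<Sum>b\<in>B. (y \<bullet> D b) *\<^sub>R b - of_int \<lfloor>y \<bullet> D b\<rfloor> *\<^sub>R b)"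
      by (subst B(5)[of y]) (simp add: l_def sum_subtractf)
    also have "\<dots> = (\<Sum>b\<in>B. frac (y \<bullet> D b) *\<^sub>R b)"
      by (simp add: frac_def scaleR_diff_left)
    finally have "norm (y - l) \<le> (\<Sum>b\<in>B. norm (frac (y \<bullet> D b) *\<^sub>R b))"
      by (simp only: norm_sum)
    also have "\<dots> \<le> R"
      unfolding R_def by (intro sum_mono) (simp add: mult_left_le_one_le frac_ge_0 less_imp_le[OF frac_lt_1])
    finally have "y - l \<in> F"
      using additiveD(2)[OF add y subsetD[OF sub l]] by (simp add: F_def)
    then show ?thesis using l by (intro bexI[of _ "y - l"]) simp_all
  qed
  have "real (fact (card F)) *\<^sub>R y \<in> L" if y: "y \<in> dual_lattice L" for y
  proof -
    have "\<forall>k::nat. \<exists>z\<in>F. real k *\<^sub>R y - z \<in> L"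
      using red additive_scale_nat[OF add y] by blast
    then obtain z where z: "\<And>k::nat. z k \<in> F" "\<And>k::nat. real k *\<^sub>R y - z k \<in> L" by metis
    have "\<not> inj_on z {..card F}"
    proof (rule pigeonhole)
      have "card (z ` {..card F}) \<le> card F"
        using finF z(1) by (intro card_mono) auto
      then show "card (z ` {..card F}) < card {..card F}" by simp
    qed
    then obtain i j where ij: "i < j" "j \<le> card F" "z i = z j"
      unfolding inj_on_def by (metis atMost_iff linorder_neqE_nat)
    have "(real j *\<^sub>R y - z j) - (real i *\<^sub>R y - z i) \<in> L"
      using z(2) additiveD(2)[OF ad] by blast
    then have d: "real (j - i) *\<^sub>R y \<in> L"
      using ij by (simp add: of_nat_diff scaleR_diff_left)
    have "j - i dvd fact (card F)"
      using ij by (intro dvd_fact) auto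
    then obtain q where "fact (card F) = (j - i) * q" by (auto elim: dvdE)
    then have "real (fact (card F)) = real q * real (j - i)"
      by (metis mult.commute of_nat_mult)
    then show ?thesis
      using additive_scale_nat[OF ad d, of q] by simp
  qed
  then show ?thesis
    by (intro exI[of _ "fact (card F)"]) (auto simp del: of_nat_fact)
qed

lemma level_props:
  assumes "integral_lattice L"
  shows "0 < level L" "\<And>y. y \<in> dual_lattice L \<Longrightarrow> real (level L) *\<^sub>R y \<in> L"
    "\<And>l. 0 < l \<Longrightarrow> (\<And>y. y \<in> dual_lattice L \<Longrightarrow> real l *\<^sub>R y \<in> L) \<Longrightarrow> level L \<le> l"
proof -
  let ?Q = "\<lambda>l. 0 < l \<and> (\<lambda>x. real l *\<^sub>R x) ` dual_lattice L \<subseteq> L"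
  have "?Q (level L)"
    unfolding level_def using ex_level[OF assms] by (rule LeastI_ex)
  then show "0 < level L" "\<And>y. y \<in> dual_lattice L \<Longrightarrow> real (level L) *\<^sub>R y \<in> L" by auto
  show "\<And>l. 0 < l \<Longrightarrow> (\<And>y. y \<in> dual_lattice L \<Longrightarrow> real l *\<^sub>R y \<in> L) \<Longrightarrow> level L \<le> l"
    unfolding level_def by (rule Least_le) auto
qed

section \<open>Modular similarities\<close>

text \<open>The defining equation of \<open>I_set\<close>, pulled back along the bijection
  \<open>sqrt m \<sigma>\<close> for positive \<open>m\<close>. As an equivalence for each vector it
  can be chained, which turns the composition of similarities into a rewriting of
  conditions.\<close>

definition modular_similarity :: "'a::euclidean_space set \<Rightarrow> nat \<Rightarrow> ('a \<Rightarrow> 'a) \<Rightarrow> bool" where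
  "modular_similarity L m \<sigma> \<longleftrightarrow> orthogonal_transformation \<sigma> \<and>
     (\<forall>x. sqrt (real m) *\<^sub>R \<sigma> x \<in> L \<longleftrightarrow> x \<in> dual_lattice L \<and> real m *\<^sub>R x \<in> L)"

lemma modular_similarity_iff:
  assumes m: "0 < m"
  shows "orthogonal_transformation \<sigma> \<and> L = \<sigma> ` partial_dual m L \<longleftrightarrow> modular_similarity L m \<sigma>"
proof (cases "orthogonal_transformation \<sigma>")
  case True
  let ?\<phi> = "\<lambda>x. sqrt (real m) *\<^sub>R \<sigma> x"
  let ?D = "{x \<in> dual_lattice L. real m *\<^sub>R x \<in> L}"
  have "dual_lattice L \<inter> (\<lambda>x. inverse (real m) *\<^sub>R x) ` L = ?D"
    using m by (auto intro!: image_eqI[of _ _ "real m *\<^sub>R _"])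
  then have "\<sigma> ` partial_dual m L = ?\<phi> ` ?D"
    unfolding partial_dual_def image_image
    using linear_scale[OF orthogonal_transformation_linear[OF True]] by simp
  moreover have inj: "?\<phi> x = ?\<phi> y \<longleftrightarrow> x = y" for x y
    using m orthogonal_transformation_inj[OF True] by (auto dest: injD)
  have surj: "\<exists>x. y = ?\<phi> x" for y
  proof -
    obtain x where "inverse (sqrt (real m)) *\<^sub>R y = \<sigma> x"
      using orthogonal_transformation_surj[OF True] by (metis surjD)
    then have "?\<phi> x = y" using m by (metis divideR_right inverse_eq_divide of_nat_0_less_iff real_sqrt_eq_zero_cancel_iff scaleR_left_imp_eq scaleR_scaleR not_less_iff_gr_or_eq right_inverse scaleR_one)
    then show ?thesis by metis
  qed
  have "L = ?\<phi> ` ?D \<longleftrightarrow> (\<forall>x. ?\<phi> x \<in> L \<longleftrightarrow> x \<in> ?D)"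
  proof
    assume eq: "L = ?\<phi> ` ?D"
    show "\<forall>x. ?\<phi> x \<in> L \<longleftrightarrow> x \<in> ?D"
    proof
      fix x
      have "?\<phi> x \<in> ?\<phi> ` ?D \<longleftrightarrow> x \<in> ?D" using inj by (auto simp: image_iff)
      then show "?\<phi> x \<in> L \<longleftrightarrow> x \<in> ?D" using eq by metis
    qed
  next
    assume mem: "\<forall>x. ?\<phi> x \<in> L \<longleftrightarrow> x \<in> ?D"
    show "L = ?\<phi> ` ?D"
    proof (intro equalityI subsetI)
      fix y assume y: "y \<in> L"
      obtain x where x: "y = ?\<phi> x" using surj by blast
      then have "x \<in> ?D" using y mem by metis
      then show "y \<in> ?\<phi> ` ?D" using x by blast
    next
      fix y assume "y \<in> ?\<phi> ` ?D"
      then show "y \<in> L" using mem by blast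
    qed
  qed
  ultimately show ?thesis using True by (simp add: modular_similarity_def)
qed (simp add: modular_similarity_def)

lemma modular_similarityD:
  assumes "modular_similarity L m \<sigma>"
  shows "orthogonal_transformation \<sigma>" "linear \<sigma>" "inj \<sigma>" "\<And>c x. \<sigma> (c *\<^sub>R x) = c *\<^sub>R \<sigma> x"
    "\<And>x y. \<sigma> (x + y) = \<sigma> x + \<sigma> y" "\<And>x y. \<sigma> x \<bullet> \<sigma> y = x \<bullet> y" "surj \<sigma>"
    "\<And>x. sqrt (real m) *\<^sub>R \<sigma> x \<in> L \<longleftrightarrow> x \<in> dual_lattice L \<and> real m *\<^sub>R x \<in> L"
proof -
  show o: "orthogonal_transformation \<sigma>" using assms by (simp add: modular_similarity_def)
  show l: "linear \<sigma>" using o by (rule orthogonal_transformation_linear)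
  show inj: "inj \<sigma>" using o by (rule orthogonal_transformation_inj)
  show "surj \<sigma>" using l inj by (intro linear_injective_imp_surjective) simp_all
  show "\<sigma> (c *\<^sub>R x) = c *\<^sub>R \<sigma> x" "\<sigma> (x + y) = \<sigma> x + \<sigma> y" for c x y
    using l by (auto simp: linear_scale linear_add)
  show "\<sigma> x \<bullet> \<sigma> y = x \<bullet> y" for x y using o by (simp add: orthogonal_transformation_def)
  show "sqrt (real m) *\<^sub>R \<sigma> x \<in> L \<longleftrightarrow> x \<in> dual_lattice L \<and> real m *\<^sub>R x \<in> L" for x
    using assms by (simp add: modular_similarity_def)
qed

text \<open>
  The compatibility of \<open>modular_similarity\<close> with the multiplication of \<open>W l\<close>: with \<open>m = g a\<close>,
  \<open>k = g b\<close>, \<open>l = g a b c\<close>, the left-hand side is the image under \<open>\<surd>k \<tau>\<close> of the condition for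
  \<open>m * k = a b\<close>, and the right-hand side is the condition for \<open>m\<close> at \<open>x / g\<close>.
\<close>

lemma lattice_gluing:
  fixes L M :: "'a::real_vector set"
  assumes L: "additive L" and M: "additive M" and LM: "L \<subseteq> M" and g: "0 < g"
    and ann: "\<And>y. y \<in> M \<Longrightarrow> real (g * a * b * c) *\<^sub>R y \<in> L"
    and cop: "coprime a g" "coprime b c" "coprime a (g * b)"
  shows "((\<exists>u\<in>L. \<exists>v\<in>M. x = u + real (g * b) *\<^sub>R v) \<and> real (a * b) *\<^sub>R x \<in> L \<and> (real a / real g) *\<^sub>R x \<in> M)
    \<longleftrightarrow> (inverse (real g) *\<^sub>R x \<in> M \<and> real a *\<^sub>R x \<in> L)" (is "?lhs \<longleftrightarrow> ?rhs")
proof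
  assume h: ?lhs
  then obtain u v where uv: "u \<in> L" "v \<in> M" "x = u + real (g * b) *\<^sub>R v" by blast
  have "real c *\<^sub>R (real a *\<^sub>R x) = real (a * c) *\<^sub>R u + real (g * a * b * c) *\<^sub>R v"
    unfolding uv(3) by (simp add: algebra_simps)
  also have "\<dots> \<in> L"
    using additiveD(4)[OF L additive_scale_nat[OF L uv(1)] ann[OF uv(2)]] .
  finally have "real c *\<^sub>R (real a *\<^sub>R x) \<in> L" .
  moreover have "real b *\<^sub>R (real a *\<^sub>R x) \<in> L"
    using h by (simp add: mult.commute)
  ultimately have "real a *\<^sub>R x \<in> L"
    using additive_coprime[OF L cop(2)] by blast
  moreover have "x \<in> M"
    unfolding uv(3) by (rule additiveD(4)[OF M subsetD[OF LM uv(1)] additive_scale_nat[OF M uv(2)]])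
  then have "real g *\<^sub>R (inverse (real g) *\<^sub>R x) \<in> M"
    using g by simp
  then have "inverse (real g) *\<^sub>R x \<in> M"
    using additive_coprime[OF M cop(1), of "inverse (real g) *\<^sub>R x"] h by (simp add: divide_inverse)
  ultimately show ?rhs by simp
next
  assume h: ?rhs
  have xM: "x \<in> M"
    using additive_scale_nat[OF M conjunct1[OF h], of g] g by simp
  obtain s t :: int where st: "real_of_int s * real a + real_of_int t * real (g * b) = 1"
    using bezout_real[OF cop(3)] .
  have "x = (real_of_int s * real a + real_of_int t * real (g * b)) *\<^sub>R x"
    by (simp only: st scaleR_one)
  also have "\<dots> = of_int s *\<^sub>R (real a *\<^sub>R x) + real (g * b) *\<^sub>R (of_int t *\<^sub>R x)"
    by (simp add: scaleR_add_left algebra_simps)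
  finally have "\<exists>u\<in>L. \<exists>v\<in>M. x = u + real (g * b) *\<^sub>R v"
    using additive_scale_int[OF L conjunct2[OF h], of s] additive_scale_int[OF M xM, of t] by blast
  moreover have "real (a * b) *\<^sub>R x \<in> L"
    using additive_scale_nat[OF L conjunct2[OF h], of b] by (simp add: mult.commute)
  moreover have "(real a / real g) *\<^sub>R x \<in> M"
    using additive_scale_nat[OF M conjunct1[OF h], of a] by (simp add: divide_inverse)
  ultimately show ?lhs by blast
qed

locale integral_euclidean_lattice =
  fixes L :: "'a::euclidean_space set"
  assumes integral: "integral_lattice L"
begin

abbreviation "M \<equiv> dual_lattice L"
abbreviation "l \<equiv> level L"

lemma lat: "euclidean_lattice L" and LM: "L \<subseteq> M"
  using integral by (auto simp: integral_lattice_def)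

lemmas addL = additive_lattice[OF lat] and addM = additive_dual[of L]
lemmas lev = level_props[OF integral]

lemma carrier_WD:
  assumes "m \<in> carrier (W l)"
  shows "0 < m" "m * (l div m) = l" "coprime m (l div m)" "0 < l div m"
proof -
  have m: "m dvd l" "coprime m (l div m)" using assms by (auto simp: W_def)
  then show "m * (l div m) = l" "coprime m (l div m)" by auto
  then show "0 < m" "0 < l div m" using lev(1) by (metis gr0I mult_0 mult_0_right)+
qed

text \<open>Let D be the set of \<open>x\<close> in \<open>M\<close> with \<open>m x\<close> in
  \<open>L\<close>, so that \<open>L\<close> is the image of D under \<open>sqrt m \<sigma>\<close>.
  Dualizing, \<open>M\<close> is the image of the dual of D under \<open>\<sigma> / sqrt m\<close>.
  That dual is L + mM, which by coprimality of \<open>m\<close> and \<open>l div m\<close> consists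
  of the \<open>x\<close> in \<open>M\<close> with \<open>(l div m) x\<close> in
  \<open>L\<close>.\<close>

lemma modular_similarity_dual:
  assumes \<sigma>: "modular_similarity L m \<sigma>" and m: "m \<in> carrier (W l)"
  shows "inverse (sqrt (real m)) *\<^sub>R \<sigma> x \<in> M \<longleftrightarrow> x \<in> M \<and> real (l div m) *\<^sub>R x \<in> L"
proof
  note D = modular_similarityD[OF \<sigma>] and m' = carrier_WD[OF m]
  have inner: "(sqrt (real m) *\<^sub>R \<sigma> d) \<bullet> (inverse (sqrt (real m)) *\<^sub>R \<sigma> x) = d \<bullet> x" for d
    using m'(1) by (simp add: D(6))
  { assume h: "inverse (sqrt (real m)) *\<^sub>R \<sigma> x \<in> M"
    have int: "d \<bullet> x \<in> \<int>" if "d \<in> M" "real m *\<^sub>R d \<in> L" for d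
      using dual_latticeD[OF h, of "sqrt (real m) *\<^sub>R \<sigma> d"] D(8)[of d] that inner[of d] by simp
    have "x \<in> M"
      using int LM additive_scale_nat[OF addL] by (auto simp: dual_lattice_def)
    \<comment> \<open>For \<open>e\<close> in \<open>M\<close> the multiple by
      \<open>l div m\<close> satisfies the condition on \<open>d\<close> in \<open>int\<close>,
      because \<open>m\<close> times it is \<open>l e\<close>. Integrality against all of
      \<open>M\<close> then means membership in \<open>L\<close> by biduality.\<close>
    moreover have "real (l div m) *\<^sub>R x \<in> dual_lattice M"
      unfolding dual_lattice_def[of M]
    proof (intro CollectI ballI)
      fix e assume e: "e \<in> M"
      have "real m *\<^sub>R (real (l div m) *\<^sub>R e) = real l *\<^sub>R e"
        by (metis m'(2) of_nat_mult scaleR_scaleR)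
      then have "(real (l div m) *\<^sub>R e) \<bullet> x \<in> \<int>"
        using lev(2)[OF e] additive_scale_nat[OF addM e] by (intro int) auto
      then show "e \<bullet> (real (l div m) *\<^sub>R x) \<in> \<int>" by simp
    qed
    then have "real (l div m) *\<^sub>R x \<in> L" using dual_dual_lattice[OF lat] by simp
    ultimately show "x \<in> M \<and> real (l div m) *\<^sub>R x \<in> L" .. }
  { assume h: "x \<in> M \<and> real (l div m) *\<^sub>R x \<in> L"
    show "inverse (sqrt (real m)) *\<^sub>R \<sigma> x \<in> M"
      unfolding dual_lattice_def[of L]
    proof (intro CollectI ballI)
      fix y assume y: "y \<in> L"
      obtain d where d: "inverse (sqrt (real m)) *\<^sub>R y = \<sigma> d"
        using D(7) by (metis surjD)
      have yd: "y = sqrt (real m) *\<^sub>R \<sigma> d"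
        using m'(1) by (simp add: d[symmetric])
      then have dM: "d \<in> M" "real m *\<^sub>R d \<in> L" using y D(8) by auto
      obtain u v :: int where uv: "real_of_int u * real m + real_of_int v * real (l div m) = 1"
        using bezout_real[OF m'(3)] .
      have "d \<bullet> x = (real_of_int u * real m + real_of_int v * real (l div m)) * (d \<bullet> x)"
        by (simp only: uv mult_1)
      also have "\<dots> = of_int u * ((real m *\<^sub>R d) \<bullet> x) + of_int v * ((real (l div m) *\<^sub>R x) \<bullet> d)"
        by (simp add: algebra_simps inner_commute)
      also have "\<dots> \<in> \<int>"
        using dual_latticeD[OF conjunct1[OF h] dM(2)] dual_latticeD[OF dM(1) conjunct2[OF h]]
        by (intro Ints_add Ints_mult Ints_of_int)
      finally show "y \<bullet> (inverse (sqrt (real m)) *\<^sub>R \<sigma> x) \<in> \<int>"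
        unfolding yd inner .
    qed }
qed

text \<open>\<open>L\<close> is the intersection of the parts of \<open>M\<close> that
  \<open>m\<close> and \<open>l div m\<close> carry into \<open>L\<close>, since these two numbers
  are coprime.\<close>

lemma mem_iff_similar:
  assumes \<sigma>: "modular_similarity L m \<sigma>" and m: "m \<in> carrier (W l)"
  shows "x \<in> L \<longleftrightarrow> sqrt (real m) *\<^sub>R \<sigma> x \<in> L \<and> inverse (sqrt (real m)) *\<^sub>R \<sigma> x \<in> M"
  unfolding modular_similarity_dual[OF assms] modular_similarityD(8)[OF \<sigma>]
  using LM additive_scale_nat[OF addL] additive_coprime[OF addL carrier_WD(3)[OF m]] by blast

text \<open>Dually, \<open>M\<close> is the sum of these two parts. The map
  \<open>sqrt m \<sigma>\<close> carries the first part onto \<open>L\<close> and the second one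
  onto mM.\<close>

lemma dual_mem_iff_similar:
  assumes \<sigma>: "modular_similarity L m \<sigma>" and m: "m \<in> carrier (W l)"
  shows "x \<in> M \<longleftrightarrow> (\<exists>u\<in>L. \<exists>v\<in>M. sqrt (real m) *\<^sub>R \<sigma> x = u + real m *\<^sub>R v)"
proof
  note D = modular_similarityD[OF \<sigma>] and m' = carrier_WD[OF m]
  have l_eq: "real l *\<^sub>R y = real m *\<^sub>R (real (l div m) *\<^sub>R y)" for y :: 'a
    by (metis m'(2) of_nat_mult scaleR_scaleR)
  { assume x: "x \<in> M"
    obtain u v :: int where uv: "real_of_int u * real m + real_of_int v * real (l div m) = 1"
      using bezout_real[OF m'(3)] .
    define x1 where "x1 = of_int v *\<^sub>R (real (l div m) *\<^sub>R x)"
    define x2 where "x2 = of_int u *\<^sub>R (real m *\<^sub>R x)"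
    have sum: "x = x1 + x2"
      unfolding x1_def x2_def by (metis add.commute scaleR_add_left scaleR_one scaleR_scaleR uv)
    have "real m *\<^sub>R x1 = of_int v *\<^sub>R (real l *\<^sub>R x)"
      unfolding x1_def l_eq by (simp add: mult.left_commute)
    then have "real m *\<^sub>R x1 \<in> L"
      using additive_scale_int[OF addL lev(2)[OF x]] by (simp only:)
    moreover have "x1 \<in> M"
      unfolding x1_def by (intro additive_scale_int additive_scale_nat addM x)
    ultimately have 1: "sqrt (real m) *\<^sub>R \<sigma> x1 \<in> L"
      unfolding D(8) by blast
    have "real (l div m) *\<^sub>R x2 = of_int u *\<^sub>R (real l *\<^sub>R x)"
      unfolding x2_def l_eq by (simp add: mult.left_commute)
    then have "real (l div m) *\<^sub>R x2 \<in> L"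
      using additive_scale_int[OF addL lev(2)[OF x]] by (simp only:)
    moreover have "x2 \<in> M"
      unfolding x2_def by (intro additive_scale_int additive_scale_nat addM x)
    ultimately have 2: "inverse (sqrt (real m)) *\<^sub>R \<sigma> x2 \<in> M"
      unfolding modular_similarity_dual[OF assms] by blast
    have "sqrt (real m) *\<^sub>R \<sigma> x = sqrt (real m) *\<^sub>R \<sigma> x1 + real m *\<^sub>R (inverse (sqrt (real m)) *\<^sub>R \<sigma> x2)"
      using m'(1) unfolding sum D(5) by (simp add: scaleR_add_right real_div_sqrt flip: divide_inverse)
    then show "\<exists>u\<in>L. \<exists>v\<in>M. sqrt (real m) *\<^sub>R \<sigma> x = u + real m *\<^sub>R v"
      using 1 2 by blast }
  { assume "\<exists>u\<in>L. \<exists>v\<in>M. sqrt (real m) *\<^sub>R \<sigma> x = u + real m *\<^sub>R v"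
    then obtain u v where uv: "u \<in> L" "v \<in> M" "sqrt (real m) *\<^sub>R \<sigma> x = u + real m *\<^sub>R v" by blast
    obtain d where "inverse (sqrt (real m)) *\<^sub>R u = \<sigma> d" using D(7) by (metis surjD)
    then have d: "u = sqrt (real m) *\<^sub>R \<sigma> d" using m'(1) by (metis (no_types, lifting) of_nat_0_less_iff order_less_irrefl real_sqrt_gt_zero right_inverse scaleR_one scaleR_scaleR)
    obtain e where "sqrt (real m) *\<^sub>R v = \<sigma> e" using D(7) by (metis surjD)
    then have e: "v = inverse (sqrt (real m)) *\<^sub>R \<sigma> e" using m'(1) by (metis (no_types, lifting) left_inverse of_nat_0_less_iff order_less_irrefl real_sqrt_gt_zero scaleR_one scaleR_scaleR)
    have "d \<in> M" using uv(1) D(8) d by blast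
    moreover have "e \<in> M" using uv(2) modular_similarity_dual[OF assms] e by blast
    moreover have "sqrt (real m) *\<^sub>R \<sigma> x = sqrt (real m) *\<^sub>R \<sigma> (d + e)"
      using m'(1) unfolding uv(3) d e D(5) by (simp add: scaleR_add_right real_div_sqrt flip: divide_inverse)
    then have "x = d + e" using m'(1) D(3) by (auto dest: injD)
    ultimately show "x \<in> M" using additiveD(4)[OF addM] by simp }
qed

lemma modular_similarity_comp:
  assumes \<sigma>: "modular_similarity L m \<sigma>" and m: "m \<in> carrier (W l)"
    and \<tau>: "modular_similarity L k \<tau>" and k: "k \<in> carrier (W l)"
  shows "modular_similarity L (m \<otimes>\<^bsub>W l\<^esub> k) (\<sigma> \<circ> \<tau>)"
proof -
  obtain g a b c where e: "m = g * a" "k = g * b" "l = g * a * b * c" "m \<otimes>\<^bsub>W l\<^esub> k = a * b"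
      and cop: "coprime a g" "coprime b c" "coprime a (g * b)"
    by (rule W_decompose[OF lev(1) m k])
  note S = modular_similarityD[OF \<sigma>] and T = modular_similarityD[OF \<tau>]
  have g: "0 < g" and b: "0 < b" using carrier_WD(1)[OF k] e by auto
  have "sqrt (real (a * b)) *\<^sub>R (\<sigma> \<circ> \<tau>) x \<in> L \<longleftrightarrow> x \<in> M \<and> real (a * b) *\<^sub>R x \<in> L" for x
  proof -
    \<comment> \<open>With this \<open>y\<close> the vector
      \<open>sqrt (a b) \<sigma> (\<tau> x)\<close> is \<open>sqrt m \<sigma> (y / g)\<close>,
      because sqrt(ga) sqrt(gb) = g sqrt(ab). So the condition for \<open>m\<close> is to be read at
      \<open>y / g\<close>.\<close>
    define y where "y = sqrt (real k) *\<^sub>R \<tau> x"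
    have "sqrt (real (g * a)) * (inverse (real g) * sqrt (real (g * b))) = sqrt (real (a * b))"
      using g by (simp add: real_sqrt_mult field_simps)
    then have "sqrt (real (a * b)) *\<^sub>R (\<sigma> \<circ> \<tau>) x = sqrt (real m) *\<^sub>R \<sigma> (inverse (real g) *\<^sub>R y)"
      unfolding y_def e(1,2) by (simp add: S(4))
    then have "sqrt (real (a * b)) *\<^sub>R (\<sigma> \<circ> \<tau>) x \<in> L \<longleftrightarrow>
        inverse (real g) *\<^sub>R y \<in> M \<and> real m *\<^sub>R (inverse (real g) *\<^sub>R y) \<in> L"
      by (simp only: S(8))
    also have "real m *\<^sub>R (inverse (real g) *\<^sub>R y) = real a *\<^sub>R y"
      using g by (simp add: e(1))
    also have "inverse (real g) *\<^sub>R y \<in> M \<and> real a *\<^sub>R y \<in> L \<longleftrightarrow>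
        ((\<exists>u\<in>L. \<exists>v\<in>M. y = u + real (g * b) *\<^sub>R v) \<and> real (a * b) *\<^sub>R y \<in> L \<and> (real a / real g) *\<^sub>R y \<in> M)"
      by (rule lattice_gluing[OF addL addM LM g _ cop, symmetric]) (use lev(2) e(3) in metis)
    \<comment> \<open>The three conditions on \<open>y\<close> go back to \<open>x\<close> through
      \<open>\<tau>\<close>: the first one is membership of \<open>x\<close> in \<open>M\<close>,
      and the other two together are membership of \<open>a b x\<close> in \<open>L\<close>.\<close>
    also have "(\<exists>u\<in>L. \<exists>v\<in>M. y = u + real (g * b) *\<^sub>R v) \<longleftrightarrow> x \<in> M"
      using dual_mem_iff_similar[OF \<tau> k, of x] unfolding y_def e(2) by simp
    also have "real (a * b) *\<^sub>R y = sqrt (real k) *\<^sub>R \<tau> (real (a * b) *\<^sub>R x)"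
      by (simp add: y_def T(4) mult.commute)
    also have "(real a / real g) *\<^sub>R y = inverse (sqrt (real k)) *\<^sub>R \<tau> (real (a * b) *\<^sub>R x)"
    proof -
      have "sqrt (real k) * sqrt (real k) = real g * real b" by (simp add: e(2))
      then have "real a / real g * sqrt (real k) = inverse (sqrt (real k)) * real (a * b)"
        using g b by (simp add: e(2) field_simps)
      then show ?thesis by (simp add: y_def T(4))
    qed
    also have "sqrt (real k) *\<^sub>R \<tau> (real (a * b) *\<^sub>R x) \<in> L \<and> inverse (sqrt (real k)) *\<^sub>R \<tau> (real (a * b) *\<^sub>R x) \<in> M
        \<longleftrightarrow> real (a * b) *\<^sub>R x \<in> L"
      using mem_iff_similar[OF \<tau> k] by blast
    finally show ?thesis .
  qed
  then show ?thesis
    unfolding modular_similarity_def e(4)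
    using orthogonal_transformation_compose[OF S(1) T(1)] by blast
qed

lemma one_in_W: "1 \<in> carrier (W l)"
  by (simp add: W_def)

lemma orthogonal_transformation_id_fun: "orthogonal_transformation id"
  using orthogonal_transformation_id by (simp add: id_def)

lemma modular_similarity_one_iff:
  "modular_similarity L 1 \<sigma> \<longleftrightarrow> orthogonal_transformation \<sigma> \<and> (\<forall>x. \<sigma> x \<in> L \<longleftrightarrow> x \<in> L)"
  using LM by (auto simp: modular_similarity_def)

lemma modular_similarity_one_inv:
  assumes "modular_similarity L 1 \<sigma>"
  shows "modular_similarity L 1 (finv \<sigma>)"
  using assms unfolding modular_similarity_one_iff
  by (metis orthogonal_transformation_inv orthogonal_transformation_surj surj_f_inv_f)

lemma ex_nonzero: "\<exists>x\<in>L. x \<noteq> 0"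
proof -
  obtain B D where "dual_bases L B D" using ex_dual_bases[OF lat] by blast
  note B = dual_basesD[OF this]
  have "\<exists>b\<in>B. b \<noteq> 0"
  proof (rule ccontr)
    assume "\<not> ?thesis"
    then have "span B \<subseteq> {0}" using span_mono[of B "{0}"] by auto
    then show False using B(4) nonzero_Basis nonempty_Basis by blast
  qed
  then show ?thesis using B(2) by blast
qed

text \<open>For nonzero \<open>x\<close> in \<open>L\<close> also \<open>sqrt k x\<close> is in
  \<open>L\<close>, and comparing inner products with \<open>x\<close> makes \<open>sqrt k\<close>
  rational, so \<open>k = p * p\<close>. Then pM is contained in L + kM, and \<open>c * p\<close>
  with \<open>c = l div k\<close> already annihilates \<open>M\<close> modulo \<open>L\<close>.
  Minimality of the level forces \<open>p = 1\<close>.\<close>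

lemma modular_similarity_id:
  assumes k: "k \<in> carrier (W l)" and id: "modular_similarity L k id"
  shows "k = 1"
proof -
  note k' = carrier_WD[OF k]
  obtain x where x: "x \<in> L" "x \<noteq> 0" using ex_nonzero by blast
  have "sqrt (real k) *\<^sub>R x \<in> L"
    using modular_similarityD(8)[OF id, of x] x LM additive_scale_nat[OF addL] by auto
  then have "x \<bullet> (sqrt (real k) *\<^sub>R x) \<in> \<int>" "x \<bullet> x \<in> \<int>"
    using dual_latticeD[OF subsetD[OF LM] x(1)] x(1) by blast+
  then have "x \<bullet> (sqrt (real k) *\<^sub>R x) / (x \<bullet> x) \<in> \<rat>"
    using Ints_subset_Rats by (intro Rats_divide) auto
  then have "sqrt (real k) \<in> \<rat>" using x(2) by simp
  then obtain p q :: nat where pq: "q \<noteq> 0" "\<bar>sqrt (real k)\<bar> = real p / real q" "coprime p q"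
    by (rule Rats_abs_nat_div_natE)
  then have "sqrt (real k) * real q = real p" by simp
  then have "real (k * q\<^sup>2) = real (p\<^sup>2)"
    by (metis of_nat_mult of_nat_power power_mult_distrib real_sqrt_pow2 of_nat_0_le_iff)
  then have kq: "k * q\<^sup>2 = p\<^sup>2" by (simp only: of_nat_eq_iff)
  have "coprime (p\<^sup>2) (q\<^sup>2)" using pq(3) by simp
  then have "q\<^sup>2 dvd 1"
    using kq by (metis coprime_absorb_right coprime_commute dvd_triv_right is_unit_gcd_iff gcd_nat.absorb2 dvd_refl coprime_imp_gcd_eq_1)
  then have "q = 1" by simp
  then have kp: "k = p * p" using kq by (simp add: power2_eq_square)
  define c where "c = l div k"
  have l: "l = p * p * c" using k'(2) by (simp add: c_def kp)
  have pos: "0 < p" "0 < c" using k'(1,4) kp by (auto simp: c_def)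
  have "real (c * p) *\<^sub>R y \<in> L" if y: "y \<in> M" for y
  proof -
    obtain u v where uv: "u \<in> L" "v \<in> M" "sqrt (real k) *\<^sub>R id y = u + real k *\<^sub>R v"
      using dual_mem_iff_similar[OF id k, of y] y by blast
    have "real p *\<^sub>R y = u + real (p * p) *\<^sub>R v"
      using uv(3) by (simp add: kp real_sqrt_mult)
    then have "real (c * p) *\<^sub>R y = real c *\<^sub>R (u + real (p * p) *\<^sub>R v)"
      by (metis of_nat_mult scaleR_scaleR)
    also have "\<dots> = real c *\<^sub>R u + real l *\<^sub>R v"
      by (simp add: l scaleR_add_right algebra_simps)
    finally show ?thesis
      using additiveD(4)[OF addL additive_scale_nat[OF addL uv(1)] lev(2)[OF uv(2)]] by simp
  qed
  then have "l \<le> c * p" using pos by (intro lev(3)) auto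
  then have "p = 1" using l pos by (metis One_nat_def Suc_leI le_antisym mult.assoc mult.commute mult_le_cancel1 mult.right_neutral mult_le_cancel2)
  then show ?thesis by (simp add: kp)
qed

text \<open>The square of \<open>\<sigma>\<close> is an automorphism, whose inverse is evidently one
  too; composing that inverse with \<open>\<sigma>\<close> gives the inverse of
  \<open>\<sigma>\<close>.\<close>

lemma modular_similarity_inv:
  assumes \<sigma>: "modular_similarity L m \<sigma>" and m: "m \<in> carrier (W l)"
  shows "modular_similarity L m (finv \<sigma>)"
proof -
  interpret comm_group "W l" by (rule comm_group_W[OF lev(1)])
  let ?\<rho> = "finv (\<sigma> \<circ> \<sigma>)"
  have sq: "modular_similarity L 1 (\<sigma> \<circ> \<sigma>)"
    using modular_similarity_comp[OF \<sigma> m \<sigma> m] W_square[OF lev(1) m] by simp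
  have "modular_similarity L (1 \<otimes>\<^bsub>W l\<^esub> m) (?\<rho> \<circ> \<sigma>)"
    by (rule modular_similarity_comp[OF modular_similarity_one_inv[OF sq] one_in_W \<sigma> m])
  moreover have "1 \<otimes>\<^bsub>W l\<^esub> m = m" using l_one[OF m] by simp
  moreover have "?\<rho> \<circ> \<sigma> = finv \<sigma>"
  proof
    fix x
    have inj: "inj (\<sigma> \<circ> \<sigma>)" using modular_similarityD(3)[OF \<sigma>] by (simp add: inj_compose)
    have "\<sigma> x = (\<sigma> \<circ> \<sigma>) (finv \<sigma> x)"
      using modular_similarityD(7)[OF \<sigma>] by (simp add: surj_f_inv_f)
    then show "(?\<rho> \<circ> \<sigma>) x = finv \<sigma> x"
      using inv_f_f[OF inj] by simp
  qed
  ultimately show ?thesis by simp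
qed

text \<open>The identity, as \<open>\<sigma>\<close> composed with its inverse, belongs to the
  product of \<open>m\<close> and \<open>k\<close>, which is therefore 1. This makes the index a
  well-defined map on similarities.\<close>

lemma modular_similarity_unique:
  assumes m: "m \<in> carrier (W l)" and k: "k \<in> carrier (W l)"
    and \<sigma>: "modular_similarity L m \<sigma>" and \<sigma>': "modular_similarity L k \<sigma>"
  shows "m = k"
proof -
  interpret comm_group "W l" by (rule comm_group_W[OF lev(1)])
  have "modular_similarity L (m \<otimes>\<^bsub>W l\<^esub> k) (\<sigma> \<circ> finv \<sigma>)"
    by (rule modular_similarity_comp[OF \<sigma> m modular_similarity_inv[OF \<sigma>' k] k])
  moreover have "\<sigma> \<circ> finv \<sigma> = id"
    using modular_similarityD(7)[OF \<sigma>] by (simp add: surj_iff)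
  ultimately have "m \<otimes>\<^bsub>W l\<^esub> k = 1"
    using modular_similarity_id[of "m \<otimes>\<^bsub>W l\<^esub> k"] m k by simp
  then show ?thesis
    using W_square[OF lev(1) k] m k by (metis right_cancel)
qed

text \<open>\<open>\<sigma>\<close> is determined by the vectors \<open>sqrt m \<sigma> b\<close>
  for \<open>b\<close> in a basis; they belong to \<open>L\<close> and have prescribed norm.\<close>

lemma finite_modular_similarities:
  assumes m: "0 < m"
  shows "finite {\<sigma>. modular_similarity L m \<sigma>}" (is "finite ?S")
proof -
  obtain B D where "dual_bases L B D" using ex_dual_bases[OF lat] by blast
  note B = dual_basesD[OF this]
  let ?f = "\<lambda>\<sigma>. \<lambda>b\<in>B. sqrt (real m) *\<^sub>R \<sigma> b"
  have "?f ` ?S \<subseteq> (\<Pi>\<^sub>E b\<in>B. {x \<in> M. norm x \<le> sqrt (real m) * norm b})"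
  proof (intro image_subsetI PiE_I)
    fix \<sigma> b assume \<sigma>: "\<sigma> \<in> ?S" and b: "b \<in> B"
    then have s: "modular_similarity L m \<sigma>" by simp
    have "b \<in> L" using b B(2) by blast
    then have "sqrt (real m) *\<^sub>R \<sigma> b \<in> L"
      using modular_similarityD(8)[OF s] LM additive_scale_nat[OF addL] by blast
    moreover have "norm (\<sigma> b) = norm b"
      using modular_similarityD(6)[OF s] by (simp add: norm_eq_sqrt_inner)
    ultimately show "?f \<sigma> b \<in> {x \<in> M. norm x \<le> sqrt (real m) * norm b}"
      using b LM by auto
  qed auto
  then have "finite (?f ` ?S)"
    by (rule finite_subset) (use B(1) finite_dual_lattice_ball[OF lat] in \<open>auto intro: finite_PiE\<close>)
  moreover have "inj_on ?f ?S"
  proof (rule inj_onI)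
    fix \<sigma> \<tau> assume st: "\<sigma> \<in> ?S" "\<tau> \<in> ?S" "?f \<sigma> = ?f \<tau>"
    have "\<sigma> b = \<tau> b" if "b \<in> B" for b
    proof -
      have "?f \<sigma> b = ?f \<tau> b" using st(3) by simp
      then show ?thesis using that m by simp
    qed
    then have "\<sigma> x = \<tau> x" for x
      using linear_eq_on_span[of \<sigma> \<tau> B x] modular_similarityD(2) st B(4) by auto
    then show "\<sigma> = \<tau>" by blast
  qed
  ultimately show ?thesis by (rule finite_imageD)
qed

section \<open>The finite group of similarities and its index map\<close>

definition "modular_indices = {m \<in> carrier (W l). \<exists>\<sigma>. modular_similarity L m \<sigma>}"
definition "similarities = {\<sigma>. \<exists>m\<in>carrier (W l). modular_similarity L m \<sigma>}"
definition "automorphisms = {\<sigma>. modular_similarity L 1 \<sigma>}"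

lemma I_set_eq: "I_set L = modular_indices"
proof (intro equalityI subsetI)
  fix m assume "m \<in> I_set L"
  then obtain \<sigma> where m: "m \<in> carrier (W l)" "orthogonal_transformation \<sigma>" "L = \<sigma> ` partial_dual m L"
    by (auto simp: I_set_def)
  then have "modular_similarity L m \<sigma>"
    using modular_similarity_iff[OF carrier_WD(1)[OF m(1)], of \<sigma> L] by (simp only: simp_thms)
  then show "m \<in> modular_indices" using m(1) by (auto simp: modular_indices_def)
next
  fix m assume "m \<in> modular_indices"
  then obtain \<sigma> where m: "m \<in> carrier (W l)" "modular_similarity L m \<sigma>"
    by (auto simp: modular_indices_def)
  then have "orthogonal_transformation \<sigma> \<and> L = \<sigma> ` partial_dual m L"
    using modular_similarity_iff[OF carrier_WD(1)[OF m(1)], of \<sigma> L] by (simp only: simp_thms)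
  then show "m \<in> I_set L" using m(1) unfolding I_set_def by blast
qed

lemma finite_carrier_W: "finite (carrier (W l))"
  using carrier_W[OF lev(1)] by simp

lemma linear_group_similarities: "linear_group similarities"
proof -
  interpret comm_group "W l" by (rule comm_group_W[OF lev(1)])
  have "similarities = (\<Union>m\<in>carrier (W l). {\<sigma>. modular_similarity L m \<sigma>})" by (auto simp: similarities_def)
  then have "finite similarities"
    using finite_carrier_W finite_modular_similarities carrier_WD(1) by simp
  moreover have "modular_similarity L 1 id"
    by (simp add: modular_similarity_one_iff orthogonal_transformation_id_fun del: One_nat_def)
  then have "id \<in> similarities" using one_in_W by (auto simp: similarities_def)
  moreover have "f \<circ> g \<in> similarities" if fg: "f \<in> similarities" "g \<in> similarities" for f g
  proof -
    obtain m k where mk: "m \<in> carrier (W l)" "modular_similarity L m f"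
        "k \<in> carrier (W l)" "modular_similarity L k g"
      using fg by (auto simp: similarities_def)
    then show ?thesis
      using modular_similarity_comp[OF mk(2,1,4,3)] m_closed[OF mk(1,3)] by (auto simp: similarities_def)
  qed
  ultimately show ?thesis
    using modular_similarityD(2,3) by (auto simp: linear_group_def similarities_def)
qed

lemma linear_group_automorphisms: "linear_group automorphisms" and automorphisms_subset_similarities: "automorphisms \<subseteq> similarities"
proof -
  show sub: "automorphisms \<subseteq> similarities" using one_in_W by (auto simp: automorphisms_def similarities_def)
  show "linear_group automorphisms"
    by (rule linear_group_subset[OF linear_group_similarities sub])
      (auto simp: automorphisms_def modular_similarity_one_iff orthogonal_transformation_id_fun simp del: One_nat_def
        intro: orthogonal_transformation_compose)
qed

text \<open>The fibres of the index map are cosets of the automorphism group: two similarities of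
  the same index \<open>m\<close> differ by one of index \<open>m\<close> times itself, which is 1
  in \<open>W l\<close>.\<close>

lemma card_similarities: "card similarities = card modular_indices * card automorphisms"
proof -
  interpret comm_group "W l" by (rule comm_group_W[OF lev(1)])
  define f where "f \<sigma> = (THE m. m \<in> carrier (W l) \<and> modular_similarity L m \<sigma>)" for \<sigma>
  have f: "f \<sigma> = m" if "m \<in> carrier (W l)" "modular_similarity L m \<sigma>" for m \<sigma>
    unfolding f_def using that modular_similarity_unique by blast
  have "f ` similarities = modular_indices"
  proof (intro equalityI subsetI)
    fix m assume "m \<in> modular_indices"
    then obtain \<sigma> where s: "m \<in> carrier (W l)" "modular_similarity L m \<sigma>" by (auto simp: modular_indices_def)
    then have "\<sigma> \<in> similarities" "m = f \<sigma>" using f by (auto simp: similarities_def)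
    then show "m \<in> f ` similarities" by blast
  qed (auto simp: similarities_def modular_indices_def f)
  moreover have "card similarities = card (f ` similarities) * card automorphisms"
  proof (rule card_fibres)
    show "finite similarities" using linear_group_similarities by (rule linear_groupD)
    fix \<sigma> assume "\<sigma> \<in> similarities"
    then obtain m where m: "m \<in> carrier (W l)" "modular_similarity L m \<sigma>" by (auto simp: similarities_def)
    have "{\<tau> \<in> similarities. f \<tau> = f \<sigma>} = (\<lambda>\<alpha>. \<sigma> \<circ> \<alpha>) ` automorphisms"
    proof (intro equalityI subsetI)
      fix \<tau> assume "\<tau> \<in> {\<tau> \<in> similarities. f \<tau> = f \<sigma>}"
      then have t: "modular_similarity L m \<tau>" using f m by (auto simp: similarities_def)
      have "modular_similarity L (m \<otimes>\<^bsub>W l\<^esub> m) (finv \<sigma> \<circ> \<tau>)"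
        by (rule modular_similarity_comp[OF modular_similarity_inv[OF m(2,1)] m(1) t m(1)])
      then have "finv \<sigma> \<circ> \<tau> \<in> automorphisms"
        using W_square[OF lev(1) m(1)] by (simp add: automorphisms_def)
      moreover have "\<tau> = \<sigma> \<circ> (finv \<sigma> \<circ> \<tau>)"
        using modular_similarityD(7)[OF m(2)] by (simp add: fun_eq_iff surj_f_inv_f)
      ultimately show "\<tau> \<in> (\<lambda>\<alpha>. \<sigma> \<circ> \<alpha>) ` automorphisms" by blast
    next
      fix \<tau> assume "\<tau> \<in> (\<lambda>\<alpha>. \<sigma> \<circ> \<alpha>) ` automorphisms"
      then obtain \<alpha> where \<alpha>: "modular_similarity L 1 \<alpha>" "\<tau> = \<sigma> \<circ> \<alpha>" by (auto simp: automorphisms_def)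
      then have "modular_similarity L m \<tau>"
        using modular_similarity_comp[OF m(2,1) \<alpha>(1) one_in_W] r_one[OF m(1)] by simp
      then show "\<tau> \<in> {\<tau> \<in> similarities. f \<tau> = f \<sigma>}" using f m by (auto simp: similarities_def)
    qed
    then show "card {\<tau> \<in> similarities. f \<tau> = f \<sigma>} = card automorphisms"
      by (simp add: card_image[OF inj_on_comp_left[OF modular_similarityD(3)[OF m(2)]]])
  qed
  ultimately show ?thesis by simp
qed

lemma comm_group_I_group: "comm_group (I_group L)"
proof -
  interpret comm_group "W l" by (rule comm_group_W[OF lev(1)])
  have sim: "carrier (I_group L) = modular_indices" "x \<otimes>\<^bsub>I_group L\<^esub> y = x \<otimes>\<^bsub>W l\<^esub> y" "\<one>\<^bsub>I_group L\<^esub> = \<one>\<^bsub>W l\<^esub>" for x y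
    by (simp_all add: I_group_def I_set_eq)
  have IW: "modular_indices \<subseteq> carrier (W l)" by (auto simp: modular_indices_def)
  show ?thesis
  proof (rule comm_groupI; unfold sim)
    show "\<one>\<^bsub>W l\<^esub> \<in> modular_indices"
      using one_in_W modular_similarity_one_iff[of id] orthogonal_transformation_id_fun by (auto simp: modular_indices_def simp del: One_nat_def)
    show "x \<otimes>\<^bsub>W l\<^esub> y \<in> modular_indices" if "x \<in> modular_indices" "y \<in> modular_indices" for x y
      using that modular_similarity_comp unfolding modular_indices_def by blast
    show "\<exists>y\<in>modular_indices. y \<otimes>\<^bsub>W l\<^esub> x = \<one>\<^bsub>W l\<^esub>" if "x \<in> modular_indices" for x
      using that W_square[OF lev(1), of x] IW by (intro bexI[of _ x]) auto
    show "x \<otimes>\<^bsub>W l\<^esub> y \<otimes>\<^bsub>W l\<^esub> z = x \<otimes>\<^bsub>W l\<^esub> (y \<otimes>\<^bsub>W l\<^esub> z)" if "x \<in> modular_indices" "y \<in> modular_indices" "z \<in> modular_indices" for x y z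
      using that IW m_assoc by blast
    show "x \<otimes>\<^bsub>W l\<^esub> y = y \<otimes>\<^bsub>W l\<^esub> x" if "x \<in> modular_indices" "y \<in> modular_indices" for x y
      using that IW m_comm by blast
    show "\<one>\<^bsub>W l\<^esub> \<otimes>\<^bsub>W l\<^esub> x = x" if "x \<in> modular_indices" for x
      using that IW l_one by blast
  qed
qed

lemma ex_F2_dim: "\<exists>B. F2_basis (I_group L) B \<and> F2_dim (I_group L) = card B \<and> card modular_indices = 2 ^ card B"
proof -
  interpret comm_group "I_group L" by (rule comm_group_I_group)
  have carr: "carrier (I_group L) = modular_indices" by (simp add: I_group_def I_set_eq)
  have "finite modular_indices" using finite_carrier_W by (auto simp: modular_indices_def)
  moreover have "x \<otimes>\<^bsub>I_group L\<^esub> x = \<one>\<^bsub>I_group L\<^esub>" if "x \<in> modular_indices" for x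
    using that W_square[OF lev(1), of x] by (simp add: I_group_def modular_indices_def)
  ultimately obtain B where "F2_basis (I_group L) B"
    using F2_basis_exists carr by auto
  then show ?thesis using F2_dim_eq_card card_carrier_F2_basis carr by metis
qed

end

theorem F2_dim_I_group_bound:
  fixes L :: "(real ^ 'n) set"
  assumes "integral_lattice L"
  shows "F2_dim (I_group L) \<le> 2 * (CARD('n) div 2)"
    and "strongly_modular L \<Longrightarrow> card {p. prime p \<and> p dvd level L} \<le> 2 * (CARD('n) div 2)"
proof -
  interpret integral_euclidean_lattice L by unfold_locales (rule assms)
  obtain B :: "nat set" where B: "F2_dim (I_group L) = card B" "card modular_indices = 2 ^ card B"
    using ex_F2_dim by blast
  have le: "card B \<le> 2 * (CARD('n) div 2)"
  proof (rule orthogonal_group_bound[OF linear_group_similarities _ linear_group_automorphisms automorphisms_subset_similarities])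
    show "orthogonal_transformation f" if "f \<in> similarities" for f
      using that modular_similarityD(1) by (auto simp: similarities_def)
    show "f \<circ> f \<in> automorphisms" if "f \<in> similarities" for f
    proof -
      obtain m where m: "m \<in> carrier (W l)" "modular_similarity L m f"
        using \<open>f \<in> similarities\<close> by (auto simp: similarities_def)
      then show ?thesis
        using modular_similarity_comp[OF m(2,1,2,1)] W_square[OF lev(1) m(1)] by (simp add: automorphisms_def)
    qed
    have "- x \<in> L \<Longrightarrow> x \<in> L" for x using additiveD(3)[OF addL, of "- x"] by simp
    then show "(\<lambda>v. - v) \<in> automorphisms"
      using additiveD(3)[OF addL]
      by (auto simp: automorphisms_def modular_similarity_one_iff orthogonal_transformation_neg simp del: One_nat_def)
    show "card similarities = 2 ^ card B * card automorphisms" using card_similarities B by simp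
  qed
  then show "F2_dim (I_group L) \<le> 2 * (CARD('n) div 2)" using B by simp
  assume "strongly_modular L"
  then have "modular_indices = carrier (W l)"
    unfolding strongly_modular_def using I_set_eq by simp
  then have "(2::nat) ^ card (prime_factors l) = 2 ^ card B"
    using B card_carrier_W[OF lev(1)] by simp
  then have "card (prime_factors l) = card B" by simp
  moreover have "prime_factors l = {p. prime p \<and> p dvd l}"
    using lev(1) by (auto simp: in_prime_factors_iff)
  ultimately show "card {p. prime p \<and> p dvd level L} \<le> 2 * (CARD('n) div 2)"
    using le by simp
qed

section \<open>Strongly modular lattices of maximal length\<close>

lemma euclidean_lattice_linear_image:
  fixes T :: "'a::euclidean_space \<Rightarrow> 'a"
  assumes T: "linear T" "inj T"
  shows "euclidean_lattice (T ` {z. \<forall>e\<in>Basis. z \<bullet> e \<in> \<int>})"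
proof -
  let ?B = "T ` (Basis :: 'a set)"
  have inj: "inj_on T Basis" using T(2) by (rule inj_on_subset) simp
  have sum: "(\<Sum>b\<in>?B. of_int (c b) *\<^sub>R b) = T (\<Sum>e\<in>Basis. of_int (c (T e)) *\<^sub>R e)" for c :: "'a \<Rightarrow> int"
    by (simp add: sum.reindex[OF inj] linear_sum[OF T(1)] linear_scale[OF T(1)])
  have "T ` {z. \<forall>e\<in>Basis. z \<bullet> e \<in> \<int>} = {\<Sum>b\<in>?B. of_int (c b) *\<^sub>R b | c :: 'a \<Rightarrow> int. True}"
  proof (intro equalityI subsetI)
    fix x assume "x \<in> T ` {z. \<forall>e\<in>Basis. z \<bullet> e \<in> \<int>}"
    then obtain z where z: "x = T z" "\<forall>e\<in>Basis. z \<bullet> e \<in> \<int>" by blast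
    let ?c = "\<lambda>b. \<lfloor>z \<bullet> inv_into UNIV T b\<rfloor>"
    have "(\<Sum>e\<in>Basis. of_int (?c (T e)) *\<^sub>R e) = (\<Sum>e\<in>Basis. (z \<bullet> e) *\<^sub>R e)"
      using z(2) by (intro sum.cong) (auto simp: inv_f_f[OF T(2)] elim!: Ints_cases)
    then have "x = (\<Sum>b\<in>?B. of_int (?c b) *\<^sub>R b)"
      unfolding sum z(1) by (simp add: euclidean_representation)
    then show "x \<in> {\<Sum>b\<in>?B. of_int (c b) *\<^sub>R b | c :: 'a \<Rightarrow> int. True}"
      by (intro CollectI exI[of _ ?c]) simp
  next
    fix x assume "x \<in> {\<Sum>b\<in>?B. of_int (c b) *\<^sub>R b | c :: 'a \<Rightarrow> int. True}"
    then obtain c :: "'a \<Rightarrow> int" where "x = (\<Sum>b\<in>?B. of_int (c b) *\<^sub>R b)" by blast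
    then have "x = T (\<Sum>e\<in>Basis. of_int (c (T e)) *\<^sub>R e)" by (simp only: sum)
    moreover have "\<forall>e\<in>Basis. (\<Sum>e\<in>Basis. of_int (c (T e)) *\<^sub>R e) \<bullet> e \<in> \<int>" by simp
    ultimately show "x \<in> T ` {z. \<forall>e\<in>Basis. z \<bullet> e \<in> \<int>}" by blast
  qed
  moreover have "independent ?B"
    using linear_independent_injective_image[OF T(1) independent_Basis] T(2) by (simp add: inj_on_subset)
  moreover have "span ?B = UNIV"
    using linear_span_image[OF T(1), of Basis] linear_injective_imp_surjective[OF T] by simp
  ultimately show ?thesis unfolding euclidean_lattice_def by blast
qed

section \<open>Integrality conditions in a single plane\<close>

lemma Ints_coprime:
  assumes "coprime a b" "real a * x \<in> \<int>" "real b * x \<in> \<int>"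
  shows "x \<in> \<int>"
  using additive_coprime[of "\<int> :: real set" a b x] assms by (simp add: additive_def)

lemma Ints_of_nat_mult: "x \<in> \<int> \<Longrightarrow> real n * x \<in> \<int>"
  by simp

text \<open>For coefficients \<open>s\<close>, \<open>t\<close> of a vector, the left-hand side says
  that p times its image under the coordinate swap is in the plane lattice (up to a sign in the
  first coefficient). The right-hand side says that the vector is in the dual and its multiple by
  \<open>p\<^sup>2\<close> in the lattice. The factor \<open>K * q\<close> can be stripped off
  because it is coprime to p.\<close>

lemma plane_condition_p:
  fixes p q K :: nat and s t :: real
  assumes "coprime p (K * q)"
  shows "real p * s \<in> \<int> \<and> real q * s + real p * t \<in> \<int> \<longleftrightarrow>
    real (K * q) * (real q * s + real p * t) \<in> \<int> \<and> real (K * p) * (real q * s + 2 * real p * t) \<in> \<int> \<and>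
    real (p\<^sup>2) * s \<in> \<int> \<and> real (p\<^sup>2) * t \<in> \<int>"
    (is "?lhs \<longleftrightarrow> ?rhs")
proof
  let ?X = "real q * s + real p * t"
  assume h: ?lhs
  have "real (K * p) * (real q * s + 2 * real p * t) = real (2 * K * p) * ?X - real (K * q) * (real p * s)"
    by (simp add: algebra_simps)
  moreover have "real (p\<^sup>2) * s = real p * (real p * s)" "real (p\<^sup>2) * t = real p * ?X - real q * (real p * s)"
    by (simp_all add: algebra_simps power2_eq_square)
  ultimately show ?rhs
    using h by (metis Ints_diff Ints_of_nat_mult)
next
  let ?X = "real q * s + real p * t"
  assume h: ?rhs
  have cop: "coprime (K * q) (p\<^sup>2)" "coprime (K * q) p"
    using assms by (simp_all add: coprime_commute)
  have "real (p\<^sup>2) * ?X = real q * (real (p\<^sup>2) * s) + real p * (real (p\<^sup>2) * t)"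
    by (simp add: algebra_simps)
  then have X: "?X \<in> \<int>"
    using Ints_coprime[OF cop(1)] h by (metis Ints_add Ints_of_nat_mult)
  have "real (K * q) * (real p * s) = real (2 * K * p) * ?X - real (K * p) * (real q * s + 2 * real p * t)"
    by (simp add: algebra_simps)
  moreover have "real p * (real p * s) = real (p\<^sup>2) * s"
    by (simp add: power2_eq_square)
  ultimately have "real p * s \<in> \<int>"
    using Ints_coprime[OF cop(2), of "real p * s"] h X by (metis Ints_diff Ints_of_nat_mult)
  then show ?lhs using X by simp
qed

text \<open>The counterpart for the reflection \<open>(u, v) \<mapsto> (u, - v)\<close>: in the
  basis of the plane, q times it sends \<open>(s, t)\<close> to
  \<open>(q s + 2 p t, - q t)\<close>.\<close>

lemma plane_condition_q:
  fixes p q K :: nat and s t :: real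
  assumes "coprime q (K * p)"
  shows "real q * s + 2 * real p * t \<in> \<int> \<and> real q * t \<in> \<int> \<longleftrightarrow>
    real (K * q) * (real q * s + real p * t) \<in> \<int> \<and> real (K * p) * (real q * s + 2 * real p * t) \<in> \<int> \<and>
    real (q\<^sup>2) * s \<in> \<int> \<and> real (q\<^sup>2) * t \<in> \<int>"
    (is "?lhs \<longleftrightarrow> ?rhs")
proof
  let ?Y = "real q * s + 2 * real p * t"
  assume h: ?lhs
  have "real (K * q) * (real q * s + real p * t) = real (K * q) * ?Y - real (K * p) * (real q * t)"
    by (simp add: algebra_simps)
  moreover have "real (q\<^sup>2) * s = real q * ?Y - real (2 * p) * (real q * t)" "real (q\<^sup>2) * t = real q * (real q * t)"
    by (simp_all add: algebra_simps power2_eq_square)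
  ultimately show ?rhs
    using h by (metis Ints_diff Ints_of_nat_mult)
next
  let ?Y = "real q * s + 2 * real p * t"
  assume h: ?rhs
  have cop: "coprime (K * p) (q\<^sup>2)" "coprime (K * p) q"
    using assms by (simp_all add: coprime_commute)
  have "real (q\<^sup>2) * ?Y = real q * (real (q\<^sup>2) * s) + real (2 * p) * (real (q\<^sup>2) * t)"
    by (simp add: algebra_simps)
  then have Y: "?Y \<in> \<int>"
    using Ints_coprime[OF cop(1)] h by (metis Ints_add Ints_of_nat_mult)
  have "real (K * p) * (real q * t) = real (K * q) * ?Y - real (K * q) * (real q * s + real p * t)"
    by (simp add: algebra_simps)
  moreover have "real q * (real q * t) = real (q\<^sup>2) * t"
    by (simp add: power2_eq_square)
  ultimately have "real q * t \<in> \<int>"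
    using Ints_coprime[OF cop(2), of "real q * t"] h Y by (metis Ints_diff Ints_of_nat_mult)
  then show ?lhs using Y by simp
qed

text \<open>The prime r belongs to another plane, and the isometry is the identity here. The factor
  r of the scaling makes the dual condition one on the multiples of \<open>s\<close> and
  \<open>t\<close> by r, and the remaining Gram matrix has determinant prime to r.\<close>

lemma plane_condition_other:
  fixes p q r K' :: nat and s t :: real
  assumes cop: "coprime r K'" "coprime r p" "coprime r q"
  shows "real r * s \<in> \<int> \<and> real r * t \<in> \<int> \<longleftrightarrow>
    real (r * K' * q) * (real q * s + real p * t) \<in> \<int> \<and> real (r * K' * p) * (real q * s + 2 * real p * t) \<in> \<int> \<and>
    real (r\<^sup>2) * s \<in> \<int> \<and> real (r\<^sup>2) * t \<in> \<int>"
    (is "?lhs \<longleftrightarrow> ?rhs")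
proof
  assume h: ?lhs
  have "real (r * K' * q) * (real q * s + real p * t) = real (K' * q * q) * (real r * s) + real (K' * q * p) * (real r * t)"
    "real (r * K' * p) * (real q * s + 2 * real p * t) = real (K' * p * q) * (real r * s) + real (2 * K' * p * p) * (real r * t)"
    "real (r\<^sup>2) * s = real r * (real r * s)" "real (r\<^sup>2) * t = real r * (real r * t)"
    by (simp_all add: algebra_simps power2_eq_square)
  then show ?rhs
    using h by (metis Ints_add Ints_of_nat_mult)
next
  assume h: ?rhs
  let ?u = "real r * s" and ?v = "real r * t"
  have r: "real r * ?u \<in> \<int>" "real r * ?v \<in> \<int>" using h by (simp_all add: power2_eq_square mult.assoc)
  have c: "coprime (K' * q) r" "coprime (K' * p) r" using cop by (simp_all add: coprime_commute)
  have "real r * (real q * ?u + real p * ?v) = real q * (real r * ?u) + real p * (real r * ?v)"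
    "real (K' * q) * (real q * ?u + real p * ?v) = real (r * K' * q) * (real q * s + real p * t)"
    by (simp_all add: algebra_simps)
  then have 1: "real q * ?u + real p * ?v \<in> \<int>"
    using Ints_coprime[OF c(1)] h r by (metis Ints_add Ints_of_nat_mult)
  have "real r * (real q * ?u + 2 * real p * ?v) = real q * (real r * ?u) + real (2 * p) * (real r * ?v)"
    "real (K' * p) * (real q * ?u + 2 * real p * ?v) = real (r * K' * p) * (real q * s + 2 * real p * t)"
    by (simp_all add: algebra_simps)
  then have 2: "real q * ?u + 2 * real p * ?v \<in> \<int>"
    using Ints_coprime[OF c(2)] h r by (metis Ints_add Ints_of_nat_mult)
  have "(real q * ?u + 2 * real p * ?v) - (real q * ?u + real p * ?v) = real p * ?v"
    by simp
  then have pv: "real p * ?v \<in> \<int>" using Ints_diff[OF 2 1] by (simp only:)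
  then have v: "?v \<in> \<int>" using Ints_coprime[OF cop(2) r(2)] by simp
  have "real q * ?u \<in> \<int>" using Ints_diff[OF 1 pv] by (simp only: add_diff_cancel_right')
  then have "?u \<in> \<int>" using Ints_coprime[OF cop(3) r(1)] by simp
  then show ?lhs using v by simp
qed

text \<open>For the coordinates outside all planes, where the lattice is generated by a vector of
  length \<open>sqrt N\<close> and \<open>N = r * N'\<close>. The identity again serves as the
  similarity.\<close>

lemma line_condition:
  fixes r N' :: nat and w :: real
  assumes cop: "coprime r N'"
  shows "real r * w \<in> \<int> \<longleftrightarrow> real (r * N') * w \<in> \<int> \<and> real (r\<^sup>2) * w \<in> \<int>"
proof -
  have e: "real (r * N') * w = real N' * (real r * w)" "real (r\<^sup>2) * w = real r * (real r * w)"
    by (simp_all add: power2_eq_square)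
  show ?thesis
    unfolding e using Ints_coprime[OF cop, of "real r * w"] Ints_of_nat_mult by blast
qed

lemma prod_primes_dvd:
  fixes R :: "nat set"
  assumes "finite R" "\<And>r. r \<in> R \<Longrightarrow> prime r" "\<And>r. r \<in> R \<Longrightarrow> r dvd t"
  shows "\<Prod>R dvd t"
  using assms
proof (induction R rule: finite_induct)
  case (insert r R)
  have "coprime r (\<Prod>R)"
    using insert by (intro prod_coprime_right) (auto intro: primes_coprime)
  then show ?case using insert by (simp add: divides_mult)
qed simp

text \<open>
  Plane \<open>j\<close> is spanned by the coordinates \<open>a j\<close> and \<open>b j\<close>. On it the lattice has the basis
  \<open>\<alpha> (q, 0)\<close>, \<open>\<alpha> (p, p)\<close> with \<open>\<alpha>\<^sup>2 = N / (p q)\<close>; \<open>sc\<close> and \<open>tc\<close> are the coefficients in this basis,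
  and \<open>X\<close> and \<open>Y\<close> are the inner products with the two basis vectors.
\<close>

locale plane_system =
  fixes k :: nat and a b :: "nat \<Rightarrow> 'n::finite" and p q :: "nat \<Rightarrow> nat"
  assumes inj_a: "inj_on a {..<k}" and inj_b: "inj_on b {..<k}" and disj: "a ` {..<k} \<inter> b ` {..<k} = {}"
    and inj_p: "inj_on p {..<k}" and inj_q: "inj_on q {..<k}" and pq_disj: "p ` {..<k} \<inter> q ` {..<k} = {}"
    and prime_p: "\<And>j. j < k \<Longrightarrow> prime (p j)" and prime_q: "\<And>j. j < k \<Longrightarrow> prime (q j)"
    and q_gt2: "\<And>j. j < k \<Longrightarrow> 2 < q j"
begin

definition "R = p ` {..<k} \<union> q ` {..<k}"
definition "N = \<Prod>R"
definition "K j = \<Prod>(R - {p j, q j})"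
definition "C = UNIV - (a ` {..<k} \<union> b ` {..<k})"
definition "\<alpha> j = sqrt (real (K j))"

definition sc :: "nat \<Rightarrow> real ^ 'n \<Rightarrow> real" where "sc j x = (x $ a j - x $ b j) / (\<alpha> j * real (q j))"
definition tc :: "nat \<Rightarrow> real ^ 'n \<Rightarrow> real" where "tc j x = x $ b j / (\<alpha> j * real (p j))"
definition wc :: "'n \<Rightarrow> real ^ 'n \<Rightarrow> real" where "wc c x = x $ c / sqrt (real N)"

definition lattice :: "(real ^ 'n) set" where
  "lattice = {x. (\<forall>j<k. sc j x \<in> \<int> \<and> tc j x \<in> \<int>) \<and> (\<forall>c\<in>C. wc c x \<in> \<int>)}"

lemma lattice_mem: "x \<in> lattice \<longleftrightarrow> (\<forall>j<k. sc j x \<in> \<int> \<and> tc j x \<in> \<int>) \<and> (\<forall>c\<in>C. wc c x \<in> \<int>)"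
  by (simp add: lattice_def)

definition "X j x = real (K j * q j) * (real (q j) * sc j x + real (p j) * tc j x)"
definition "Y j x = real (K j * p j) * (real (q j) * sc j x + 2 * real (p j) * tc j x)"

lemma finite_R: "finite R" by (simp add: R_def)

lemma prime_R: "r \<in> R \<Longrightarrow> prime r"
  using prime_p prime_q by (auto simp: R_def)

lemma p_in_R: "j < k \<Longrightarrow> p j \<in> R" and q_in_R: "j < k \<Longrightarrow> q j \<in> R"
  by (auto simp: R_def)

lemma p_neq_q: "i < k \<Longrightarrow> j < k \<Longrightarrow> p i \<noteq> q j"
  using pq_disj by auto

lemma a_neq_b: "i < k \<Longrightarrow> j < k \<Longrightarrow> a i \<noteq> b j"
  using disj by auto

lemma coprime_R:
  assumes "r \<in> R" "S \<subseteq> R" "r \<notin> S"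
  shows "coprime r (\<Prod>S)"
proof (rule prod_coprime_right)
  fix i assume "i \<in> S"
  then show "coprime r i" using assms prime_R by (metis primes_coprime subsetD)
qed

lemma prod_R_pos:
  assumes "S \<subseteq> R"
  shows "0 < \<Prod>S"
proof (rule prod_pos)
  fix i assume "i \<in> S"
  then show "0 < i" using assms prime_R by (metis prime_gt_0_nat subsetD)
qed

lemma N_pos: "0 < N" and K_pos: "0 < K j"
  unfolding N_def K_def by (rule prod_R_pos; blast)+

lemma N_eq: "r \<in> R \<Longrightarrow> N = r * \<Prod>(R - {r})"
  unfolding N_def using finite_R by (rule prod.remove)

lemma N_eq_K: "j < k \<Longrightarrow> N = p j * q j * K j"
proof -
  assume j: "j < k"
  have "\<Prod>(R - {p j}) = q j * \<Prod>(R - {p j} - {q j})"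
    using finite_R q_in_R[OF j] p_neq_q[OF j j] by (intro prod.remove) auto
  moreover have "R - {p j} - {q j} = R - {p j, q j}" by blast
  ultimately show ?thesis using N_eq[OF p_in_R[OF j]] by (simp add: K_def)
qed

lemma alpha_pos: "0 < \<alpha> j" and alpha_sq: "\<alpha> j * \<alpha> j = real (K j)"
  using K_pos[of j] by (simp_all add: \<alpha>_def)

lemma pq_pos: "j < k \<Longrightarrow> 0 < p j" "j < k \<Longrightarrow> 0 < q j"
  using prime_p prime_q prime_gt_0_nat by blast+

lemma coords:
  assumes "j < k"
  shows "x $ b j = \<alpha> j * real (p j) * tc j x" "x $ a j = \<alpha> j * (real (q j) * sc j x + real (p j) * tc j x)"
  using alpha_pos[of j] pq_pos[OF assms] by (simp_all add: sc_def tc_def field_simps)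

lemma coord_C: "x $ c = sqrt (real N) * wc c x"
  using N_pos by (simp add: wc_def)

lemma scale_coords: "sc j (d *\<^sub>R x) = d * sc j x" "tc j (d *\<^sub>R x) = d * tc j x" "wc c (d *\<^sub>R x) = d * wc c x"
  by (simp_all add: sc_def tc_def wc_def right_diff_distrib)

text \<open>The matrix of the lattice basis: positions \<open>a j\<close> and \<open>b j\<close> of
  the argument hold the coefficients for the two basis vectors of plane \<open>j\<close>, so the
  lattice is the image of the integral vectors.\<close>

definition T :: "real ^ 'n \<Rightarrow> real ^ 'n" where
  "T z = (\<chi> i. if i \<in> a ` {..<k} then
       (let j = inv_into {..<k} a i in \<alpha> j * (real (q j) * z $ i + real (p j) * z $ b j))
     else if i \<in> b ` {..<k} then (let j = inv_into {..<k} b i in \<alpha> j * (real (p j) * z $ i))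
     else sqrt (real N) * z $ i)"

lemma T_nth:
  shows "j < k \<Longrightarrow> T z $ a j = \<alpha> j * (real (q j) * z $ a j + real (p j) * z $ b j)"
    and "j < k \<Longrightarrow> T z $ b j = \<alpha> j * (real (p j) * z $ b j)"
    and "c \<in> C \<Longrightarrow> T z $ c = sqrt (real N) * z $ c"
  using inj_a inj_b a_neq_b a_neq_b[symmetric] by (auto simp: T_def C_def inv_into_f_f Let_def)

lemma T_coords:
  shows "j < k \<Longrightarrow> sc j (T z) = z $ a j" "j < k \<Longrightarrow> tc j (T z) = z $ b j" "c \<in> C \<Longrightarrow> wc c (T z) = z $ c"
  using alpha_pos[of j] pq_pos[of j] N_pos by (simp_all add: sc_def tc_def wc_def T_nth field_simps)

lemma index_cases:
  obtains j where "j < k" "i = a j" | j where "j < k" "i = b j" | "i \<in> C"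
  unfolding C_def by blast

lemma linear_T: "linear T"
  by (rule linearI) (auto simp: T_def vec_eq_iff Let_def algebra_simps)

lemma inj_T: "inj T"
proof (rule injI)
  fix x y assume eq: "T x = T y"
  have "x $ i = y $ i" for i
    by (rule index_cases[of i]) (use T_coords[of _ x] T_coords[of _ y] eq in metis)+
  then show "x = y" by (simp add: vec_eq_iff)
qed

lemma T_mem: "T z \<in> lattice \<longleftrightarrow> (\<forall>i. z $ i \<in> \<int>)"
proof
  assume h: "T z \<in> lattice"
  show "\<forall>i. z $ i \<in> \<int>"
  proof
    fix i show "z $ i \<in> \<int>"
      by (rule index_cases[of i]) (use h T_coords[of _ z] in \<open>auto simp: lattice_def\<close>)
  qed
qed (auto simp: lattice_def T_coords)

lemma euclidean_lattice: "euclidean_lattice lattice"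
proof -
  have "lattice = T ` {z. \<forall>e\<in>Basis. z \<bullet> e \<in> \<int>}"
  proof (intro equalityI subsetI)
    fix x assume x: "x \<in> lattice"
    obtain z where z: "x = T z"
      using linear_injective_imp_surjective[OF linear_T inj_T] by (auto simp: surj_def)
    then have "\<forall>e\<in>Basis. z \<bullet> e \<in> \<int>"
      using x T_mem by (auto simp: Basis_vec_def inner_axis)
    then show "x \<in> T ` {z. \<forall>e\<in>Basis. z \<bullet> e \<in> \<int>}" using z by blast
  next
    fix x assume "x \<in> T ` {z. \<forall>e\<in>Basis. z \<bullet> e \<in> \<int>}"
    then obtain z where z: "x = T z" "\<forall>e\<in>Basis. z \<bullet> e \<in> \<int>" by blast
    have "z $ i \<in> \<int>" for i
      using z(2) axis_in_Basis_iff[of i "1 :: real"] by (auto simp: inner_axis dest!: bspec[of _ _ "axis i 1"])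
    then show "x \<in> lattice" using z(1) T_mem by simp
  qed
  then show ?thesis using euclidean_lattice_linear_image[OF linear_T inj_T] by simp
qed

lemma inner_eq:
  "z \<bullet> x = (\<Sum>j<k. sc j z * X j x + tc j z * Y j x) + (\<Sum>c\<in>C. wc c z * (real N * wc c x))"
proof -
  have "z \<bullet> x = (\<Sum>i\<in>(a ` {..<k} \<union> b ` {..<k}) \<union> C. z $ i * x $ i)"
    by (simp add: inner_vec_def C_def)
  also have "\<dots> = (\<Sum>i\<in>a ` {..<k} \<union> b ` {..<k}. z $ i * x $ i) + (\<Sum>i\<in>C. z $ i * x $ i)"
    by (rule sum.union_disjoint) (auto simp: C_def)
  also have "(\<Sum>i\<in>a ` {..<k} \<union> b ` {..<k}. z $ i * x $ i)
      = (\<Sum>i\<in>a ` {..<k}. z $ i * x $ i) + (\<Sum>i\<in>b ` {..<k}. z $ i * x $ i)"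
    using disj by (intro sum.union_disjoint) auto
  also have "\<dots> = (\<Sum>j<k. z $ a j * x $ a j + z $ b j * x $ b j)"
    by (simp add: sum.reindex[OF inj_a] sum.reindex[OF inj_b] sum.distrib)
  also have "\<dots> = (\<Sum>j<k. sc j z * X j x + tc j z * Y j x)"
  proof (rule sum.cong[OF refl])
    fix j assume "j \<in> {..<k}"
    then have j: "j < k" by simp
    have "z $ a j * x $ a j + z $ b j * x $ b j =
        (\<alpha> j * \<alpha> j) * ((real (q j) * sc j z + real (p j) * tc j z) * (real (q j) * sc j x + real (p j) * tc j x)
          + real (p j) * tc j z * (real (p j) * tc j x))"
      unfolding coords[OF j] by (simp add: algebra_simps)
    then show "z $ a j * x $ a j + z $ b j * x $ b j = sc j z * X j x + tc j z * Y j x"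
      unfolding alpha_sq by (simp add: X_def Y_def algebra_simps)
  qed
  also have "(\<Sum>i\<in>C. z $ i * x $ i) = (\<Sum>c\<in>C. wc c z * (real N * wc c x))"
  proof (rule sum.cong[OF refl])
    fix c show "z $ c * x $ c = wc c z * (real N * wc c x)"
      unfolding coord_C[of z] coord_C[of x] using real_sqrt_mult_self[of "real N"] N_pos
      by (simp add: algebra_simps flip: real_sqrt_mult)
  qed
  finally show ?thesis .
qed

lemma dual_mem: "x \<in> dual_lattice lattice \<longleftrightarrow>
    (\<forall>j<k. X j x \<in> \<int> \<and> Y j x \<in> \<int>) \<and> (\<forall>c\<in>C. real N * wc c x \<in> \<int>)"
proof
  assume h: "(\<forall>j<k. X j x \<in> \<int> \<and> Y j x \<in> \<int>) \<and> (\<forall>c\<in>C. real N * wc c x \<in> \<int>)"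
  show "x \<in> dual_lattice lattice"
    unfolding dual_lattice_def
  proof (intro CollectI ballI)
    fix z assume z: "z \<in> lattice"
    show "z \<bullet> x \<in> \<int>"
      unfolding inner_eq using z h
      by (intro Ints_add Ints_sum Ints_mult[of _ "X _ x"] Ints_mult[of _ "Y _ x"] Ints_mult[of _ "real N * wc _ x"])
        (auto simp: lattice_def)
  qed
next
  assume h: "x \<in> dual_lattice lattice"
  have int: "T (axis i 1) \<bullet> x \<in> \<int>" for i
    using dual_latticeD[OF h, of "T (axis i 1)"] T_mem[of "axis i 1"] by (auto simp: axis_def)
  \<comment> \<open>Pairing with a basis vector of the lattice leaves exactly one of the terms
    \<open>X\<close>, \<open>Y\<close> or \<open>N wc\<close>.\<close>
  have ax: "T (axis i 1) \<bullet> x = (\<Sum>j<k. (if a j = i then X j x else 0)) + (\<Sum>j<k. if b j = i then Y j x else 0)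
      + (\<Sum>c\<in>C. if c = i then real N * wc c x else 0)" for i
    unfolding inner_eq sum.distrib[symmetric]
    by (intro arg_cong2[of _ _ _ _ "(+)"] sum.cong refl) (auto simp: T_coords axis_def)
  show "(\<forall>j<k. X j x \<in> \<int> \<and> Y j x \<in> \<int>) \<and> (\<forall>c\<in>C. real N * wc c x \<in> \<int>)"
  proof (intro conjI allI impI ballI)
    fix j assume j: "j < k"
    have aj: "a i = a j \<longleftrightarrow> i = j" "b i = b j \<longleftrightarrow> i = j" "b i \<noteq> a j" "a i \<noteq> b j" if "i < k" for i
      using that j inj_a inj_b a_neq_b by (auto dest: inj_onD) metis
    have C: "c \<in> C \<Longrightarrow> c \<noteq> a j \<and> c \<noteq> b j" for c using j by (auto simp: C_def)
    have "T (axis (a j) 1) \<bullet> x = (\<Sum>i<k. if i = j then X i x else 0) + (\<Sum>i<k. 0) + (\<Sum>c\<in>C. 0)"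
      unfolding ax by (intro arg_cong2[of _ _ _ _ "(+)"] sum.cong refl) (use aj C in auto)
    then show "X j x \<in> \<int>" using int[of "a j"] j by simp
    have "T (axis (b j) 1) \<bullet> x = (\<Sum>i<k. 0) + (\<Sum>i<k. if i = j then Y i x else 0) + (\<Sum>c\<in>C. 0)"
      unfolding ax by (intro arg_cong2[of _ _ _ _ "(+)"] sum.cong refl) (use aj C in auto)
    then show "Y j x \<in> \<int>" using int[of "b j"] j by simp
  next
    fix c assume c: "c \<in> C"
    then have C: "a i \<noteq> c" "b i \<noteq> c" if "i < k" for i using that by (auto simp: C_def)
    have "T (axis c 1) \<bullet> x = (\<Sum>i<k. 0) + (\<Sum>i<k. 0) + (\<Sum>d\<in>C. if d = c then real N * wc d x else 0)"
      unfolding ax by (intro arg_cong2[of _ _ _ _ "(+)"] sum.cong refl) (use C in auto)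
    then show "real N * wc c x \<in> \<int>" using int[of c] c by simp
  qed
qed

lemma integral: "integral_lattice lattice"
  unfolding integral_lattice_def
proof (intro conjI euclidean_lattice subsetI)
  fix x assume "x \<in> lattice"
  then have "\<And>j. j < k \<Longrightarrow> sc j x \<in> \<int> \<and> tc j x \<in> \<int>" "\<And>c. c \<in> C \<Longrightarrow> wc c x \<in> \<int>"
    by (auto simp: lattice_def)
  then show "x \<in> dual_lattice lattice"
    unfolding dual_mem X_def Y_def by (auto intro!: Ints_mult Ints_add)
qed

text \<open>On a plane the Gram matrix is \<open>K j\<close> times the matrix with rows (q^2, pq)
  and (pq, 2p^2), of determinant \<open>N\<^sup>2\<close>. The coefficients of
  \<open>N\<^sup>2 x\<close> come from \<open>X\<close> and \<open>Y\<close> by the adjugate matrix,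
  which is integral.\<close>

lemma level_mult:
  assumes "x \<in> dual_lattice lattice"
  shows "real (N\<^sup>2) *\<^sub>R x \<in> lattice"
proof -
  note h = assms[unfolded dual_mem]
  have "sc j (real (N\<^sup>2) *\<^sub>R x) \<in> \<int> \<and> tc j (real (N\<^sup>2) *\<^sub>R x) \<in> \<int>" if j: "j < k" for j
  proof -
    have "sc j (real (N\<^sup>2) *\<^sub>R x) = real (2 * K j * (p j)\<^sup>2) * X j x - real N * Y j x"
      "tc j (real (N\<^sup>2) *\<^sub>R x) = real (K j * (q j)\<^sup>2) * Y j x - real N * X j x"
      unfolding scale_coords N_eq_K[OF j] X_def Y_def by (simp_all add: algebra_simps power2_eq_square)
    then show ?thesis using h j by (metis Ints_diff Ints_of_nat_mult)
  qed
  moreover have "wc c (real (N\<^sup>2) *\<^sub>R x) \<in> \<int>" if "c \<in> C" for c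
  proof -
    have "wc c (real (N\<^sup>2) *\<^sub>R x) = real N * (real N * wc c x)"
      unfolding scale_coords by (simp add: power2_eq_square)
    then show ?thesis using h that by (metis Ints_of_nat_mult)
  qed
  ultimately show ?thesis by (simp add: lattice_def)
qed

lemma real_div_Ints_dvd:
  assumes "real m / real n \<in> \<int>" "0 < n"
  shows "n dvd m"
proof -
  obtain z where "real m / real n = of_int z" using assms(1) by (auto elim: Ints_cases)
  then have "real m = of_int z * real n" using assms(2) by (simp add: field_simps)
  then have "real_of_int (int m) = real_of_int (z * int n)" by simp
  then have "int m = z * int n" by (simp only: of_int_eq_iff)
  then have "int n dvd int m" by simp
  then show ?thesis by (simp only: int_dvd_int_iff)
qed

text \<open>A single plane already forces \<open>N\<close> to divide \<open>d\<close>, and its own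
  two primes to divide the quotient. All planes together give the second factor \<open>N\<close>,
  which is squarefree.\<close>

lemma level_dvd:
  assumes "\<And>x. x \<in> dual_lattice lattice \<Longrightarrow> real d *\<^sub>R x \<in> lattice"
  shows "N\<^sup>2 dvd d"
proof -
  have key: "p j * N dvd d * q j \<and> q j * N dvd 2 * d * p j \<and> N dvd d" if j: "j < k" for j
  proof -
    define vec where "vec s t = T (s *\<^sub>R axis (a j) 1 + t *\<^sub>R axis (b j) 1)" for s t :: real
    have vec: "sc j (vec s t) = s" "tc j (vec s t) = t" for s t
      using T_coords(1,2)[OF j] a_neq_b[OF j j] by (simp_all add: vec_def axis_def)
    have vec': "sc i (vec s t) = 0" "tc i (vec s t) = 0" if "i < k" "i \<noteq> j" for i s t
      using T_coords(1,2)[OF that(1)] that j a_neq_b inj_a inj_b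
      by (auto simp: vec_def axis_def dest: inj_onD) metis+
    have vec'': "wc c (vec s t) = 0" if "c \<in> C" for c s t
      using T_coords(3)[OF that] that j by (auto simp: vec_def axis_def C_def)
    have XY: "vec s t \<in> dual_lattice lattice" if "X j (vec s t) \<in> \<int>" "Y j (vec s t) \<in> \<int>" for s t
      unfolding dual_mem
    proof (intro conjI allI impI ballI)
      fix i assume i: "i < k"
      show "X i (vec s t) \<in> \<int>" "Y i (vec s t) \<in> \<int>"
        using that vec'[OF i, of s t] by (cases "i = j"; simp add: X_def Y_def)+
    qed (simp add: vec'')
    have mem: "real d * s \<in> \<int> \<and> real d * t \<in> \<int>" if "X j (vec s t) \<in> \<int>" "Y j (vec s t) \<in> \<int>" for s t
      using assms[OF XY[OF that]] j vec by (auto simp: lattice_def scale_coords)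
    have N: "real N = real (p j) * real (q j) * real (K j)" using N_eq_K[OF j] by simp
    have pos: "real N > 0" "real (p j) > 0" "real (q j) > 0" "real (K j) > 0"
      using N_pos K_pos pq_pos[OF j] by simp_all
    \<comment> \<open>The two columns of the inverse Gram matrix: dual vectors with
      \<open>(X, Y)\<close> equal to (0, 1) here and to (1, 0) below.\<close>
    have "X j (vec (- 1 / real N) (real (q j) / (real (p j) * real N))) = 0"
      "Y j (vec (- 1 / real N) (real (q j) / (real (p j) * real N))) = 1"
      unfolding X_def Y_def vec using pos N by (simp_all add: field_simps)
    then have 1: "real d * (- 1 / real N) \<in> \<int>" "real d * (real (q j) / (real (p j) * real N)) \<in> \<int>"
      using mem by (metis Ints_0 Ints_1)+
    have "X j (vec (2 * real (p j) / (real (q j) * real N)) (- 1 / real N)) = 1"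
      "Y j (vec (2 * real (p j) / (real (q j) * real N)) (- 1 / real N)) = 0"
      unfolding X_def Y_def vec using pos N by (simp_all add: field_simps)
    then have 2: "real d * (2 * real (p j) / (real (q j) * real N)) \<in> \<int>"
      using mem by (metis Ints_0 Ints_1)
    have "real d / real N \<in> \<int>" using 1(1) by (simp add: minus_in_Ints_iff)
    moreover have "real (d * q j) / real (p j * N) \<in> \<int>" using 1(2) by simp
    moreover have "real (2 * d * p j) / real (q j * N) \<in> \<int>" using 2 by (simp add: mult.assoc mult.left_commute)
    ultimately show ?thesis
      using real_div_Ints_dvd pos by (metis N_pos mult_pos_pos pq_pos[OF j])
  qed
  have "N dvd d"
  proof (cases "k = 0")
    \<comment> \<open>Without planes \<open>R\<close> is empty and \<open>N\<close> is 1.\<close>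
    case True
    then show ?thesis unfolding N_def R_def by simp
  next
    case False
    then show ?thesis using key[of 0] by simp
  qed
  then obtain t where t: "d = N * t" by (auto elim: dvdE)
  have "r dvd t" if "r \<in> R" for r
  proof -
    obtain j where j: "j < k" "r = p j \<or> r = q j" using \<open>r \<in> R\<close> by (auto simp: R_def)
    have "N * p j dvd N * (t * q j)" "N * q j dvd N * (2 * t * p j)"
      using key[OF j(1)] by (simp_all add: t mult_ac)
    then have d: "p j dvd t * q j" "q j dvd 2 * t * p j" using N_pos by simp_all
    have c1: "coprime (p j) (q j)"
      using prime_p[OF j(1)] prime_q[OF j(1)] p_neq_q[OF j(1) j(1)] by (rule primes_coprime)
    \<comment> \<open>The 2 stems from the second basis vector, whose two coordinates are equal;
      this is where \<open>2 < q j\<close> enters.\<close>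
    have c2: "coprime (q j) 2"
      using prime_q[OF j(1)] q_gt2[OF j(1)] by (intro primes_coprime) auto
    have "p j dvd t" using d(1) c1 by (simp add: coprime_dvd_mult_left_iff)
    moreover have "q j dvd 2 * t"
      using d(2) c1 by (simp add: coprime_dvd_mult_left_iff coprime_commute)
    then have "q j dvd t" using c2 by (simp add: coprime_dvd_mult_right_iff)
    ultimately show ?thesis using j(2) by blast
  qed
  then have "N dvd t"
    unfolding N_def using finite_R prime_R by (intro prod_primes_dvd)
  then show ?thesis unfolding t by (simp add: power2_eq_square)
qed

lemma level_eq: "level lattice = N\<^sup>2"
  unfolding level_def
proof (rule Least_equality)
  show "0 < N\<^sup>2 \<and> (\<lambda>x. real (N\<^sup>2) *\<^sub>R x) ` dual_lattice lattice \<subseteq> lattice"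
    using N_pos level_mult by auto
  fix d assume d: "0 < d \<and> (\<lambda>x. real d *\<^sub>R x) ` dual_lattice lattice \<subseteq> lattice"
  then have "N\<^sup>2 dvd d" by (intro level_dvd) auto
  then show "N\<^sup>2 \<le> d" using d dvd_imp_le by blast
qed

text \<open>Leaves only the plane that owns the prime r to be checked. On the other planes and on
  the remaining coordinates \<open>\<sigma>\<close> is the identity, which suffices there because
  their scaling contains r exactly once.\<close>

lemma modular_similarityI:
  assumes orth: "orthogonal_transformation \<sigma>" and r: "r \<in> R"
    and j: "\<And>x. (sc j (real r *\<^sub>R \<sigma> x) \<in> \<int> \<and> tc j (real r *\<^sub>R \<sigma> x) \<in> \<int>) \<longleftrightarrow>
      X j x \<in> \<int> \<and> Y j x \<in> \<int> \<and> real (r\<^sup>2) * sc j x \<in> \<int> \<and> real (r\<^sup>2) * tc j x \<in> \<int>"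
    and rj: "r \<in> {p j, q j}" "j < k"
    and other: "\<And>x i. i \<noteq> a j \<Longrightarrow> i \<noteq> b j \<Longrightarrow> \<sigma> x $ i = x $ i"
  shows "modular_similarity lattice (r\<^sup>2) \<sigma>"
proof -
  have plane: "(sc i (real r *\<^sub>R \<sigma> x) \<in> \<int> \<and> tc i (real r *\<^sub>R \<sigma> x) \<in> \<int>) \<longleftrightarrow>
      X i x \<in> \<int> \<and> Y i x \<in> \<int> \<and> real (r\<^sup>2) * sc i x \<in> \<int> \<and> real (r\<^sup>2) * tc i x \<in> \<int>" if i: "i < k" for x i
  proof (cases "i = j")
    case False
    have "\<sigma> x $ a i = x $ a i" "\<sigma> x $ b i = x $ b i"
      using i rj(2) False a_neq_b inj_a inj_b by (metis inj_onD lessThan_iff other)+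
    then have s: "sc i (real r *\<^sub>R \<sigma> x) = real r * sc i x" "tc i (real r *\<^sub>R \<sigma> x) = real r * tc i x"
      unfolding scale_coords by (simp_all add: sc_def tc_def)
    have neq: "r \<noteq> p i" "r \<noteq> q i"
      using rj i False p_neq_q inj_p inj_q by (auto dest: inj_onD) metis+
    define K' where "K' = \<Prod>(R - {p i, q i, r})"
    have K: "K i = r * K'"
    proof -
      have "\<Prod>(R - {p i, q i}) = r * \<Prod>(R - {p i, q i} - {r})"
        using finite_R r neq by (intro prod.remove) auto
      moreover have "R - {p i, q i} - {r} = R - {p i, q i, r}" by blast
      ultimately show ?thesis by (simp add: K_def K'_def)
    qed
    have "coprime r K'" unfolding K'_def using r by (intro coprime_R) auto
    moreover have "coprime r (p i)" "coprime r (q i)"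
      using prime_R[OF r] prime_p[OF i] prime_q[OF i] neq by (auto intro: primes_coprime)
    ultimately show ?thesis
      unfolding s X_def Y_def K by (rule plane_condition_other)
  qed (use j in simp)
  have line: "wc c (real r *\<^sub>R \<sigma> x) \<in> \<int> \<longleftrightarrow> real N * wc c x \<in> \<int> \<and> real (r\<^sup>2) * wc c x \<in> \<int>" if c: "c \<in> C" for x c
  proof -
    have "c \<noteq> a j" "c \<noteq> b j" using c rj(2) by (auto simp: C_def)
    then have "wc c (real r *\<^sub>R \<sigma> x) = real r * wc c x"
      unfolding scale_coords using other by (simp add: wc_def)
    moreover have "coprime r (\<Prod>(R - {r}))" using r by (intro coprime_R) auto
    ultimately show ?thesis using line_condition N_eq[OF r] by metis
  qed
  have "sqrt (real (r\<^sup>2)) = real r" by simp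
  moreover have "real r *\<^sub>R \<sigma> x \<in> lattice \<longleftrightarrow> x \<in> dual_lattice lattice \<and> real (r\<^sup>2) *\<^sub>R x \<in> lattice" for x
    unfolding dual_mem lattice_mem scale_coords(1-3)[of _ "real (r\<^sup>2)"]
    using plane[of _ x] line[of _ x] by blast
  ultimately show ?thesis
    using orth unfolding modular_similarity_def by metis
qed

lemma coprime_pq:
  assumes "j < k"
  shows "coprime (p j) (K j * q j)" "coprime (q j) (K j * p j)"
proof -
  have "coprime (p j) (q j)"
    using prime_p prime_q p_neq_q assms by (intro primes_coprime)
  moreover have "coprime (p j) (K j)" "coprime (q j) (K j)"
    unfolding K_def using p_in_R q_in_R assms by (auto intro!: coprime_R)
  ultimately show "coprime (p j) (K j * q j)" "coprime (q j) (K j * p j)"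
    by (simp_all add: coprime_commute)
qed

lemma similarity_p:
  assumes j: "j < k"
  shows "\<exists>\<sigma>. modular_similarity lattice ((p j)\<^sup>2) \<sigma>"
proof -
  define \<pi> where "\<pi> i = (if i = a j then b j else if i = b j then a j else i)" for i
  define \<sigma> where "\<sigma> x = (\<chi> i. x $ \<pi> i)" for x :: "real ^ 'n"
  have \<pi>: "\<pi> (\<pi> i) = i" for i by (auto simp: \<pi>_def)
  have "modular_similarity lattice ((p j)\<^sup>2) \<sigma>"
  proof (rule modular_similarityI[OF _ p_in_R[OF j] _ _ j])
    have "linear \<sigma>" by (rule linearI) (simp_all add: \<sigma>_def vec_eq_iff)
    moreover have "\<sigma> x \<bullet> \<sigma> y = x \<bullet> y" for x y
      unfolding inner_vec_def \<sigma>_def by (rule sum.reindex_bij_witness[of _ \<pi> \<pi>]) (auto simp: \<pi>)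
    ultimately show "orthogonal_transformation \<sigma>" by (simp add: orthogonal_transformation_def)
    show "\<sigma> x $ i = x $ i" if "i \<noteq> a j" "i \<noteq> b j" for x i
      using that by (simp add: \<sigma>_def \<pi>_def)
    fix x
    have "\<sigma> x $ a j = x $ b j" "\<sigma> x $ b j = x $ a j"
      using a_neq_b[OF j j] by (auto simp: \<sigma>_def \<pi>_def)
    then have "sc j (real (p j) *\<^sub>R \<sigma> x) = - (real (p j) * sc j x)"
      "tc j (real (p j) *\<^sub>R \<sigma> x) = real (q j) * sc j x + real (p j) * tc j x"
      unfolding scale_coords using alpha_pos[of j] pq_pos[OF j] by (simp_all add: sc_def tc_def field_simps)
    then show "(sc j (real (p j) *\<^sub>R \<sigma> x) \<in> \<int> \<and> tc j (real (p j) *\<^sub>R \<sigma> x) \<in> \<int>) \<longleftrightarrow>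
      X j x \<in> \<int> \<and> Y j x \<in> \<int> \<and> real ((p j)\<^sup>2) * sc j x \<in> \<int> \<and> real ((p j)\<^sup>2) * tc j x \<in> \<int>"
      unfolding X_def Y_def plane_condition_p[OF coprime_pq(1)[OF j], symmetric] by (simp only: minus_in_Ints_iff)
  qed simp
  then show ?thesis by blast
qed

lemma similarity_q:
  assumes j: "j < k"
  shows "\<exists>\<sigma>. modular_similarity lattice ((q j)\<^sup>2) \<sigma>"
proof -
  define \<sigma> where "\<sigma> x = (\<chi> i. if i = b j then - x $ i else x $ i)" for x :: "real ^ 'n"
  have "modular_similarity lattice ((q j)\<^sup>2) \<sigma>"
  proof (rule modular_similarityI[OF _ q_in_R[OF j] _ _ j])
    have "linear \<sigma>" by (rule linearI) (auto simp: \<sigma>_def vec_eq_iff)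
    moreover have "\<sigma> x \<bullet> \<sigma> y = x \<bullet> y" for x y
      unfolding inner_vec_def \<sigma>_def by (intro sum.cong) auto
    ultimately show "orthogonal_transformation \<sigma>" by (simp add: orthogonal_transformation_def)
    show "\<sigma> x $ i = x $ i" if "i \<noteq> a j" "i \<noteq> b j" for x i
      using that by (simp add: \<sigma>_def)
    fix x
    have "\<sigma> x $ a j = x $ a j" "\<sigma> x $ b j = - x $ b j"
      using a_neq_b[OF j j] by (auto simp: \<sigma>_def)
    then have "sc j (real (q j) *\<^sub>R \<sigma> x) = real (q j) * sc j x + 2 * real (p j) * tc j x"
      "tc j (real (q j) *\<^sub>R \<sigma> x) = - (real (q j) * tc j x)"
      unfolding scale_coords using alpha_pos[of j] pq_pos[OF j] by (simp_all add: sc_def tc_def field_simps)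
    then show "(sc j (real (q j) *\<^sub>R \<sigma> x) \<in> \<int> \<and> tc j (real (q j) *\<^sub>R \<sigma> x) \<in> \<int>) \<longleftrightarrow>
      X j x \<in> \<int> \<and> Y j x \<in> \<int> \<and> real ((q j)\<^sup>2) * sc j x \<in> \<int> \<and> real ((q j)\<^sup>2) * tc j x \<in> \<int>"
      unfolding X_def Y_def plane_condition_q[OF coprime_pq(2)[OF j], symmetric] by (simp only: minus_in_Ints_iff)
  qed simp
  then show ?thesis by blast
qed

lemma prime_factors_level: "prime_factors (N\<^sup>2) = R"
proof -
  have "prime r \<and> r dvd N \<longleftrightarrow> r \<in> R" for r
  proof
    assume h: "prime r \<and> r dvd N"
    then obtain s where "s \<in> R" "r dvd s"
      unfolding N_def using finite_R by (auto simp: prime_dvd_prod_iff)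
    then show "r \<in> R" using h prime_R primes_dvd_imp_eq by blast
  next
    assume "r \<in> R"
    then show "prime r \<and> r dvd N" using prime_R N_eq dvd_triv_left by metis
  qed
  moreover have "r \<in> prime_factors (N\<^sup>2) \<longleftrightarrow> prime r \<and> r dvd N" for r
    unfolding in_prime_factors_iff using N_pos prime_dvd_power_iff[of r 2 N] by auto
  ultimately show ?thesis by blast
qed

lemma exact_part_singleton:
  assumes r: "r \<in> R"
  shows "exact_part (N\<^sup>2) {r} = r\<^sup>2"
proof -
  have pr: "prime r" using prime_R[OF r] .
  have "coprime r (\<Prod>(R - {r}))" using r by (intro coprime_R) auto
  then have nd: "\<not> r dvd \<Prod>(R - {r})"
    using pr by (meson coprime_common_divisor dvd_refl not_prime_unit)
  have "multiplicity r N = 1"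
    unfolding N_eq[OF r] using pr nd N_pos prod_R_pos[of "R - {r}"]
    by (subst prime_elem_multiplicity_mult_distrib) (auto simp: not_dvd_imp_multiplicity_0 prime_gt_0_nat)
  then have "multiplicity r (N\<^sup>2) = 2"
    using pr N_pos by (simp add: prime_elem_multiplicity_power_distrib)
  then show ?thesis by (simp add: exact_part_def)
qed

text \<open>The exact divisors of the level are products of the squares of primes in
  \<open>R\<close>, so the swaps and reflections are composed, one prime at a time. On disjoint sets
  of primes the product in \<open>W\<close> corresponds to the union.\<close>

lemma strongly_modular: "strongly_modular lattice"
proof -
  interpret integral_euclidean_lattice lattice by unfold_locales (rule integral)
  have gen: "\<exists>\<sigma>. modular_similarity lattice (exact_part (N\<^sup>2) S) \<sigma>" if "S \<subseteq> R" for S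
    using finite_subset[OF that finite_R] that
  proof (induction S rule: finite_induct)
    case empty
    have "modular_similarity lattice 1 id"
      by (simp add: modular_similarity_one_iff orthogonal_transformation_id_fun del: One_nat_def)
    then show ?case by auto
  next
    case (insert r S)
    have r: "r \<in> R" using insert by simp
    have carr: "exact_part (N\<^sup>2) U \<in> carrier (W (N\<^sup>2))" if "U \<subseteq> R" for U
      using carrier_W[of "N\<^sup>2"] N_pos prime_factors_level that by auto
    obtain \<tau> where \<tau>: "modular_similarity lattice (exact_part (N\<^sup>2) S) \<tau>"
      using insert by auto
    obtain \<sigma> where \<sigma>: "modular_similarity lattice (exact_part (N\<^sup>2) {r}) \<sigma>"
      unfolding exact_part_singleton[OF r] using r similarity_p similarity_q by (auto simp: R_def)
    have "modular_similarity lattice (exact_part (N\<^sup>2) {r} \<otimes>\<^bsub>W (N\<^sup>2)\<^esub> exact_part (N\<^sup>2) S) (\<sigma> \<circ> \<tau>)"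
      using modular_similarity_comp[OF \<sigma> _ \<tau>] carr[of "{r}"] carr[of S] insert by (simp add: level_eq)
    moreover have "exact_part (N\<^sup>2) {r} \<otimes>\<^bsub>W (N\<^sup>2)\<^esub> exact_part (N\<^sup>2) S = exact_part (N\<^sup>2) (sym_diff {r} S)"
      using insert r prime_factors_level by (intro mult_exact_part) auto
    moreover have "sym_diff {r} S = insert r S" using insert by blast
    ultimately show ?case by auto
  qed
  have "I_set lattice = carrier (W (level lattice))"
    unfolding I_set_eq modular_indices_def using gen carrier_W[of "N\<^sup>2"] N_pos prime_factors_level
    by (auto simp: level_eq)
  then show ?thesis using integral by (simp add: strongly_modular_def)
qed

lemma card_primes_level: "card {r. prime r \<and> r dvd level lattice} = 2 * k"
proof -
  have "{r. prime r \<and> r dvd level lattice} = R"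
    unfolding level_eq prime_factors_level[symmetric] using N_pos by (auto simp: in_prime_factors_iff)
  also have "card R = 2 * k"
    unfolding R_def using pq_disj by (simp add: card_Un_disjoint card_image inj_p inj_q)
  finally show ?thesis .
qed

end

text \<open>Coordinates and odd primes are enumerated by \<open>h\<close> and \<open>f\<close>; even
  positions supply \<open>a\<close> and \<open>p\<close>, odd ones \<open>b\<close> and
  \<open>q\<close>. In odd dimension one coordinate stays outside the planes, and in dimension 1 the
  lattice consists of the integers.\<close>

lemma ex_strongly_modular_lattice:
  "\<exists>L :: (real ^ 'n) set. integral_lattice L \<and> strongly_modular L \<and>
     card {p. prime p \<and> p dvd level L} = 2 * (CARD('n) div 2)"
proof -
  have "infinite ({r::nat. prime r} - {..2})"
    using primes_infinite by (rule Diff_infinite_finite[rotated]) simp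
  then obtain f :: "nat \<Rightarrow> nat" where f: "inj f" "range f \<subseteq> {r. prime r} - {..2}"
    using infinite_countable_subset by blast
  obtain h where h: "bij_betw h {0..<CARD('n)} (UNIV :: 'n set)"
    using ex_bij_betw_nat_finite[of "UNIV :: 'n set"] by auto
  have hinj: "h i = h j \<longleftrightarrow> i = j" if "i < CARD('n)" "j < CARD('n)" for i j
    using h that by (auto simp: bij_betw_def inj_on_def)
  have fi: "f i \<in> {r. prime r} - {..2}" for i using f(2) by blast
  have fD: "prime (f i)" "2 < f i" for i using fi[of i] by auto
  interpret plane_system "CARD('n) div 2" "\<lambda>j. h (2 * j)" "\<lambda>j. h (2 * j + 1)" "\<lambda>j. f (2 * j)" "\<lambda>j. f (2 * j + 1)"
  proof
    have odd: "2 * i \<noteq> 2 * j + 1" "2 * j + 1 \<noteq> 2 * i" for i j :: nat by presburger+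
    show "inj_on (\<lambda>j. h (2 * j)) {..<CARD('n) div 2}" "inj_on (\<lambda>j. h (2 * j + 1)) {..<CARD('n) div 2}"
      using hinj by (auto simp: inj_on_def)
    show "(\<lambda>j. h (2 * j)) ` {..<CARD('n) div 2} \<inter> (\<lambda>j. h (2 * j + 1)) ` {..<CARD('n) div 2} = {}"
    proof -
      have "h (2 * i) \<noteq> h (2 * j + 1)" if "i < CARD('n) div 2" "j < CARD('n) div 2" for i j
        using hinj[of "2 * i" "2 * j + 1"] that odd(1)[of i j] by simp
      then show ?thesis by blast
    qed
    show "inj_on (\<lambda>j. f (2 * j)) {..<CARD('n) div 2}" "inj_on (\<lambda>j. f (2 * j + 1)) {..<CARD('n) div 2}"
      by (auto simp: inj_on_def inj_eq[OF f(1)])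
    show "(\<lambda>j. f (2 * j)) ` {..<CARD('n) div 2} \<inter> (\<lambda>j. f (2 * j + 1)) ` {..<CARD('n) div 2} = {}"
    proof -
      have "f (2 * i) \<noteq> f (2 * j + 1)" for i j
        using f(1) odd(1)[of i j] by (auto dest: injD)
      then show ?thesis by blast
    qed
  qed (use fD in auto)
  show ?thesis using integral strongly_modular card_primes_level by blast
qed

theorem theorem2p2:
  shows "(\<forall>\<Lambda> :: (real ^ 'n) set. integral_lattice \<Lambda> \<longrightarrow>
            F2_dim (I_group \<Lambda>) \<le> 2 * (CARD('n) div 2))
       \<and> (\<forall>\<Lambda> :: (real ^ 'n) set. integral_lattice \<Lambda> \<and> strongly_modular \<Lambda> \<longrightarrow>
            card {p. prime p \<and> p dvd level \<Lambda>} \<le> 2 * (CARD('n) div 2))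
       \<and> (\<exists>\<Lambda> :: (real ^ 'n) set. integral_lattice \<Lambda> \<and> strongly_modular \<Lambda> \<and>
            card {p. prime p \<and> p dvd level \<Lambda>} = 2 * (CARD('n) div 2))"
  using F2_dim_I_group_bound ex_strongly_modular_lattice by blast

end
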